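(* Let $\theta$ be an inner function in $H^\infty(\mathbb{D}^n)$ and $n\ge 3$. Then the Beurling type quotient module $\mathcal{Q}_\theta = H^2(\mathbb{D}^n)\ominus \theta H^2(\mathbb{D}^n)$ is not essentially normal.
   Context: $\mathbb{D}^n$ is the open unit polydisc in $\mathbb{C}^n$ and $H^2(\mathbb{D}^n)$ is the Hardy space of holomorphic functions $f=\sum_{\bm k\in\mathbb{N}^n}a_{\bm k}\bm z^{\bm k}$ on $\mathbb{D}^n$ with $\|f\|^2=\sum|a_{\bm k}|^2<\infty$. $M_{z_i}$ denotes multiplication by the $i$-th coordinate function on $H^2(\mathbb{D}^n)$. An inner function is a bounded analytic function $\theta$ on $\mathbb{D}^n$ with $|\theta|=1$ a.e. on the distinguished boundary $\mathbb{T}^n$. A closed subspace $\mathcal{Q}\subseteq H^2(\mathbb{D}^n)$ is a quotient module if $\mathcal{Q}^\perp$ is invariant under all $M_{z_i}$. For a quotient module $\mathcal{Q}$ put $C_{z_i}=P_{\mathcal{Q}}M_{z_i}|_{\mathcal{Q}}$, where $P_{\mathcal{Q}}$ is the orthogonal projection onto $\mathcal{Q}$. $\mathcal{Q}$ is essentially normal if $[C_{z_i},C_{z_j}^*]=C_{z_i}C_{z_j}^*-C_{z_j}^*C_{z_i}$ is compact for all $1\le i,j\le n$.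
   Formalization: The inner function θ is assumed nonconstant; for a unimodular constant θ the quotient module is {0}, which is trivially essentially normal, so the statement fails as written in that case. *)

theory Defs
  imports "HOL-Analysis.Analysis"
begin

definition polydisc :: "(complex ^ 'n) set" where
  "polydisc = {z. \<forall>i. cmod (z $ i) < 1}"

text \<open>Holomorphy in several variables: continuous, and holomorphic in each variable separately.\<close>

definition polydisc_holomorphic :: "(complex ^ 'n \<Rightarrow> complex) \<Rightarrow> bool" where
  "polydisc_holomorphic f \<longleftrightarrow>
     continuous_on polydisc f \<and>
     (\<forall>z\<in>polydisc. \<forall>i. (\<lambda>w. f (\<chi> j. if j = i then w else z $ j)) holomorphic_on ball 0 1)"

definition multi_power :: "complex ^ 'n \<Rightarrow> ('n::finite \<Rightarrow> nat) \<Rightarrow> complex" where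
  "multi_power z k = (\<Prod>i\<in>UNIV. (z $ i) ^ k i)"

definition power_series_of :: "(complex ^ 'n \<Rightarrow> complex) \<Rightarrow> (('n::finite \<Rightarrow> nat) \<Rightarrow> complex) \<Rightarrow> bool" where
  "power_series_of f a \<longleftrightarrow>
     (\<forall>z\<in>polydisc. ((\<lambda>k. a k * multi_power z k) has_sum f z) UNIV)"

text \<open>
  A function on the polydisc is represented by its extension by \<open>0\<close> to the whole space, so that
  equality of elements of \<open>H\<^sup>2\<close> is equality of functions and the vector space
  operations are the pointwise ones.
\<close>

definition hardy_space :: "(complex ^ 'n::finite \<Rightarrow> complex) set" where
  "hardy_space = {f. (\<forall>z. z \<notin> polydisc \<longrightarrow> f z = 0) \<and> polydisc_holomorphic f \<and>
     (\<exists>a. power_series_of f a \<and> (\<lambda>k. (cmod (a k))\<^sup>2) summable_on UNIV)}"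

text \<open>The power series coefficients of a function on the polydisc are unique.\<close>

definition hardy_coeff :: "(complex ^ 'n::finite \<Rightarrow> complex) \<Rightarrow> ('n \<Rightarrow> nat) \<Rightarrow> complex" where
  "hardy_coeff f = (THE a. power_series_of f a)"

definition hardy_inner :: "(complex ^ 'n::finite \<Rightarrow> complex) \<Rightarrow> (complex ^ 'n \<Rightarrow> complex) \<Rightarrow> complex" where
  "hardy_inner f g = (\<Sum>\<^sub>\<infinity>k. hardy_coeff f k * cnj (hardy_coeff g k))"

definition hardy_norm :: "(complex ^ 'n::finite \<Rightarrow> complex) \<Rightarrow> real" where
  "hardy_norm f = sqrt (\<Sum>\<^sub>\<infinity>k. (cmod (hardy_coeff f k))\<^sup>2)"

definition hardy_orthocomplement ::
    "(complex ^ 'n::finite \<Rightarrow> complex) set \<Rightarrow> (complex ^ 'n \<Rightarrow> complex) set" where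
  "hardy_orthocomplement S = {f \<in> hardy_space. \<forall>g\<in>S. hardy_inner f g = 0}"

text \<open>Normalized Lebesgue measure on the distinguished boundary of the polydisc.\<close>

definition torus_measure :: "(complex ^ 'n::finite) measure" where
  "torus_measure =
     distr (uniform_measure lborel (cbox 0 (\<chi> i. 2 * pi) :: (real ^ 'n) set)) borel
       (\<lambda>t. \<chi> i. cis (t $ i))"

text \<open>Boundary values are radial limits.\<close>

definition inner_function :: "(complex ^ 'n::finite \<Rightarrow> complex) \<Rightarrow> bool" where
  "inner_function \<theta> \<longleftrightarrow>
     polydisc_holomorphic \<theta> \<and> bounded (\<theta> ` polydisc) \<and>
     (AE \<zeta> in torus_measure.
        \<exists>w. cmod w = 1 \<and> ((\<lambda>r. \<theta> (r *\<^sub>R \<zeta>)) \<longlongrightarrow> w) (at_left (1::real)))"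

definition beurling_quotient ::
    "(complex ^ 'n::finite \<Rightarrow> complex) \<Rightarrow> (complex ^ 'n \<Rightarrow> complex) set" where
  "beurling_quotient \<theta> = hardy_orthocomplement ((\<lambda>h z. \<theta> z * h z) ` hardy_space)"

definition coord_mult :: "'n \<Rightarrow> (complex ^ 'n::finite \<Rightarrow> complex) \<Rightarrow> complex ^ 'n \<Rightarrow> complex" where
  "coord_mult i f = (\<lambda>z. z $ i * f z)"

text \<open>
  Operators on a closed subspace \<open>Q\<close> of \<open>H\<^sup>2\<close> are functions of which only the
  values on \<open>Q\<close> matter.  Orthogonal projections and adjoints are given by their defining
  properties; these determine them uniquely when \<open>Q\<close> is a closed subspace and \<open>T\<close> is a bounded
  linear operator from \<open>Q\<close> to \<open>Q\<close>.
\<close>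

definition hardy_proj ::
    "(complex ^ 'n::finite \<Rightarrow> complex) set \<Rightarrow> (complex ^ 'n \<Rightarrow> complex) \<Rightarrow> (complex ^ 'n \<Rightarrow> complex)" where
  "hardy_proj Q f = (THE g. g \<in> Q \<and> (\<forall>h\<in>Q. hardy_inner (\<lambda>z. f z - g z) h = 0))"

definition hardy_adjoint ::
    "(complex ^ 'n::finite \<Rightarrow> complex) set \<Rightarrow> ((complex ^ 'n \<Rightarrow> complex) \<Rightarrow> (complex ^ 'n \<Rightarrow> complex))
      \<Rightarrow> (complex ^ 'n \<Rightarrow> complex) \<Rightarrow> (complex ^ 'n \<Rightarrow> complex)" where
  "hardy_adjoint Q T g = (THE h. h \<in> Q \<and> (\<forall>f\<in>Q. hardy_inner (T f) g = hardy_inner f h))"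

definition compact_operator_on ::
    "(complex ^ 'n::finite \<Rightarrow> complex) set \<Rightarrow> ((complex ^ 'n \<Rightarrow> complex) \<Rightarrow> (complex ^ 'n \<Rightarrow> complex))
      \<Rightarrow> bool" where
  "compact_operator_on Q T \<longleftrightarrow>
     (\<forall>f. (\<forall>m::nat. f m \<in> Q) \<and> (\<exists>B. \<forall>m. hardy_norm (f m) \<le> B) \<longrightarrow>
        (\<exists>g\<in>Q. \<exists>s::nat \<Rightarrow> nat. strict_mono s \<and>
           (\<lambda>m. hardy_norm (\<lambda>z. T (f (s m)) z - g z)) \<longlonglongrightarrow> 0))"

definition compressed_mult ::
    "(complex ^ 'n::finite \<Rightarrow> complex) set \<Rightarrow> 'n \<Rightarrow> (complex ^ 'n \<Rightarrow> complex)
      \<Rightarrow> (complex ^ 'n \<Rightarrow> complex)" where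
  "compressed_mult Q i f = hardy_proj Q (coord_mult i f)"

definition cross_commutator ::
    "(complex ^ 'n::finite \<Rightarrow> complex) set \<Rightarrow> 'n \<Rightarrow> 'n \<Rightarrow> (complex ^ 'n \<Rightarrow> complex)
      \<Rightarrow> (complex ^ 'n \<Rightarrow> complex)" where
  "cross_commutator Q i j f =
     (\<lambda>z. compressed_mult Q i (hardy_adjoint Q (compressed_mult Q j) f) z
        - hardy_adjoint Q (compressed_mult Q j) (compressed_mult Q i f) z)"

definition essentially_normal :: "(complex ^ 'n::finite \<Rightarrow> complex) set \<Rightarrow> bool" where
  "essentially_normal Q \<longleftrightarrow> (\<forall>i j. compact_operator_on Q (cross_commutator Q i j))"

end

theory Submission
  imports Defs "HOL-Probability.Infinite_Product_Measure" "HOL-Complex_Analysis.Complex_Analysis"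
    "HOL-Real_Asymp.Real_Asymp"
begin

text \<open>
  Write \<open>D\<^sub>i\<theta>(z) = \<theta>(z) - \<theta>(z\<^bsub>i:=0\<^esub>)\<close> and let \<open>K\<^sub>w\<close> be the Szego kernel.  The projection of \<open>K\<^sub>w\<close> to the
  quotient module is \<open>f\<^sub>w = (1 - cnj (\<theta>(w)) \<theta>) K\<^sub>w\<close>.  For \<open>i \<noteq> j\<close> the operator \<open>T = [C\<^sub>i, C\<^sub>j*]\<close> satisfies
  \<open>cnj w\<^sub>i v\<^sub>j (T f\<^sub>w)(v) = cnj (D\<^sub>i\<theta>(w)) D\<^sub>j\<theta>(v) K(w\<^bsub>i:=0\<^esub>, v\<^bsub>j:=0\<^esub>)\<close>.
  Let a third coordinate \<open>w\<^sub>k\<close> tend to the circle and keep the others fixed: \<open>f\<^sub>w / \<parallel>K\<^sub>w\<parallel>\<close> tends weakly to \<open>0\<close>,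
  so compactness of \<open>T\<close> makes \<open>T f\<^sub>w / \<parallel>K\<^sub>w\<parallel>\<close> tend to \<open>0\<close> in norm.  Evaluating at \<open>v\<close> with \<open>v\<^sub>l = w\<^sub>l\<close> for
  \<open>l \<noteq> i, j\<close> gives \<open>D\<^sub>i\<theta>(w) D\<^sub>j\<theta>(v) \<rightarrow> 0\<close>, and the maximum principle in the variable \<open>w\<^sub>k = v\<^sub>k\<close> shows that this
  product vanishes.  Hence \<open>D\<^sub>i\<theta> = 0\<close> or \<open>D\<^sub>j\<theta> = 0\<close>, so \<open>\<theta>\<close> depends on one variable \<open>z\<^sub>i\<close> only.  Then for
  \<open>j \<noteq> i\<close> and \<open>w\<^sub>j = 0\<close> one has \<open>[C\<^sub>j, C\<^sub>j*] f\<^sub>w = - f\<^sub>w\<close>, which contradicts compactness along the same kind of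
  sequence, since \<open>\<parallel>f\<^sub>w\<parallel>\<^sup>2 / \<parallel>K\<^sub>w\<parallel>\<^sup>2 = 1 - |\<theta>(w)|\<^sup>2\<close> stays constant and positive.
\<close>

section \<open>Integration over the torus\<close>

no_notation fps_nth (infixl \<open>$\<close> 75)

text \<open>Projections and adjoints are given by definite descriptions, so every operator first
  needs an explicit form: \<open>adj\<close> is the adjoint of multiplication by \<theta>,
  \<open>proj\<close> is the identity minus \<theta> times \<open>adj\<close>, and the adjoint of a
  compressed shift is the backward shift \<open>bshift\<close>. All of this rests on one analytic
  fact, that multiplication by \<theta> is an isometry. Only there do the boundary values of
  \<theta> enter, and testing monomials is enough; boundary values of general Hardy functions never
  occur. Why three variables: in the kernel value at w with w_i = 0 and v with v_j = 0, the factors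
  for i and j are 1, so a further coordinate must supply growth comparable to the product of the two
  kernel norms. Constants are excluded because for a unimodular constant the quotient module is zero
  and its commutators are compact. Formulas for backward shifts stay multiplied by z_i, since a
  difference quotient leaves z_i = 0 open; injectivity of multiplication by z_i then recovers the
  full identity.\<close>

definition circ :: "real measure" where
  "circ = density lborel (\<lambda>x. ennreal (indicator {0..2*pi} x / (2*pi)))"

lemma sets_circ [simp, measurable_cong]: "sets circ = sets borel"
  by (simp add: circ_def)

lemma space_circ [simp]: "space circ = UNIV"
  by (simp add: circ_def)

lemma prob_space_circ: "prob_space circ"
proof
  have "emeasure circ (space circ) = (\<integral>\<^sup>+x. ennreal (1/(2*pi)) * indicator {0..2*pi} x \<partial>lborel)"
    by (auto simp: circ_def emeasure_density intro!: nn_integral_cong split: split_indicator)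
  also have "\<dots> = 1"
    by (subst nn_integral_cmult_indicator) (auto simp flip: ennreal_mult')
  finally show "emeasure circ (space circ) = 1" .
qed

interpretation circ: prob_space circ by (rule prob_space_circ)

interpretation tor: product_sigma_finite "\<lambda>_. circ"
  by standard

lemma circ_integral:
  fixes f :: "real \<Rightarrow> complex"
  assumes "continuous_on UNIV f" "(f has_integral I) {0..2*pi}"
  shows "integral\<^sup>L circ f = I / (2*pi)"
proof -
  have [measurable]: "f \<in> borel_measurable borel"
    by (rule borel_measurable_continuous_onI) fact
  have c: "continuous_on {0..2*pi} f"
    using assms(1) continuous_on_subset by blast
  have "integral\<^sup>L circ f = (\<integral>x. (indicator {0..2*pi} x / (2*pi)) *\<^sub>R f x \<partial>lborel)"
    unfolding circ_def by (subst integral_density) auto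
  also have "\<dots> = (\<integral>x. (indicator {0..2*pi} x *\<^sub>R f x) / complex_of_real (2*pi) \<partial>lborel)"
    by (intro Bochner_Integration.integral_cong refl) (simp add: scaleR_conv_of_real)
  also have "\<dots> = (LINT x:{0..2*pi}|lborel. f x) / complex_of_real (2*pi)"
    by (simp add: set_lebesgue_integral_def)
  also have "(LINT x:{0..2*pi}|lborel. f x) = integral {0..2*pi} f"
    by (rule set_borel_integral_eq_integral) (rule borel_integrable_atLeastAtMost'[OF c])
  also have "\<dots> = I" using assms(2) by (rule integral_unique)
  finally show ?thesis by simp
qed

lemma circ_integral_cis:
  "integral\<^sup>L circ (\<lambda>t. cis (of_int m * t)) = (if m = 0 then 1 else 0)"
proof (cases "m = 0")
  case True
  then show ?thesis using circ.prob_space by simp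
next
  case False
  have "((\<lambda>t. cis (of_int m * t)) has_integral
      (cis (of_int m * (2*pi)) / (\<i> * of_int m) - cis (of_int m * 0) / (\<i> * of_int m))) {0..2*pi}"
  proof (intro fundamental_theorem_of_calculus)
    fix x :: real
    have "((\<lambda>z. exp (\<i> * of_int m * z) / (\<i> * of_int m)) has_field_derivative exp (\<i> * of_int m * x)) (at (of_real x))"
      using False by (auto intro!: derivative_eq_intros)
    hence "((\<lambda>t. exp (\<i> * of_int m * of_real t) / (\<i> * of_int m)) has_vector_derivative exp (\<i> * of_int m * x)) (at x within {0..2*pi})"
      by (rule has_vector_derivative_real_field)
    then show "((\<lambda>t. cis (of_int m * t) / (\<i> * of_int m)) has_vector_derivative cis (of_int m * x)) (at x within {0..2*pi})"
      by (simp add: cis_conv_exp mult.assoc)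
  qed auto
  moreover have "cis (of_int m * (2*pi)) = 1"
    by (metis cis_multiple_2pi Ints_of_int mult.commute)
  ultimately have "((\<lambda>t. cis (of_int m * t)) has_integral 0) {0..2*pi}" by simp
  from circ_integral[OF _ this] show ?thesis using False
    by (simp add: continuous_intros)
qed

text \<open>Cauchy's formula in the angle variable: cancelling u in u / (u - z) gives 1 / (1 - z/u),
  whose geometric series later produces power series expansions.\<close>

lemma circ_Cauchy:
  assumes g: "g holomorphic_on ball 0 1" and r: "0 < r" "r < 1" and z: "cmod z < r"
  shows "integral\<^sup>L circ (\<lambda>t. g (r * cis t) / (1 - z * cis (-t) / r)) = g z"
proof -
  have g': "g holomorphic_on cball 0 r"
    using g r by (auto intro: holomorphic_on_subset)
  have ne: "r * cis t \<noteq> z" for t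
    using z r by (auto simp: norm_mult)
  have "((\<lambda>u. g u/(u-z)) has_contour_integral (2 * of_real pi * \<i> * g z)) (circlepath 0 r)"
    using Cauchy_integral_circlepath_simple[OF g', of z] z by simp
  hence "((\<lambda>t. g (0 + r * cis t) / (0 + r * cis t - z) * r * \<i> * cis t) has_integral (2 * of_real pi * \<i> * g z)) {0..2*pi}"
    unfolding circlepath_def by (subst (asm) has_contour_integral_part_circlepath_iff) auto
  \<comment> \<open>The factor \<open>-\<i>\<close> removes the \<i> that comes from du = \<i> u
    dt.\<close>
  hence "((\<lambda>t. (-\<i>) * (g (0 + r * cis t) / (0 + r * cis t - z) * r * \<i> * cis t)) has_integral (-\<i>) * (2 * of_real pi * \<i> * g z)) {0..2*pi}"
    by (rule has_integral_mult_right)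
  also have "(\<lambda>t. (-\<i>) * (g (0 + r * cis t) / (0 + r * cis t - z) * r * \<i> * cis t))
      = (\<lambda>t. g (r * cis t) / (1 - z * cis (-t) / r))"
  proof
    fix t
    have alg: "(-\<i>) * (G / (0 + R * c - z) * R * \<i> * c) = G / (1 - z * inverse c / R)"
      if "R \<noteq> 0" "c \<noteq> 0" "R * c - z \<noteq> 0" for R c G :: complex
    proof -
      have e: "1 - z * inverse c / R = (R * c - z) / (R * c)"
        using that by (simp add: field_simps)
      show ?thesis unfolding e using that by (simp add: field_simps)
    qed
    show "(-\<i>) * (g (0 + r * cis t) / (0 + r * cis t - z) * r * \<i> * cis t) = g (r * cis t) / (1 - z * cis (-t) / r)"
      using alg[of "complex_of_real r" "cis t" "g (r * cis t)"] ne[of t] r by (simp flip: cis_inverse)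
  qed
  also have "(-\<i>) * (2 * of_real pi * \<i> * g z) = 2 * of_real pi * g z"
    by (simp add: algebra_simps)
  finally have *: "((\<lambda>t. g (r * cis t) / (1 - z * cis (-t) / r)) has_integral 2 * of_real pi * g z) {0..2*pi}" .
  have c: "continuous_on UNIV (\<lambda>t. g (r * cis t) / (1 - z * cis (-t) / r))"
  proof (intro continuous_intros ballI)
    show "continuous_on UNIV (\<lambda>t. g (r * cis t))"
      by (rule continuous_on_compose2[OF holomorphic_on_imp_continuous_on[OF g]])
         (use r in \<open>auto intro!: continuous_intros simp: norm_mult\<close>)
    show "1 - z * cis (-t) / r \<noteq> 0" for t
    proof
      assume "1 - z * cis (-t) / r = 0"
      hence "z * cis (-t) = r" using r by (simp add: field_simps)
      hence "cmod (z * cis (-t)) = cmod r" by simp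
      thus False using z r by (simp add: norm_mult)
    qed
  qed (use r in auto)
  show ?thesis using circ_integral[OF c *] by simp
qed

section \<open>The torus as a product of angle measures\<close>

definition vcis :: "('n \<Rightarrow> real) \<Rightarrow> complex ^ 'n::finite" where
  "vcis x = (\<chi> i. cis (x i))"

abbreviation torus :: "('n::finite \<Rightarrow> real) measure" where
  "torus \<equiv> PiM UNIV (\<lambda>_. circ)"

lemma torus_prob_space: "prob_space (PiM S (\<lambda>_. circ))"
  by (rule prob_space_PiM) (rule prob_space_circ)

lemma measurable_vec_lambda [measurable (raw)]:
  fixes g :: "'a \<Rightarrow> 'n::finite \<Rightarrow> 'b::euclidean_space"
  assumes "\<And>i. (\<lambda>x. g x i) \<in> borel_measurable M"
  shows "(\<lambda>x. \<chi> i. g x i) \<in> borel_measurable M"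
  by (subst borel_measurable_euclidean_space)
     (use assms in \<open>auto simp: Basis_vec_def inner_axis intro!: borel_measurable_inner\<close>)

text \<open>Boxes determine Lebesgue measure, and the preimage of a box is a product of intervals.
  This links measures on vectors to products over functions, where Fubini is applied.\<close>

lemma lborel_vec:
  "(lborel :: (real ^ 'n::finite) measure) = distr (PiM UNIV (\<lambda>_. lborel)) borel (\<lambda>x. \<chi> i. x i)"
proof (rule lborel_eqI)
  interpret product_sigma_finite "\<lambda>_::'n. lborel :: real measure" by standard
  fix l u :: "real ^ 'n" assume le: "\<And>b. b \<in> Basis \<Longrightarrow> l \<bullet> b \<le> u \<bullet> b"
  have B: "(Basis :: (real ^ 'n) set) = range (\<lambda>i. axis i 1)"
    by (auto simp: Basis_vec_def)
  have le': "l $ i \<le> u $ i" for i using le[of "axis i 1"] by (simp add: inner_axis axis_in_Basis_iff)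
  have "emeasure (distr (PiM UNIV (\<lambda>_. lborel)) borel (\<lambda>x. \<chi> i. x i)) (box l u)
      = emeasure (PiM UNIV (\<lambda>_. lborel)) (PiE UNIV (\<lambda>i. {l $ i<..<u $ i}))"
    by (subst emeasure_distr) (auto simp: mem_box_cart space_PiM PiE_iff intro!: arg_cong[where f="emeasure _"])
  also have "\<dots> = (\<Prod>i\<in>UNIV. ennreal (u $ i - l $ i))"
    by (subst emeasure_PiM) (auto simp: le')
  also have "\<dots> = ennreal (\<Prod>i\<in>UNIV. u $ i - l $ i)"
    by (rule prod_ennreal) (auto simp: le')
  also have "(\<Prod>i\<in>UNIV. u $ i - l $ i) = (\<Prod>b\<in>Basis. (u - l) \<bullet> b)"
    unfolding B by (subst prod.reindex) (simp_all add: inj_on_def axis_eq_axis inner_axis)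
  finally show "emeasure (distr (PiM UNIV (\<lambda>_. lborel)) borel (\<lambda>x. \<chi> i. x i)) (box l u)
    = ennreal (\<Prod>b\<in>Basis. (u - l) \<bullet> b)" .
qed simp

text \<open>Rectangles determine a product measure, and on a rectangle the integral of the product
  density splits into one-variable integrals.\<close>

lemma torus_density:
  "(torus :: ('n::finite \<Rightarrow> real) measure) =
     density (PiM UNIV (\<lambda>_. lborel)) (\<lambda>x. \<Prod>i\<in>UNIV. ennreal (indicator {0..2*pi} (x i) / (2*pi)))"
proof (rule sym, rule tor.PiM_eqI)
  interpret L: product_sigma_finite "\<lambda>_::'n. lborel :: real measure" by standard
  fix A :: "'n \<Rightarrow> real set" assume "\<And>i. i \<in> UNIV \<Longrightarrow> A i \<in> sets circ"
  hence [measurable]: "A i \<in> sets borel" for i by simp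
  have [measurable]: "PiE UNIV A \<in> sets (PiM UNIV (\<lambda>_. lborel))"
    by (intro sets_PiM_I_finite) auto
  have "emeasure (density (PiM UNIV (\<lambda>_. lborel)) (\<lambda>x. \<Prod>i\<in>UNIV. ennreal (indicator {0..2*pi} (x i) / (2*pi)))) (PiE UNIV A)
     = (\<integral>\<^sup>+x. (\<Prod>i\<in>UNIV. ennreal (indicator {0..2*pi} (x i) / (2*pi)) * indicator (A i) (x i)) \<partial>PiM UNIV (\<lambda>_. lborel))"
    by (subst emeasure_density)
       (auto intro!: nn_integral_cong simp: prod.distrib indicator_def PiE_iff prod_zero_iff split: if_splits)
  also have "\<dots> = (\<Prod>i\<in>UNIV. emeasure circ (A i))"
    by (subst L.product_nn_integral_prod) (auto simp: circ_def emeasure_density)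
  finally show "emeasure (density (PiM UNIV (\<lambda>_. lborel)) (\<lambda>x. \<Prod>i\<in>UNIV. ennreal (indicator {0..2*pi} (x i) / (2*pi)))) (PiE UNIV A) = (\<Prod>i\<in>UNIV. emeasure circ (A i))" .
qed (auto intro!: sets_PiM_cong)

text \<open>Only null sets are transferred, so \<open>P\<close> may be an arbitrary predicate, such
  as the existence of a radial limit.\<close>

lemma AE_torus_measureD:
  fixes P :: "complex ^ 'n::finite \<Rightarrow> bool"
  assumes "AE \<zeta> in torus_measure. P \<zeta>"
  shows "AE x in torus. P (vcis x)"
proof -
  let ?C = "cbox 0 (\<chi> i. 2 * pi) :: (real ^ 'n) set"
  have m: "(\<lambda>t :: real ^ 'n. (\<chi> i. cis (t $ i)) :: complex ^ 'n) \<in> borel_measurable borel"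
    by (intro borel_measurable_continuous_onI continuous_intros continuous_on_vec_lambda)
  have "AE t in uniform_measure lborel ?C. P (\<chi> i. cis (t $ i))"
    by (rule AE_distrD[OF _ assms[unfolded torus_measure_def]]) (use m in simp)
  moreover have "emeasure lborel ?C \<noteq> 0"
  proof -
    have "(\<Prod>b\<in>Basis. ((\<chi> i. 2 * pi) - 0 :: real ^ 'n) \<bullet> b) > 0"
      by (rule prod_pos) (auto simp: Basis_vec_def inner_axis)
    then show ?thesis
      by (subst emeasure_lborel_cbox) (auto simp: Basis_vec_def inner_axis ennreal_eq_0_iff)
  qed
  ultimately have "AE t in lborel. t \<in> ?C \<longrightarrow> P (\<chi> i. cis (t $ i))"
    using emeasure_lborel_cbox_finite[of "0 :: real ^ 'n" "\<chi> i. 2 * pi"]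
    by (subst (asm) AE_uniform_measure) simp_all
  hence "AE t in distr (PiM UNIV (\<lambda>_. lborel)) borel (\<lambda>x. \<chi> i. x i). t \<in> ?C \<longrightarrow> P (\<chi> i. cis (t $ i))"
    by (subst (asm) lborel_vec)
  hence "AE x in PiM UNIV (\<lambda>_. lborel). (\<chi> i. x i) \<in> ?C \<longrightarrow> P (\<chi> i. cis ((\<chi> i. x i) $ i))"
    by (rule AE_distrD[rotated]) simp
  moreover have "(\<chi> i. x i) \<in> ?C"
    if "0 < (\<Prod>i\<in>UNIV. ennreal (indicator {0..2*pi} (x i) / (2*pi)))" for x :: "'n \<Rightarrow> real"
  proof -
    have "(\<Prod>i\<in>UNIV. ennreal (indicator {0..2*pi} (x i) / (2*pi))) \<noteq> 0"
      using that by (metis less_irrefl)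
    moreover have "(\<Prod>i\<in>UNIV. ennreal (indicator {0..2*pi} (x i) / (2*pi))) = 0" if "x i \<notin> {0..2*pi}" for i
      by (rule prod_zero, simp, rule bexI[of _ i]) (use that in auto)
    ultimately have "x i \<in> {0..2*pi}" for i by blast
    then show ?thesis by (simp add: mem_box_cart)
  qed
  ultimately show ?thesis
    unfolding torus_density
    by (subst AE_density) (auto simp: vcis_def elim!: eventually_mono)
qed

section \<open>Cauchy formula and power series\<close>

lemma open_polydisc: "open (polydisc :: (complex ^ 'n::finite) set)"
proof -
  have "polydisc = (\<Inter>i. {z :: complex ^ 'n. cmod (z $ i) < 1})" by (auto simp: polydisc_def)
  also have "open \<dots>" by (intro open_INT ballI open_Collect_less continuous_intros) auto
  finally show ?thesis .
qed

lemma compact_closed_polydisc: "compact {z :: complex ^ 'n::finite. \<forall>i. cmod (z $ i) \<le> r}"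
proof -
  have "{z :: complex ^ 'n. \<forall>i. cmod (z $ i) \<le> r} = (\<Inter>i. {z. cmod (z $ i) \<le> r})" by auto
  moreover have "closed \<dots>" by (intro closed_INT ballI closed_Collect_le continuous_intros)
  moreover have "bounded {z :: complex ^ 'n. \<forall>i. cmod (z $ i) \<le> r}"
  proof (rule boundedI)
    fix z :: "complex ^ 'n" assume "z \<in> {z. \<forall>i. cmod (z $ i) \<le> r}"
    hence "(\<Sum>i\<in>UNIV. cmod (z $ i)) \<le> (\<Sum>i\<in>(UNIV::'n set). r)" by (intro sum_mono) auto
    then show "norm z \<le> (\<Sum>i\<in>(UNIV::'n set). r)"
      using L2_set_le_sum[of UNIV "\<lambda>i. cmod (z $ i)"] by (simp add: norm_vec_def)
  qed
  ultimately show ?thesis by (simp add: compact_eq_bounded_closed)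
qed

lemma closed_polydisc_subset: "r < 1 \<Longrightarrow> {z. \<forall>i. cmod (z $ i) \<le> r} \<subseteq> polydisc"
  by (auto simp: polydisc_def intro: le_less_trans)

text \<open>Finitely many coordinates have a maximum below 1. The extra bound \<open>s\<close> lets
  the radius also exceed a number fixed beforehand.\<close>

lemma polydisc_bounded_radius:
  fixes z :: "complex ^ 'n::finite"
  assumes "z \<in> polydisc" "s < 1"
  obtains r where "s < r" "0 < r" "r < 1" "\<And>i. cmod (z $ i) < r"
proof -
  let ?m = "Max (insert s (insert 0 (range (\<lambda>i. cmod (z $ i)))))"
  have "?m < 1" using assms by (subst Max_less_iff) (auto simp: polydisc_def)
  then obtain r where r: "?m < r" "r < 1" using dense by blast
  hence "s < r \<and> 0 < r \<and> (\<forall>i. cmod (z $ i) < r)"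
    by (subst (asm) Max_less_iff) auto
  then show ?thesis using that r by blast
qed

text \<open>Cutting \<open>f\<close> off by the indicator of the polydisc gives a Borel function on
  the whole space, and the cutoff is invisible along \<open>g\<close>.\<close>

lemma measurable_polydisc_compose:
  fixes f :: "complex ^ 'n::finite \<Rightarrow> complex"
  assumes "continuous_on polydisc f" "g \<in> borel_measurable M" "\<And>x. x \<in> space M \<Longrightarrow> g x \<in> polydisc"
  shows "(\<lambda>x. f (g x)) \<in> borel_measurable M"
proof -
  have [measurable]: "(\<lambda>z. indicator polydisc z *\<^sub>R f z) \<in> borel_measurable borel"
    by (rule borel_measurable_continuous_on_indicator) (use assms in \<open>auto intro: borel_open open_polydisc\<close>)
  have "(\<lambda>x. indicator polydisc (g x) *\<^sub>R f (g x)) \<in> borel_measurable M"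
    using assms(2) by measurable
  then show ?thesis
    by (rule measurable_cong[THEN iffD1, rotated]) (use assms(3) in auto)
qed

lemma polydisc_holomorphic_continuous: "polydisc_holomorphic f \<Longrightarrow> continuous_on polydisc f"
  by (simp add: polydisc_holomorphic_def)

lemma bounded_on_closed_polydisc:
  fixes f :: "complex ^ 'n::finite \<Rightarrow> complex"
  assumes "continuous_on polydisc f" "r < 1"
  obtains B where "B \<ge> 0" "\<And>z. (\<And>i. cmod (z $ i) \<le> r) \<Longrightarrow> cmod (f z) \<le> B"
proof -
  have "compact (f ` {z. \<forall>i. cmod (z $ i) \<le> r})"
    using assms closed_polydisc_subset[of r]
    by (intro compact_continuous_image compact_closed_polydisc) (auto intro: continuous_on_subset)
  then obtain B where "\<forall>x\<in>f ` {z. \<forall>i. cmod (z $ i) \<le> r}. cmod x \<le> B"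
    using compact_imp_bounded bounded_iff by metis
  then show ?thesis using that[of "max B 0"] by (force simp: le_max_iff_disj)
qed

text \<open>Coordinates in \<open>S\<close> run over the circle of radius \<open>r\<close>, the
  others are frozen at \<open>z\<close>. This intermediate form supports an induction over
  \<open>S\<close>; \<open>S = UNIV\<close> is the full formula.\<close>

lemma polydisc_Cauchy_partial:
  fixes f :: "complex ^ 'n::finite \<Rightarrow> complex"
  assumes f: "polydisc_holomorphic f" and r: "0 < r" "r < 1" and z: "\<And>i. cmod (z $ i) < r"
    and S: "finite S"
  shows "(\<integral>x. f (\<chi> i. if i \<in> S then r * cis (x i) else z $ i) * (\<Prod>i\<in>S. 1 / (1 - z $ i * cis (- x i) / r))
           \<partial>PiM S (\<lambda>_. circ)) = f z"
  using S
proof (induction S)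
  case empty
  then show ?case by (simp add: PiM_empty lebesgue_integral_count_space_finite)
next
  case (insert j S)
  let ?F = "\<lambda>x. f (\<chi> i. if i \<in> insert j S then r * cis (x i) else z $ i) * (\<Prod>i\<in>insert j S. 1 / (1 - z $ i * cis (- x i) / r))"
  have c: "continuous_on polydisc f" using f by (rule polydisc_holomorphic_continuous)
  have zp: "(\<chi> i. if i \<in> T then r * cis (x i) else z $ i) \<in> polydisc" for x T
    using z r by (auto simp: polydisc_def norm_mult intro: less_trans)
  obtain B where B: "B \<ge> 0" "\<And>z. (\<And>i. cmod (z $ i) \<le> r) \<Longrightarrow> cmod (f z) \<le> B"
    using bounded_on_closed_polydisc[OF c r(2)] by blast
  have kb: "cmod (1 / (1 - z $ i * cis (- t) / r)) \<le> 1 / (1 - cmod (z $ i) / r)" for i t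
  proof -
    have "cmod (z $ i * cis (- t) / r) = cmod (z $ i) / r" using r by (simp add: norm_mult norm_divide)
    hence "1 - cmod (z $ i) / r \<le> cmod (1 - z $ i * cis (- t) / r)"
      using norm_triangle_ineq2[of 1 "z $ i * cis (- t) / r"] by simp
    moreover have "1 - cmod (z $ i) / r > 0" using z[of i] r by simp
    ultimately show ?thesis by (simp add: norm_divide frac_le)
  qed
  interpret P: prob_space "PiM (insert j S) (\<lambda>_. circ)" by (rule torus_prob_space)
  \<comment> \<open>Fubini needs integrability: \<open>f\<close> is bounded on the closed polydisc
    of radius \<open>r\<close>, and each kernel factor is at most 1 / (1 - |z_i| / r).\<close>
  have int: "integrable (PiM (insert j S) (\<lambda>_. circ)) ?F"
  proof (rule P.integrable_const_bound[where B = "B * (\<Prod>i\<in>insert j S. 1 / (1 - cmod (z $ i) / r))"])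
    show "AE x in PiM (insert j S) (\<lambda>_. circ). norm (?F x) \<le> B * (\<Prod>i\<in>insert j S. 1 / (1 - cmod (z $ i) / r))"
    proof (intro AE_I2)
      fix x
      have "norm (?F x) = cmod (f (\<chi> i. if i \<in> insert j S then r * cis (x i) else z $ i)) *
         (\<Prod>i\<in>insert j S. cmod (1 / (1 - z $ i * cis (- x i) / r)))"
        by (simp only: norm_mult prod_norm)
      also have "\<dots> \<le> B * (\<Prod>i\<in>insert j S. 1 / (1 - cmod (z $ i) / r))"
        using z r by (intro mult_mono prod_mono conjI kb B norm_ge_zero prod_nonneg ballI)
          (auto simp: norm_mult less_imp_le)
      finally show "norm (?F x) \<le> B * (\<Prod>i\<in>insert j S. 1 / (1 - cmod (z $ i) / r))" .
    qed
    have [measurable]: "(\<lambda>x. f (\<chi> i. if i \<in> insert j S then r * cis (x i) else z $ i)) \<in> borel_measurable (PiM (insert j S) (\<lambda>_. circ))"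
    proof (rule measurable_polydisc_compose[OF c _ zp], rule measurable_vec_lambda)
      fix i show "(\<lambda>x. if i \<in> insert j S then r * cis (x i) else z $ i) \<in> borel_measurable (PiM (insert j S) (\<lambda>_. circ))"
      proof (cases "i \<in> insert j S")
        case True
        hence [measurable]: "(\<lambda>x. x i) \<in> borel_measurable (PiM (insert j S) (\<lambda>_. circ))"
          using measurable_component_singleton[of i "insert j S" "\<lambda>_. circ"] by simp
        show ?thesis using True by (simp add: cis_conv_exp)
      qed auto
    qed
    have [measurable]: "(\<lambda>x. \<Prod>i\<in>insert j S. 1 / (1 - z $ i * cis (- x i) / r)) \<in> borel_measurable (PiM (insert j S) (\<lambda>_. circ))"
    proof (rule borel_measurable_prod)
      fix i assume "i \<in> insert j S"
      hence [measurable]: "(\<lambda>x. x i) \<in> borel_measurable (PiM (insert j S) (\<lambda>_. circ))"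
        using measurable_component_singleton[of i "insert j S" "\<lambda>_. circ"] by simp
      show "(\<lambda>x. 1 / (1 - z $ i * cis (- x i) / r)) \<in> borel_measurable (PiM (insert j S) (\<lambda>_. circ))"
        unfolding cis_conv_exp by measurable
    qed
    show "?F \<in> borel_measurable (PiM (insert j S) (\<lambda>_. circ))" by measurable
  qed
  have "integral\<^sup>L (PiM (insert j S) (\<lambda>_. circ)) ?F = (\<integral>x. (\<integral>y. ?F (x(j:=y)) \<partial>circ) \<partial>PiM S (\<lambda>_. circ))"
    by (rule tor.product_integral_insert[OF insert.hyps int])
  also have "\<dots> = (\<integral>x. f (\<chi> i. if i \<in> S then r * cis (x i) else z $ i) * (\<Prod>i\<in>S. 1 / (1 - z $ i * cis (- x i) / r)) \<partial>PiM S (\<lambda>_. circ))"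
  proof (rule Bochner_Integration.integral_cong[OF refl])
    fix x
    let ?w = "\<chi> i. if i \<in> S then r * cis (x i) else z $ i"
    let ?g = "\<lambda>w. f (\<chi> i. if i = j then w else ?w $ i)"
    have g: "?g holomorphic_on ball 0 1"
      using f zp[of S x] unfolding polydisc_holomorphic_def by blast
    have p: "(\<Prod>i\<in>S. 1 / (1 - z $ i * cis (- (if i = j then y else x i)) / r)) = (\<Prod>i\<in>S. 1 / (1 - z $ i * cis (- x i) / r))" for y
      using insert.hyps by (intro prod.cong) auto
    have F: "?F (x(j:=y)) = (\<Prod>i\<in>S. 1 / (1 - z $ i * cis (- x i) / r)) * (?g (r * cis y) / (1 - z $ j * cis (-y) / r))" for y
    proof -
      have "(\<chi> i. if i \<in> insert j S then r * cis ((x(j:=y)) i) else z $ i) = (\<chi> i. if i = j then r * cis y else ?w $ i)"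
        by (auto simp: vec_eq_iff)
      then show ?thesis using insert.hyps by (simp add: p)
    qed
    \<comment> \<open>Only coordinate \<open>j\<close> varies, so the other kernel factors come out
      and Cauchy's formula evaluates the slice at \<open>z $ j\<close>.\<close>
    have "(\<integral>y. ?F (x(j:=y)) \<partial>circ) = (\<Prod>i\<in>S. 1 / (1 - z $ i * cis (- x i) / r)) * ?g (z $ j)"
      unfolding F by (simp only: integral_mult_right_zero circ_Cauchy[OF g r z])
    also have "(\<chi> i. if i = j then z $ j else ?w $ i) = ?w"
      using insert.hyps by (auto simp: vec_eq_iff)
    finally show "(\<integral>y. ?F (x(j:=y)) \<partial>circ) = f ?w * (\<Prod>i\<in>S. 1 / (1 - z $ i * cis (- x i) / r))"
      by (simp add: mult.commute)
  qed
  also have "\<dots> = f z" by (rule insert.IH)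
  finally show ?case .
qed

text \<open>The M-test makes the finite partial sums converge uniformly, and on a probability space
  a uniform error bounds the error of the integrals.\<close>

lemma has_sum_integral:
  fixes f :: "'k \<Rightarrow> 'a \<Rightarrow> complex"
  assumes "prob_space M" and meas: "\<And>k. f k \<in> borel_measurable M" "F \<in> borel_measurable M"
    and b: "\<And>k x. x \<in> space M \<Longrightarrow> cmod (f k x) \<le> b k" "b summable_on UNIV"
    and F: "\<And>x. x \<in> space M \<Longrightarrow> ((\<lambda>k. f k x) has_sum F x) UNIV"
  shows "((\<lambda>k. integral\<^sup>L M (f k)) has_sum integral\<^sup>L M F) UNIV"
proof -
  interpret prob_space M by fact
  have intf: "integrable M (f k)" for k
    by (rule integrable_const_bound[where B = "b k"]) (use meas b in auto)
  have ul: "uniform_limit (space M) (\<lambda>X x. \<Sum>k\<in>X. f k x) F (finite_subsets_at_top UNIV)"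
    by (rule Weierstrass_m_test_general'[OF b(1) F b(2)]) auto
  have "uniform_limit {()} (\<lambda>X _. \<Sum>k\<in>X. integral\<^sup>L M (f k)) (\<lambda>_. integral\<^sup>L M F) (finite_subsets_at_top UNIV)"
  proof (rule uniform_limitI)
    fix e :: real assume e: "e > 0"
    show "\<forall>\<^sub>F X in finite_subsets_at_top UNIV. \<forall>x\<in>{()}. dist (\<Sum>k\<in>X. integral\<^sup>L M (f k)) (integral\<^sup>L M F) < e"
      \<comment> \<open>Half of \<open>e\<close>, because integration preserves only the weak
        inequality.\<close>
      using uniform_limitD[OF ul half_gt_zero[OF e]]
    proof eventually_elim
      case (elim X)
      have i1: "integrable M (\<lambda>x. \<Sum>k\<in>X. f k x)" using intf by simp
      have i2: "integrable M (\<lambda>x. (\<Sum>k\<in>X. f k x) - F x)"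
        by (rule integrable_const_bound[where B = "e/2"])
           (use elim meas in \<open>auto simp: dist_norm intro!: less_imp_le\<close>)
      have "integrable M F"
        using Bochner_Integration.integrable_diff[OF i1 i2] by simp
      hence "(\<Sum>k\<in>X. integral\<^sup>L M (f k)) - integral\<^sup>L M F = (\<integral>x. (\<Sum>k\<in>X. f k x) - F x \<partial>M)"
        using i1 intf by simp
      also have "cmod \<dots> \<le> (\<integral>x. e/2 \<partial>M)"
        by (rule order_trans[OF integral_norm_bound], rule integral_mono)
           (use elim i2 in \<open>auto simp: dist_norm less_imp_le\<close>)
      also have "\<dots> < e" using e prob_space by simp
      finally show ?case by (simp add: dist_norm)
    qed
  qed
  then show ?thesis
    unfolding has_sum_def by (auto dest: tendsto_uniform_limitI)
qed

section \<open>Monomials and their orthogonality on the torus\<close>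

definition mdeg :: "('n::finite \<Rightarrow> nat) \<Rightarrow> nat" where
  "mdeg k = sum k UNIV"

lemma norm_multi_power: "cmod (multi_power z k) = (\<Prod>i\<in>UNIV. cmod (z $ i) ^ k i)"
  by (simp add: multi_power_def prod_norm norm_power flip: prod_norm)

lemma multi_power_const: "multi_power (\<chi> i. c) k = c ^ mdeg k"
  by (simp add: multi_power_def mdeg_def power_sum)

lemma norm_multi_power_le:
  assumes "\<And>i. cmod (z $ i) \<le> r"
  shows "cmod (multi_power z k) \<le> r ^ mdeg k"
  unfolding norm_multi_power mdeg_def power_sum using assms
  by (intro prod_mono conjI power_mono) auto

lemma multi_power_scaleR: "multi_power (r *\<^sub>R z) k = of_real r ^ mdeg k * multi_power z k"
  unfolding multi_power_def mdeg_def vector_scaleR_component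
  by (simp add: scaleR_conv_of_real power_mult_distrib prod.distrib power_sum)

lemma multi_power_vcis: "multi_power (vcis x) k = (\<Prod>i\<in>UNIV. cis (of_nat (k i) * x i))"
  unfolding multi_power_def vcis_def by (intro prod.cong refl) (simp add: Complex.DeMoivre)

text \<open>The integrand is a product of one-variable characters, so Fubini leaves a product of
  Kronecker deltas.\<close>

lemma torus_orthogonality:
  fixes k l :: "'n::finite \<Rightarrow> nat"
  shows "(\<integral>x. multi_power (vcis x) k * cnj (multi_power (vcis x) l) \<partial>torus) = (if k = l then 1 else 0)"
proof -
  have "(\<integral>x. multi_power (vcis x) k * cnj (multi_power (vcis x) l) \<partial>torus)
      = (\<integral>x. (\<Prod>i\<in>UNIV. cis (of_int (int (k i) - int (l i)) * x i)) \<partial>(torus :: ('n \<Rightarrow> real) measure))"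
    by (intro Bochner_Integration.integral_cong refl)
       (simp add: multi_power_vcis cis_cnj cis_mult algebra_simps flip: prod.distrib)
  also have "\<dots> = (\<Prod>i\<in>UNIV. integral\<^sup>L circ (\<lambda>t. cis (of_int (int (k i) - int (l i)) * t)))"
  proof (rule tor.product_integral_prod)
    fix i :: 'n
    show "integrable circ (\<lambda>t. cis (of_int (int (k i) - int (l i)) * t))"
      by (rule circ.integrable_const_bound[where B = 1]) (auto simp: cis_conv_exp)
  qed auto
  also have "\<dots> = (\<Prod>i\<in>UNIV. if k i = l i then 1 else 0)"
    by (intro prod.cong refl) (subst circ_integral_cis, auto)
  also have "\<dots> = (if k = l then 1 else 0)"
    by (auto simp: prod_zero_iff fun_eq_iff)
  finally show ?thesis .
qed

lemma measurable_vcis [measurable]: "vcis \<in> borel_measurable (torus :: ('n::finite \<Rightarrow> real) measure)"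
proof -
  have [measurable]: "(\<lambda>x. x i) \<in> borel_measurable torus" for i :: 'n
    using measurable_component_singleton[of i UNIV "\<lambda>_. circ"] by simp
  have "(\<lambda>x :: 'n \<Rightarrow> real. \<chi> i. cis (x i)) \<in> borel_measurable torus"
    unfolding cis_conv_exp by measurable
  then show ?thesis by (simp add: vcis_def[abs_def])
qed

lemma measurable_multi_power [measurable]: "(\<lambda>z. multi_power z k) \<in> borel_measurable borel"
  unfolding multi_power_def by (intro borel_measurable_continuous_onI continuous_intros)

lemma measurable_multi_power_vcis: "(\<lambda>x. multi_power (vcis x) k) \<in> borel_measurable torus"
  by measurable

lemma measurable_cnj_multi_power_vcis: "(\<lambda>x. cnj (multi_power (vcis x) k)) \<in> borel_measurable torus"
  by (rule borel_measurable_continuous_on[OF _ measurable_multi_power_vcis]) (intro continuous_intros)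

lemma norm_vcis [simp]: "cmod (vcis x $ i) = 1"
  by (simp add: vcis_def)

lemma norm_multi_power_vcis [simp]: "cmod (multi_power (vcis x) k) = 1"
  by (simp add: norm_multi_power)

lemma vcis_in_polydisc: "0 \<le> r \<Longrightarrow> r < 1 \<Longrightarrow> r *\<^sub>R vcis x \<in> polydisc"
  by (simp add: polydisc_def)

lemma measurable_radial:
  fixes f :: "complex ^ 'n::finite \<Rightarrow> complex"
  assumes "continuous_on polydisc f" "0 \<le> r" "r < 1"
  shows "(\<lambda>x. f (r *\<^sub>R vcis x)) \<in> borel_measurable torus"
  by (rule measurable_polydisc_compose[OF assms(1)]) (use assms vcis_in_polydisc in auto)
text \<open>Evaluate at the diagonal point (r, ..., r), where the monomial of \<open>k\<close> is
  \<open>r ^ mdeg k\<close>; for complex families unconditional summability is absolute.\<close>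

lemma power_series_abs_summable:
  fixes a :: "('n::finite \<Rightarrow> nat) \<Rightarrow> complex"
  assumes "\<And>z. (\<And>i. cmod (z $ i) \<le> r) \<Longrightarrow> ((\<lambda>k. a k * multi_power z k) has_sum f z) UNIV" "0 \<le> r"
  shows "(\<lambda>k. cmod (a k) * r ^ mdeg k) summable_on UNIV"
proof -
  have "(\<lambda>k. a k * multi_power (\<chi> i. complex_of_real r) k) summable_on UNIV"
    using assms(1)[of "\<chi> i. complex_of_real r"] assms(2) by (auto intro: has_sum_imp_summable)
  then show ?thesis
    using assms(2) by (simp add: summable_on_iff_abs_summable_on_complex multi_power_const norm_mult norm_power)
qed

text \<open>Termwise integration, after which orthogonality keeps only the term \<open>l\<close>.
  Coefficients are thus determined by values of \<open>f\<close> on a single torus.\<close>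

lemma power_series_Fourier:
  fixes f :: "complex ^ 'n::finite \<Rightarrow> complex"
  assumes f: "continuous_on polydisc f" and r: "0 \<le> r" "r < 1"
    and hs: "\<And>z. (\<And>i. cmod (z $ i) \<le> r) \<Longrightarrow> ((\<lambda>k. a k * multi_power z k) has_sum f z) UNIV"
  shows "(\<integral>x. f (r *\<^sub>R vcis x) * cnj (multi_power (vcis x) l) \<partial>torus) = a l * of_real r ^ mdeg l"
proof -
  have "((\<lambda>k. \<integral>x. a k * multi_power (r *\<^sub>R vcis x) k * cnj (multi_power (vcis x) l) \<partial>torus) has_sum
          (\<integral>x. f (r *\<^sub>R vcis x) * cnj (multi_power (vcis x) l) \<partial>torus)) UNIV"
  proof (rule has_sum_integral[OF torus_prob_space])
    show "(\<lambda>k. cmod (a k) * r ^ mdeg k) summable_on UNIV"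
      by (rule power_series_abs_summable[OF hs r(1)])
    show "(\<lambda>x. f (r *\<^sub>R vcis x) * cnj (multi_power (vcis x) l)) \<in> borel_measurable torus"
      by (intro borel_measurable_times measurable_radial[OF f r] measurable_cnj_multi_power_vcis)
    show "(\<lambda>x. a k * multi_power (r *\<^sub>R vcis x) k * cnj (multi_power (vcis x) l)) \<in> borel_measurable torus" for k
      unfolding multi_power_scaleR
      by (intro borel_measurable_times borel_measurable_const measurable_multi_power_vcis measurable_cnj_multi_power_vcis)
    show "((\<lambda>k. a k * multi_power (r *\<^sub>R vcis x) k * cnj (multi_power (vcis x) l)) has_sum
       f (r *\<^sub>R vcis x) * cnj (multi_power (vcis x) l)) UNIV" for x
      by (intro has_sum_cmult_left hs) (use r in simp)
  qed (use r in \<open>simp_all add: norm_mult multi_power_scaleR norm_power\<close>)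
  also have "(\<lambda>k. \<integral>x. a k * multi_power (r *\<^sub>R vcis x) k * cnj (multi_power (vcis x) l) \<partial>torus)
     = (\<lambda>k. if k = l then a l * of_real r ^ mdeg l else 0)"
  proof
    fix k
    have "(\<integral>x. a k * multi_power (r *\<^sub>R vcis x) k * cnj (multi_power (vcis x) l) \<partial>torus) =
      (\<integral>x. (a k * of_real r ^ mdeg k) * (multi_power (vcis x) k * cnj (multi_power (vcis x) l)) \<partial>torus)"
      by (simp add: multi_power_scaleR mult.assoc)
    also have "\<dots> = (a k * of_real r ^ mdeg k) * (if k = l then 1 else 0)"
      by (simp only: integral_mult_right_zero torus_orthogonality)
    finally show "(\<integral>x. a k * multi_power (r *\<^sub>R vcis x) k * cnj (multi_power (vcis x) l) \<partial>torus)
      = (if k = l then a l * of_real r ^ mdeg l else 0)" by simp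
  qed
  finally have "((\<lambda>k. if k = l then a l * of_real r ^ mdeg l else 0) has_sum
      (\<integral>x. f (r *\<^sub>R vcis x) * cnj (multi_power (vcis x) l) \<partial>torus)) UNIV" .
  moreover have "((\<lambda>k. if k = l then a l * of_real r ^ mdeg l else 0) has_sum a l * of_real r ^ mdeg l) UNIV"
    using has_sum_finite_neutralI[of "{l}" UNIV "\<lambda>k. if k = l then a l * of_real r ^ mdeg l else 0"] by auto
  ultimately show ?thesis by (rule has_sum_unique)
qed

lemma power_series_unique_local:
  fixes f :: "complex ^ 'n::finite \<Rightarrow> complex"
  assumes "continuous_on polydisc f" "0 < r" "r < 1"
    and "\<And>z. (\<And>i. cmod (z $ i) \<le> r) \<Longrightarrow> ((\<lambda>k. a k * multi_power z k) has_sum f z) UNIV"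
    and "\<And>z. (\<And>i. cmod (z $ i) \<le> r) \<Longrightarrow> ((\<lambda>k. b k * multi_power z k) has_sum f z) UNIV"
  shows "a = b"
proof
  fix l
  have "a l * of_real r ^ mdeg l = b l * of_real r ^ mdeg l"
    using power_series_Fourier[OF assms(1) _ assms(3,4), of l] power_series_Fourier[OF assms(1) _ assms(3,5), of l] assms(2)
    by simp
  then show "a l = b l" using assms(2) by simp
qed

lemma multi_geometric:
  fixes y :: "complex ^ 'n::finite"
  assumes y: "\<And>i. cmod (y $ i) < 1"
  shows "((\<lambda>k. multi_power y k) has_sum (\<Prod>i\<in>UNIV. 1 / (1 - y $ i))) UNIV"
    and "(\<lambda>k. cmod (multi_power y k)) summable_on UNIV"
proof -
  have U: "(UNIV :: ('n \<Rightarrow> nat) set) = PiE UNIV (\<lambda>_. UNIV)" by auto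
  have g: "(\<lambda>m. norm ((cmod (y $ i)) ^ m)) summable_on UNIV" "(\<lambda>m. norm ((y $ i) ^ m)) summable_on UNIV" for i
    using y[of i] by (simp_all add: norm_power summable_on_UNIV_nonneg_real_iff)
  have s: "infsum (\<lambda>m. (y $ i) ^ m) UNIV = 1 / (1 - y $ i)" for i
    by (rule infsumI, rule norm_summable_imp_has_sum[OF _ geometric_sums[OF y]])
       (use y[of i] in \<open>simp add: norm_power\<close>)
  have t: "infsum (\<lambda>m. (cmod (y $ i)) ^ m) UNIV = 1 / (1 - cmod (y $ i))" for i
    by (rule infsumI, rule norm_summable_imp_has_sum[OF _ geometric_sums])
       (use y[of i] in \<open>simp_all add: norm_power\<close>)
  have "infsum (\<lambda>k. \<Prod>i\<in>UNIV. (cmod (y $ i)) ^ k i) (PiE UNIV (\<lambda>_. UNIV)) = (\<Prod>i\<in>UNIV. 1 / (1 - cmod (y $ i)))"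
    unfolding t[symmetric] by (rule infsum_prod_PiE_abs) (simp_all only: finite g)
  hence "infsum (\<lambda>k. cmod (multi_power y k)) UNIV = (\<Prod>i\<in>UNIV. 1 / (1 - cmod (y $ i)))"
    by (simp add: norm_multi_power)
  \<comment> \<open>An infinite sum that does not exist is \<open>0\<close> by convention, so a positive value gives summability.\<close>
  moreover have "\<dots> > 0" using y by (intro prod_pos) auto
  ultimately show *: "(\<lambda>k. cmod (multi_power y k)) summable_on UNIV"
    by (metis infsum_not_exists less_irrefl)
  have "infsum (\<lambda>k. \<Prod>i\<in>UNIV. (y $ i) ^ k i) (PiE UNIV (\<lambda>_. UNIV)) = (\<Prod>i\<in>UNIV. 1 / (1 - y $ i))"
    unfolding s[symmetric] by (rule infsum_prod_PiE_abs) (simp_all only: finite g)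
  hence "infsum (\<lambda>k. multi_power y k) UNIV = (\<Prod>i\<in>UNIV. 1 / (1 - y $ i))"
    by (simp add: multi_power_def)
  then show "((\<lambda>k. multi_power y k) has_sum (\<Prod>i\<in>UNIV. 1 / (1 - y $ i))) UNIV"
    using has_sum_infsum[of "\<lambda>k. multi_power y k" UNIV] *
    by (simp add: summable_on_iff_abs_summable_on_complex)
qed

text \<open>Expand the Cauchy kernel into its multiple geometric series and integrate term by term.
  The coefficients obtained still depend on \<open>r\<close>.\<close>

lemma power_series_exists_local:
  fixes f :: "complex ^ 'n::finite \<Rightarrow> complex"
  assumes f: "polydisc_holomorphic f" and r: "0 < r" "r < 1"
  obtains a where "\<And>z. (\<And>i. cmod (z $ i) < r) \<Longrightarrow> ((\<lambda>k. a k * multi_power z k) has_sum f z) UNIV"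
proof
  let ?a = "\<lambda>k. \<integral>x. f (r *\<^sub>R vcis x) * cnj (multi_power (vcis x) k) / r ^ mdeg k \<partial>torus"
  fix z :: "complex ^ 'n" assume z: "\<And>i. cmod (z $ i) < r"
  have c: "continuous_on polydisc f" using f by (rule polydisc_holomorphic_continuous)
  obtain B where B: "B \<ge> 0" "\<And>z. (\<And>i. cmod (z $ i) \<le> r) \<Longrightarrow> cmod (f z) \<le> B"
    using bounded_on_closed_polydisc[OF c r(2)] by blast
  let ?y = "\<lambda>x. \<chi> i. z $ i * cis (- x i) / r"
  have y: "cmod (?y x $ i) < 1" for x i using z[of i] r by (simp add: norm_mult norm_divide)
  have mp: "multi_power (?y x) k = multi_power z k * cnj (multi_power (vcis x) k) / r ^ mdeg k" for x k
    by (simp add: multi_power_def vcis_def mdeg_def power_sum power_mult_distrib power_divide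
        prod.distrib prod_dividef cis_cnj)
  have "f z = (\<integral>x. f (r *\<^sub>R vcis x) * (\<Prod>i\<in>UNIV. 1 / (1 - ?y x $ i)) \<partial>torus)"
    using polydisc_Cauchy_partial[OF f r z, of UNIV] by (simp add: vcis_def scaleR_vec_def scaleR_conv_of_real)
  moreover have "((\<lambda>k. \<integral>x. f (r *\<^sub>R vcis x) * multi_power (?y x) k \<partial>torus) has_sum
      (\<integral>x. f (r *\<^sub>R vcis x) * (\<Prod>i\<in>UNIV. 1 / (1 - ?y x $ i)) \<partial>torus)) UNIV"
  proof (rule has_sum_integral[OF torus_prob_space])
    show "(\<lambda>k. B * cmod (multi_power (\<chi> i. z $ i / r) k)) summable_on UNIV"
      \<comment> \<open>The majorant is geometric with ratios |z_i| / r < 1, which do not depend on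
        the angles.\<close>
      by (intro summable_on_cmult_right multi_geometric(2)) (use z r in \<open>simp add: norm_divide\<close>)
    have m: "(\<lambda>x. f (r *\<^sub>R vcis x)) \<in> borel_measurable torus"
      by (rule measurable_radial[OF c]) (use r in auto)
    show "(\<lambda>x. f (r *\<^sub>R vcis x) * multi_power (?y x) k) \<in> borel_measurable torus" for k
      unfolding mp by (intro borel_measurable_times borel_measurable_divide m measurable_cnj_multi_power_vcis borel_measurable_const)
    show "((\<lambda>k. f (r *\<^sub>R vcis x) * multi_power (?y x) k) has_sum f (r *\<^sub>R vcis x) * (\<Prod>i\<in>UNIV. 1 / (1 - ?y x $ i))) UNIV" for x
      by (intro has_sum_cmult_right multi_geometric(1) y)
    have [measurable]: "(\<lambda>x. x i) \<in> borel_measurable torus" for i :: 'n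
      using measurable_component_singleton[of i UNIV "\<lambda>_. circ"] by simp
    have "(\<lambda>x. (\<Prod>i\<in>UNIV. 1 / (1 - ?y x $ i))) \<in> borel_measurable torus"
      unfolding vec_lambda_beta cis_conv_exp by measurable
    with m show "(\<lambda>x. f (r *\<^sub>R vcis x) * (\<Prod>i\<in>UNIV. 1 / (1 - ?y x $ i))) \<in> borel_measurable torus"
      by (rule borel_measurable_times)
    show "cmod (f (r *\<^sub>R vcis x) * multi_power (?y x) k) \<le> B * cmod (multi_power (\<chi> i. z $ i / r) k)" for x k
      unfolding norm_mult norm_multi_power using r B
      by (intro mult_mono) (auto simp: norm_mult norm_divide prod_nonneg)
  qed
  ultimately have "((\<lambda>k. \<integral>x. f (r *\<^sub>R vcis x) * multi_power (?y x) k \<partial>torus) has_sum f z) UNIV" by simp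
  also have "(\<lambda>k. \<integral>x. f (r *\<^sub>R vcis x) * multi_power (?y x) k \<partial>torus) = (\<lambda>k. ?a k * multi_power z k)"
  proof
    fix k
    have "(\<integral>x. f (r *\<^sub>R vcis x) * multi_power (?y x) k \<partial>torus) =
       (\<integral>x. (f (r *\<^sub>R vcis x) * cnj (multi_power (vcis x) k) / r ^ mdeg k) * multi_power z k \<partial>torus)"
      unfolding mp by (intro Bochner_Integration.integral_cong) (simp_all add: field_simps)
    then show "(\<integral>x. f (r *\<^sub>R vcis x) * multi_power (?y x) k \<partial>torus) = ?a k * multi_power z k"
      by (simp only: integral_mult_left_zero)
  qed
  finally show "((\<lambda>k. ?a k * multi_power z k) has_sum f z) UNIV" .
qed

text \<open>One coefficient family must serve all radii. The family found at radius 1/2 is compared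
  with the one at a radius \<open>r\<close> containing the given point; uniqueness on a smaller
  polydisc identifies them.\<close>

lemma power_series_exists:
  fixes f :: "complex ^ 'n::finite \<Rightarrow> complex"
  assumes f: "polydisc_holomorphic f"
  obtains a where "power_series_of f a"
proof -
  have c: "continuous_on polydisc f" using f by (rule polydisc_holomorphic_continuous)
  obtain a where a: "\<And>z. (\<And>i. cmod (z $ i) < 1/2) \<Longrightarrow> ((\<lambda>k. a k * multi_power z k) has_sum f z) UNIV"
    by (rule power_series_exists_local[OF f, of "1/2"]) auto
  have "((\<lambda>k. a k * multi_power z k) has_sum f z) UNIV" if z: "z \<in> polydisc" for z
  proof -
    obtain r where r: "1/2 < r" "0 < r" "r < 1" "\<And>i. cmod (z $ i) < r"
      using polydisc_bounded_radius[OF z, of "1/2"] by auto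
    obtain b where b: "\<And>z. (\<And>i. cmod (z $ i) < r) \<Longrightarrow> ((\<lambda>k. b k * multi_power z k) has_sum f z) UNIV"
      by (rule power_series_exists_local[OF f r(2,3)]) auto
    have "a = b"
    \<comment> \<open>The closed polydisc of radius 1/4 lies in both open polydiscs, of radius 1/2
      and \<open>r\<close>.\<close>
    proof (rule power_series_unique_local[OF c, of "1/4"])
      fix z :: "complex ^ 'n" assume le: "\<And>i. cmod (z $ i) \<le> 1/4"
      have "cmod (z $ i) < 1/2" "cmod (z $ i) < r" for i
        using le[of i] r(1) by linarith+
      then show "((\<lambda>k. a k * multi_power z k) has_sum f z) UNIV" "((\<lambda>k. b k * multi_power z k) has_sum f z) UNIV"
        by (auto intro: a b)
    qed auto
    with b r show ?thesis by simp
  qed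
  hence "power_series_of f a" by (simp add: power_series_of_def)
  then show ?thesis by (rule that)
qed

lemma power_series_unique:
  assumes "continuous_on polydisc f" "power_series_of f a" "power_series_of f b"
  shows "a = b"
proof (rule power_series_unique_local[OF assms(1), of "1/2"])
  fix z :: "complex ^ 'a" assume "\<And>i. cmod (z $ i) \<le> 1/2"
  hence "z \<in> polydisc" unfolding polydisc_def by (smt (verit, best) field_sum_of_halves mem_Collect_eq)
  then show "((\<lambda>k. a k * multi_power z k) has_sum f z) UNIV" "((\<lambda>k. b k * multi_power z k) has_sum f z) UNIV"
    using assms(2,3) by (auto simp: power_series_of_def)
qed auto

section \<open>The Hardy space as a sequence space\<close>

text \<open>On square summable families this is the inverse of \<open>hardy_coeff\<close>; the value
  0 outside follows the convention of \<open>hardy_space\<close>.\<close>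

definition hfun :: "(('n::finite \<Rightarrow> nat) \<Rightarrow> complex) \<Rightarrow> complex ^ 'n \<Rightarrow> complex" where
  "hfun a z = (if z \<in> polydisc then \<Sum>\<^sub>\<infinity>k. a k * multi_power z k else 0)"

lemma power_series_uniform_limit:
  fixes a :: "('n::finite \<Rightarrow> nat) \<Rightarrow> complex"
  assumes "(\<lambda>k. cmod (a k) * r ^ mdeg k) summable_on UNIV" "r < 1"
  shows "uniform_limit {z. \<forall>i. cmod (z $ i) \<le> r} (\<lambda>X z. \<Sum>k\<in>X. a k * multi_power z k) (hfun a) (finite_subsets_at_top UNIV)"
proof -
  have b: "norm (a k * multi_power z k) \<le> cmod (a k) * r ^ mdeg k" if "z \<in> {z. \<forall>i. cmod (z $ i) \<le> r}" for k z
    using that by (auto simp: norm_mult intro!: mult_left_mono norm_multi_power_le)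
  show ?thesis
  proof (rule Weierstrass_m_test_general'[OF b _ assms(1)])
    fix z :: "complex ^ 'n" assume z: "z \<in> {z. \<forall>i. cmod (z $ i) \<le> r}"
    have "(\<lambda>k. a k * multi_power z k) summable_on UNIV"
      unfolding summable_on_iff_abs_summable_on_complex
      by (rule summable_on_comparison_test[OF assms(1)]) (use b[OF z] in auto)
    then show "((\<lambda>k. a k * multi_power z k) has_sum hfun a z) UNIV"
      using closed_polydisc_subset[OF assms(2)] z by (auto simp: hfun_def)
  qed
qed

text \<open>On each smaller polydisc the sum is a uniform limit of polynomials, which passes on
  continuity and, in each variable, holomorphy.\<close>

lemma
  fixes a :: "('n::finite \<Rightarrow> nat) \<Rightarrow> complex"
  assumes a: "\<And>r. 0 < r \<Longrightarrow> r < 1 \<Longrightarrow> (\<lambda>k. cmod (a k) * r ^ mdeg k) summable_on UNIV"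
  shows power_series_of_hfun: "power_series_of (hfun a) a"
    and polydisc_holomorphic_hfun: "polydisc_holomorphic (hfun a)"
proof -
  have ul: "uniform_limit {z. \<forall>i. cmod (z $ i) \<le> r} (\<lambda>X z. \<Sum>k\<in>X. a k * multi_power z k) (hfun a) (finite_subsets_at_top UNIV)"
    if "0 < r" "r < 1" for r
    by (rule power_series_uniform_limit[OF a]) (use that in auto)
  show "power_series_of (hfun a) a"
    unfolding power_series_of_def
  proof
    fix z :: "complex ^ 'n" assume z: "z \<in> polydisc"
    obtain r where r: "(0::real) < r" "0 < r" "r < 1" "\<And>i. cmod (z $ i) < r"
      using polydisc_bounded_radius[OF z, of 0] by auto
    then show "((\<lambda>k. a k * multi_power z k) has_sum hfun a z) UNIV"
      unfolding has_sum_def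
      by (intro tendsto_uniform_limitI[OF ul[of r]]) (auto intro: less_imp_le)
  qed
  show "polydisc_holomorphic (hfun a)"
    unfolding polydisc_holomorphic_def
  proof (intro conjI ballI allI)
    show "continuous_on polydisc (hfun a)"
    proof (rule continuous_at_imp_continuous_on, rule)
      fix z :: "complex ^ 'n" assume z: "z \<in> polydisc"
      obtain r where r: "(0::real) < r" "0 < r" "r < 1" "\<And>i. cmod (z $ i) < r"
        using polydisc_bounded_radius[OF z, of 0] by auto
      have "continuous_on {z. \<forall>i. cmod (z $ i) \<le> r} (hfun a)"
        by (rule uniform_limit_theorem[OF _ ul])
           (use r in \<open>auto intro!: always_eventually continuous_intros simp: multi_power_def\<close>)
      moreover have "open {z :: complex ^ 'n. \<forall>i. cmod (z $ i) < r}"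
      proof -
        have "{z :: complex ^ 'n. \<forall>i. cmod (z $ i) < r} = (\<Inter>i. {z. cmod (z $ i) < r})" by auto
        also have "open \<dots>" by (intro open_INT ballI open_Collect_less continuous_intros) auto
        finally show ?thesis .
      qed
      ultimately have "continuous_on {z. \<forall>i. cmod (z $ i) < r} (hfun a) \<and> open {z :: complex ^ 'n. \<forall>i. cmod (z $ i) < r}"
        by (auto intro: continuous_on_subset less_imp_le)
      then show "isCont (hfun a) z"
        using r continuous_on_eq_continuous_at by fastforce
    qed
  next
    fix z :: "complex ^ 'n" and i assume z: "z \<in> polydisc"
    let ?u = "\<lambda>w. \<chi> j. if j = i then w else z $ j"
    show "(\<lambda>w. hfun a (?u w)) holomorphic_on ball 0 1"
      unfolding holomorphic_on_def
    proof
      fix w :: complex assume w: "w \<in> ball 0 1"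
      \<comment> \<open>The radius must exceed |w| too, since the slice point carries
        \<open>w\<close> in coordinate \<open>i\<close>.\<close>
      obtain r where r: "cmod w < r" "0 < r" "r < 1" "\<And>i. cmod (z $ i) < r"
        using polydisc_bounded_radius[OF z, of "cmod w"] w by auto
      have u: "uniform_limit (cball 0 r) (\<lambda>X w. \<Sum>k\<in>X. a k * multi_power (?u w) k) (\<lambda>w. hfun a (?u w)) (finite_subsets_at_top UNIV)"
        by (rule uniform_limit_compose'[OF ul[of r]]) (use r in \<open>auto simp: less_imp_le[OF r(4)]\<close>)
      have hol: "(\<lambda>w. \<Sum>k\<in>X. a k * multi_power (?u w) k) holomorphic_on A" for X A
      proof -
        have "(\<lambda>w. if j = i then w else z $ j) holomorphic_on A" for j
          by (cases "j = i") (auto intro!: holomorphic_intros)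
        then show ?thesis unfolding multi_power_def by (auto intro!: holomorphic_intros)
      qed
      have "\<forall>\<^sub>F X in finite_subsets_at_top UNIV.
          continuous_on (cball 0 r) (\<lambda>w. \<Sum>k\<in>X. a k * multi_power (?u w) k) \<and>
          (\<lambda>w. \<Sum>k\<in>X. a k * multi_power (?u w) k) holomorphic_on ball 0 r"
        using hol holomorphic_on_imp_continuous_on by (intro always_eventually) blast
      from holomorphic_uniform_limit[OF this u finite_subsets_at_top_neq_bot]
      have "(\<lambda>w. hfun a (?u w)) holomorphic_on ball 0 r" by blast
      then have "(\<lambda>w. hfun a (?u w)) field_differentiable at w"
        by (rule holomorphic_on_imp_differentiable_at) (use r in auto)
      then show "(\<lambda>w. hfun a (?u w)) field_differentiable at w within ball 0 1"
        by (rule field_differentiable_at_within)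
    qed
  qed
qed

section \<open>Square summable coefficients and the linear structure of the Hardy space\<close>

definition l2 :: "('k \<Rightarrow> complex) \<Rightarrow> bool" where
  "l2 a \<longleftrightarrow> (\<lambda>k. (cmod (a k))\<^sup>2) summable_on UNIV"

lemma mult_le_sum_squares:
  fixes x y :: real
  assumes "0 \<le> x" "0 \<le> y"
  shows "x * y \<le> x\<^sup>2 + y\<^sup>2"
  using sum_squares_bound[of x y] mult_nonneg_nonneg[OF assms] unfolding mult.assoc by linarith

text \<open>Bound the product by the sum of the two squares; the squares of
  \<open>r ^ mdeg k\<close> form a multiple geometric series with ratio
  \<open>r\<^sup>2\<close>.\<close>

lemma l2_weighted_summable:
  fixes a :: "('n::finite \<Rightarrow> nat) \<Rightarrow> complex"
  assumes "l2 a" "0 < r" "r < 1"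
  shows "(\<lambda>k. cmod (a k) * r ^ mdeg k) summable_on UNIV"
proof -
  have "(\<lambda>k. cmod (multi_power (\<chi> i::'n. complex_of_real (r\<^sup>2)) k)) summable_on UNIV"
    by (rule multi_geometric(2)) (use assms in \<open>simp add: norm_power power_less_one_iff\<close>)
  hence "(\<lambda>k::'n \<Rightarrow> nat. (r ^ mdeg k)\<^sup>2) summable_on UNIV"
    using assms(2) by (simp add: multi_power_const norm_power power_mult[symmetric] mult.commute)
  hence "(\<lambda>k. (cmod (a k))\<^sup>2 + (r ^ mdeg k)\<^sup>2) summable_on UNIV"
    using assms(1) unfolding l2_def by (rule summable_on_add[rotated])
  then show ?thesis
  proof (rule summable_on_comparison_test)
    show "cmod (a k) * r ^ mdeg k \<le> (cmod (a k))\<^sup>2 + (r ^ mdeg k)\<^sup>2" for k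
      using assms(2) by (intro mult_le_sum_squares) auto
  qed (use assms in auto)
qed

lemma hardy_coeff_eqI:
  assumes "polydisc_holomorphic f" "power_series_of f a"
  shows "hardy_coeff f = a"
  unfolding hardy_coeff_def using assms power_series_unique[OF polydisc_holomorphic_continuous]
  by (intro the_equality) auto

lemma power_series_of_hardy_coeff:
  assumes "polydisc_holomorphic f"
  shows "power_series_of f (hardy_coeff f)"
  using power_series_exists[OF assms] hardy_coeff_eqI[OF assms] by metis

lemma hardy_spaceI:
  assumes "\<And>z. z \<notin> polydisc \<Longrightarrow> f z = 0" "polydisc_holomorphic f" "l2 (hardy_coeff f)"
  shows "f \<in> hardy_space"
  using assms power_series_of_hardy_coeff[OF assms(2)] by (auto simp: hardy_space_def l2_def)

lemma hardy_space_holomorphic: "f \<in> hardy_space \<Longrightarrow> polydisc_holomorphic f"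
  by (simp add: hardy_space_def)

lemma hardy_space_l2: "f \<in> hardy_space \<Longrightarrow> l2 (hardy_coeff f)"
  using hardy_coeff_eqI by (fastforce simp: hardy_space_def l2_def)

lemma hardy_space_outside: "f \<in> hardy_space \<Longrightarrow> z \<notin> polydisc \<Longrightarrow> f z = 0"
  by (simp add: hardy_space_def)

lemma hfun_coeff: "l2 a \<Longrightarrow> hardy_coeff (hfun a) = a"
  by (intro hardy_coeff_eqI polydisc_holomorphic_hfun power_series_of_hfun l2_weighted_summable)

lemma hfun_in_hardy_space: "l2 a \<Longrightarrow> hfun a \<in> hardy_space"
  by (rule hardy_spaceI)
     (simp_all add: hfun_coeff polydisc_holomorphic_hfun l2_weighted_summable, simp add: hfun_def)

lemma hardy_space_has_sum:
  "f \<in> hardy_space \<Longrightarrow> z \<in> polydisc \<Longrightarrow> ((\<lambda>k. hardy_coeff f k * multi_power z k) has_sum f z) UNIV"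
  using power_series_of_hardy_coeff[OF hardy_space_holomorphic] unfolding power_series_of_def by blast

lemma hardy_space_eqI:
  assumes "f \<in> hardy_space" "g \<in> hardy_space" "\<And>k. hardy_coeff f k = hardy_coeff g k"
  shows "f = g"
proof
  fix z show "f z = g z"
    using hardy_space_has_sum[OF assms(1), of z] hardy_space_has_sum[OF assms(2), of z] assms(3)
      hardy_space_outside[OF assms(1), of z] hardy_space_outside[OF assms(2), of z]
    by (cases "z \<in> polydisc") (auto dest: has_sum_unique)
qed

lemma l2_comparison:
  assumes "l2 a" "\<And>k. cmod (b k) \<le> C * cmod (a k)"
  shows "l2 b"
  unfolding l2_def
proof (rule summable_on_comparison_test)
  show "(\<lambda>k. C\<^sup>2 * (cmod (a k))\<^sup>2) summable_on UNIV"
    using assms(1) unfolding l2_def by (rule summable_on_cmult_right)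
  show "(cmod (b k))\<^sup>2 \<le> C\<^sup>2 * (cmod (a k))\<^sup>2" for k
    using power_mono[OF assms(2)[of k], of 2] by (simp add: power_mult_distrib)
qed auto

lemma l2_add:
  assumes "l2 a" "l2 b"
  shows "l2 (\<lambda>k. a k + b k)"
  unfolding l2_def
proof (rule summable_on_comparison_test)
  show "(\<lambda>k. 2 * ((cmod (a k))\<^sup>2 + (cmod (b k))\<^sup>2)) summable_on UNIV"
    using assms unfolding l2_def by (intro summable_on_cmult_right summable_on_add)
  show "(cmod (a k + b k))\<^sup>2 \<le> 2 * ((cmod (a k))\<^sup>2 + (cmod (b k))\<^sup>2)" for k
  proof -
    have "(cmod (a k + b k))\<^sup>2 \<le> (cmod (a k) + cmod (b k))\<^sup>2"
      by (intro power_mono norm_triangle_ineq) auto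
    also have "\<dots> \<le> 2 * ((cmod (a k))\<^sup>2 + (cmod (b k))\<^sup>2)"
      using sum_squares_bound[of "cmod (a k)" "cmod (b k)"] by (simp add: power2_sum)
    finally show ?thesis .
  qed
qed auto

lemma polydisc_holomorphic_cmult: "polydisc_holomorphic f \<Longrightarrow> polydisc_holomorphic (\<lambda>z. c * f z)"
  by (auto simp: polydisc_holomorphic_def intro!: continuous_intros holomorphic_intros)

lemma polydisc_holomorphic_add:
  "polydisc_holomorphic f \<Longrightarrow> polydisc_holomorphic g \<Longrightarrow> polydisc_holomorphic (\<lambda>z. f z + g z)"
  by (auto simp: polydisc_holomorphic_def intro!: continuous_intros holomorphic_intros)

lemma polydisc_holomorphic_mult:
  "polydisc_holomorphic f \<Longrightarrow> polydisc_holomorphic g \<Longrightarrow> polydisc_holomorphic (\<lambda>z. f z * g z)"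
  by (auto simp: polydisc_holomorphic_def intro!: continuous_intros holomorphic_intros)

lemma polydisc_holomorphic_component:
  "polydisc_holomorphic (\<lambda>z :: complex ^ 'n::finite. z $ i)"
  unfolding polydisc_holomorphic_def
proof (intro conjI ballI allI)
  fix z :: "complex ^ 'n" and j
  show "(\<lambda>w. (\<chi> l. if l = j then w else z $ l) $ i) holomorphic_on ball 0 1"
    by (cases "i = j") (auto intro!: holomorphic_intros)
qed (intro continuous_intros)

lemma
  assumes "f \<in> hardy_space"
  shows hardy_coeff_cmult: "hardy_coeff (\<lambda>z. c * f z) = (\<lambda>k. c * hardy_coeff f k)"
    and hardy_space_cmult: "(\<lambda>z. c * f z) \<in> hardy_space"
proof -
  note h = polydisc_holomorphic_cmult[OF hardy_space_holomorphic[OF assms]]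
  show *: "hardy_coeff (\<lambda>z. c * f z) = (\<lambda>k. c * hardy_coeff f k)"
    by (rule hardy_coeff_eqI[OF h])
       (auto simp: power_series_of_def mult.assoc intro!: has_sum_cmult_right hardy_space_has_sum assms)
  show "(\<lambda>z. c * f z) \<in> hardy_space"
    by (rule hardy_spaceI[OF _ h])
       (auto simp: * hardy_space_outside[OF assms] norm_mult intro!: l2_comparison[OF hardy_space_l2[OF assms], of _ "cmod c"])
qed

lemma
  assumes "f \<in> hardy_space" "g \<in> hardy_space"
  shows hardy_coeff_add: "hardy_coeff (\<lambda>z. f z + g z) = (\<lambda>k. hardy_coeff f k + hardy_coeff g k)"
    and hardy_space_add: "(\<lambda>z. f z + g z) \<in> hardy_space"
proof -
  note h = polydisc_holomorphic_add[OF assms[THEN hardy_space_holomorphic]]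
  show *: "hardy_coeff (\<lambda>z. f z + g z) = (\<lambda>k. hardy_coeff f k + hardy_coeff g k)"
    by (rule hardy_coeff_eqI[OF h])
       (auto simp: power_series_of_def distrib_right intro!: has_sum_add hardy_space_has_sum assms)
  show "(\<lambda>z. f z + g z) \<in> hardy_space"
    by (rule hardy_spaceI[OF _ h])
       (auto simp: * hardy_space_outside[OF assms(1)] hardy_space_outside[OF assms(2)] intro!: l2_add assms hardy_space_l2)
qed

lemma
  assumes "f \<in> hardy_space" "g \<in> hardy_space"
  shows hardy_coeff_diff: "hardy_coeff (\<lambda>z. f z - g z) = (\<lambda>k. hardy_coeff f k - hardy_coeff g k)"
    and hardy_space_diff: "(\<lambda>z. f z - g z) \<in> hardy_space"
  using hardy_coeff_add[OF assms(1) hardy_space_cmult[OF assms(2), of "-1"]]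
    hardy_coeff_cmult[OF assms(2), of "-1"]
    hardy_space_add[OF assms(1) hardy_space_cmult[OF assms(2), of "-1"]] by simp_all

section \<open>Inner product and norm\<close>

lemma l2_Cauchy_Schwarz:
  assumes "l2 a" "l2 b"
  shows "(\<lambda>k. a k * cnj (b k)) summable_on UNIV"
    and "cmod (\<Sum>\<^sub>\<infinity>k. a k * cnj (b k)) \<le> sqrt (\<Sum>\<^sub>\<infinity>k. (cmod (a k))\<^sup>2) * sqrt (\<Sum>\<^sub>\<infinity>k. (cmod (b k))\<^sup>2)"
proof -
  have s: "(\<lambda>k. norm (a k * cnj (b k))) summable_on UNIV"
  proof (rule summable_on_comparison_test)
    show "(\<lambda>k. (cmod (a k))\<^sup>2 + (cmod (b k))\<^sup>2) summable_on UNIV"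
      using assms unfolding l2_def by (rule summable_on_add)
    show "norm (a k * cnj (b k)) \<le> (cmod (a k))\<^sup>2 + (cmod (b k))\<^sup>2" for k
      unfolding norm_mult complex_mod_cnj by (intro mult_le_sum_squares) auto
  qed auto
  then show "(\<lambda>k. a k * cnj (b k)) summable_on UNIV"
    by (simp add: summable_on_iff_abs_summable_on_complex)
  have "cmod (\<Sum>\<^sub>\<infinity>k. a k * cnj (b k)) \<le> (\<Sum>\<^sub>\<infinity>k. norm (a k * cnj (b k)))"
    by (rule norm_infsum_bound[OF s])
  also have "\<dots> \<le> sqrt (\<Sum>\<^sub>\<infinity>k. (cmod (a k))\<^sup>2) * sqrt (\<Sum>\<^sub>\<infinity>k. (cmod (b k))\<^sup>2)"
  proof (rule infsum_le_finite_sums[OF s])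
    fix F :: "'a set" assume F: "finite F"
    have "(\<Sum>k\<in>F. norm (a k * cnj (b k))) \<le> L2_set (\<lambda>k. cmod (a k)) F * L2_set (\<lambda>k. cmod (b k)) F"
      using L2_set_mult_ineq[of "\<lambda>k. cmod (a k)" "\<lambda>k. cmod (b k)" F] by (simp add: norm_mult)
    also have "\<dots> \<le> sqrt (\<Sum>\<^sub>\<infinity>k. (cmod (a k))\<^sup>2) * sqrt (\<Sum>\<^sub>\<infinity>k. (cmod (b k))\<^sup>2)"
      unfolding L2_set_def using assms F unfolding l2_def
      by (intro mult_mono real_sqrt_le_mono finite_sum_le_infsum) (auto intro!: sum_nonneg infsum_nonneg)
    finally show "(\<Sum>k\<in>F. norm (a k * cnj (b k))) \<le> sqrt (\<Sum>\<^sub>\<infinity>k. (cmod (a k))\<^sup>2) * sqrt (\<Sum>\<^sub>\<infinity>k. (cmod (b k))\<^sup>2)" .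
  qed
  finally show "cmod (\<Sum>\<^sub>\<infinity>k. a k * cnj (b k)) \<le> sqrt (\<Sum>\<^sub>\<infinity>k. (cmod (a k))\<^sup>2) * sqrt (\<Sum>\<^sub>\<infinity>k. (cmod (b k))\<^sup>2)" .
qed

lemma hardy_inner_summable:
  assumes "f \<in> hardy_space" "g \<in> hardy_space"
  shows "(\<lambda>k. hardy_coeff f k * cnj (hardy_coeff g k)) summable_on UNIV"
  using assms by (intro l2_Cauchy_Schwarz hardy_space_l2)

lemma hardy_Cauchy_Schwarz:
  assumes "f \<in> hardy_space" "g \<in> hardy_space"
  shows "cmod (hardy_inner f g) \<le> hardy_norm f * hardy_norm g"
  unfolding hardy_inner_def hardy_norm_def using assms by (intro l2_Cauchy_Schwarz hardy_space_l2)

lemma hardy_inner_commute: "hardy_inner f g = cnj (hardy_inner g f)"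
  unfolding hardy_inner_def infsum_cnj[symmetric] by (simp add: mult.commute)

lemma hardy_inner_add_left:
  assumes "f \<in> hardy_space" "g \<in> hardy_space" "h \<in> hardy_space"
  shows "hardy_inner (\<lambda>z. f z + g z) h = hardy_inner f h + hardy_inner g h"
  unfolding hardy_inner_def using assms
  by (simp add: hardy_coeff_add distrib_right infsum_add hardy_inner_summable)

lemma hardy_inner_cmult_left:
  assumes "f \<in> hardy_space"
  shows "hardy_inner (\<lambda>z. c * f z) h = c * hardy_inner f h"
  unfolding hardy_inner_def using assms
  by (simp add: hardy_coeff_cmult mult.assoc infsum_cmult_right')

lemma hardy_inner_diff_left:
  assumes "f \<in> hardy_space" "g \<in> hardy_space" "h \<in> hardy_space"
  shows "hardy_inner (\<lambda>z. f z - g z) h = hardy_inner f h - hardy_inner g h"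
  using hardy_inner_add_left[OF assms(1) hardy_space_cmult[OF assms(2), of "-1"] assms(3)]
    hardy_inner_cmult_left[OF assms(2), of "-1"] by simp

lemma hardy_inner_cmult_right:
  assumes "f \<in> hardy_space"
  shows "hardy_inner h (\<lambda>z. c * f z) = cnj c * hardy_inner h f"
  by (subst (1 2) hardy_inner_commute) (simp add: hardy_inner_cmult_left assms)

lemma hardy_inner_diff_right:
  assumes "f \<in> hardy_space" "g \<in> hardy_space" "h \<in> hardy_space"
  shows "hardy_inner h (\<lambda>z. f z - g z) = hardy_inner h f - hardy_inner h g"
  by (subst (1 2 3) hardy_inner_commute) (simp add: hardy_inner_diff_left assms)

lemma hardy_inner_self:
  assumes "f \<in> hardy_space"
  shows "hardy_inner f f = of_real ((hardy_norm f)\<^sup>2)"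
proof -
  have "hardy_inner f f = (\<Sum>\<^sub>\<infinity>k. of_real ((cmod (hardy_coeff f k))\<^sup>2))"
    unfolding hardy_inner_def by (intro infsum_cong) (metis complex_norm_square)
  also have "\<dots> = of_real (\<Sum>\<^sub>\<infinity>k. (cmod (hardy_coeff f k))\<^sup>2)"
    using hardy_space_l2[OF assms] unfolding l2_def
    by (intro infsumI has_sum_of_real has_sum_infsum)
  finally show ?thesis by (simp add: hardy_norm_def infsum_nonneg)
qed

lemma hardy_norm_nonneg [simp]: "hardy_norm f \<ge> 0"
  by (simp add: hardy_norm_def infsum_nonneg)

lemma zero_in_hardy_space: "(\<lambda>_. 0) \<in> hardy_space"
proof -
  have "l2 (\<lambda>_ :: 'a \<Rightarrow> nat. 0)" by (simp add: l2_def)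
  from hardy_space_cmult[OF hfun_in_hardy_space[OF this], of 0] show ?thesis by simp
qed

lemma hardy_inner_self_eq_0:
  assumes "f \<in> hardy_space" "hardy_inner f f = 0"
  shows "f = (\<lambda>_. 0)"
proof (rule hardy_space_eqI[OF assms(1) zero_in_hardy_space])
  fix k
  have "(\<Sum>\<^sub>\<infinity>k. (cmod (hardy_coeff f k))\<^sup>2) \<le> 0"
    using assms(2) unfolding hardy_inner_self[OF assms(1)] hardy_norm_def by (simp add: infsum_nonneg)
  from nonneg_infsum_le_0D[OF this, of k] have "hardy_coeff f k = 0"
    using hardy_space_l2[OF assms(1)] by (simp add: l2_def)
  moreover have "hardy_coeff (\<lambda>_. 0) k = (0 :: complex)"
    using hardy_coeff_cmult[OF assms(1), of 0] by simp
  ultimately show "hardy_coeff f k = hardy_coeff (\<lambda>_. 0) k" by simp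
qed

lemma hardy_eqI_inner:
  assumes "f \<in> hardy_space" "g \<in> hardy_space" "\<And>h. h \<in> hardy_space \<Longrightarrow> hardy_inner f h = hardy_inner g h"
  shows "f = g"
proof -
  let ?d = "\<lambda>z. f z - g z"
  have "hardy_inner ?d ?d = 0"
    using assms by (subst hardy_inner_diff_left) (auto intro: hardy_space_diff)
  from hardy_inner_self_eq_0[OF hardy_space_diff[OF assms(1,2)] this] show ?thesis
    by (auto simp: fun_eq_iff)
qed

lemma hardy_norm_cmult: "f \<in> hardy_space \<Longrightarrow> hardy_norm (\<lambda>z. c * f z) = cmod c * hardy_norm f"
  unfolding hardy_norm_def
  by (simp add: hardy_coeff_cmult norm_mult power_mult_distrib infsum_cmult_right' real_sqrt_mult)

section \<open>The Szego kernel\<close>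

definition kern :: "complex ^ 'n::finite \<Rightarrow> complex ^ 'n \<Rightarrow> complex" where
  "kern w = hfun (\<lambda>k. cnj (multi_power w k))"

lemma l2_kern: "w \<in> polydisc \<Longrightarrow> l2 (\<lambda>k. cnj (multi_power w k))"
proof -
  assume w: "w \<in> polydisc"
  have "(\<lambda>k. cmod (multi_power (\<chi> i. (w $ i)\<^sup>2) k)) summable_on UNIV"
    by (rule multi_geometric(2)) (use w in \<open>simp add: polydisc_def norm_power power_less_one_iff\<close>)
  moreover have "cmod (multi_power (\<chi> i. (w $ i)\<^sup>2) k) = (cmod (multi_power w k))\<^sup>2" for k
    by (simp add: norm_multi_power norm_power prod_power_distrib power_mult[symmetric] mult.commute)
  ultimately show ?thesis by (simp add: l2_def)
qed

lemma kern_in_hardy_space: "w \<in> polydisc \<Longrightarrow> kern w \<in> hardy_space"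
  unfolding kern_def by (intro hfun_in_hardy_space l2_kern)

text \<open>The kernel has the conjugated monomials at \<open>w\<close> as coefficients, so the
  inner product is the power series of \<open>f\<close> at \<open>w\<close>.\<close>

lemma kern_reproducing:
  assumes "f \<in> hardy_space" "w \<in> polydisc"
  shows "hardy_inner f (kern w) = f w"
  unfolding hardy_inner_def kern_def hfun_coeff[OF l2_kern[OF assms(2)]]
  using hardy_space_has_sum[OF assms] by (simp add: infsumI)

lemma kern_eq:
  assumes "w \<in> polydisc" "z \<in> polydisc"
  shows "kern w z = (\<Prod>i\<in>UNIV. 1 / (1 - cnj (w $ i) * z $ i))"
proof -
  let ?y = "\<chi> i. cnj (w $ i) * z $ i"
  have "((\<lambda>k. multi_power ?y k) has_sum (\<Prod>i\<in>UNIV. 1 / (1 - ?y $ i))) UNIV"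
  proof (rule multi_geometric(1))
    fix i show "cmod (?y $ i) < 1"
      using assms mult_strict_mono'[of "cmod (w $ i)" 1 "cmod (z $ i)" 1] by (simp add: polydisc_def norm_mult)
  qed
  moreover have "multi_power ?y k = cnj (multi_power w k) * multi_power z k" for k
    by (simp add: multi_power_def power_mult_distrib prod.distrib)
  ultimately show ?thesis
    using assms(2) by (simp add: kern_def hfun_def infsumI)
qed

lemma kern_norm:
  assumes "w \<in> polydisc"
  shows "(hardy_norm (kern w))\<^sup>2 = (\<Prod>i\<in>UNIV. 1 / (1 - (cmod (w $ i))\<^sup>2))"
proof -
  have "of_real ((hardy_norm (kern w))\<^sup>2) = kern w w"
    using kern_reproducing[OF kern_in_hardy_space[OF assms] assms] by (simp add: hardy_inner_self kern_in_hardy_space assms)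
  also have "\<dots> = of_real (\<Prod>i\<in>UNIV. 1 / (1 - (cmod (w $ i))\<^sup>2))"
    by (simp add: kern_eq assms complex_norm_square mult.commute flip: of_real_power)
  finally show ?thesis unfolding of_real_eq_iff .
qed

text \<open>Cauchy-Schwarz against the kernel. It serves twice: norm limits become pointwise limits,
  and a value at one point bounds a norm from below.\<close>

lemma hardy_point_evaluation:
  assumes "f \<in> hardy_space" "w \<in> polydisc"
  shows "cmod (f w) \<le> hardy_norm f * hardy_norm (kern w)"
  using hardy_Cauchy_Schwarz[OF assms(1) kern_in_hardy_space[OF assms(2)]]
  by (simp add: kern_reproducing assms)

section \<open>Coordinate shifts and Parseval\<close>

definition inc :: "'n \<Rightarrow> ('n \<Rightarrow> nat) \<Rightarrow> 'n \<Rightarrow> nat" where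
  "inc i k = k(i := Suc (k i))"

lemma bij_betw_inc: "bij_betw (inc i) UNIV {k. k i \<noteq> 0}"
  by (rule bij_betw_byWitness[where f' = "\<lambda>k. k(i := k i - 1)"]) (auto simp: inc_def fun_eq_iff)

text \<open>\<open>inc i\<close> is a bijection onto the exponents with positive \<open>i\<close>-th
  entry, and \<open>F\<close> vanishes on all others.\<close>

lemma has_sum_inc:
  fixes F :: "('n \<Rightarrow> nat) \<Rightarrow> complex"
  assumes "\<And>k. k i = 0 \<Longrightarrow> F k = 0"
  shows "((\<lambda>k. F (inc i k)) has_sum s) UNIV \<longleftrightarrow> (F has_sum s) UNIV"
proof -
  have "((\<lambda>k. F (inc i k)) has_sum s) UNIV \<longleftrightarrow> (F has_sum s) {k. k i \<noteq> 0}"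
    by (rule has_sum_reindex_bij_betw[OF bij_betw_inc])
  also have "\<dots> \<longleftrightarrow> (F has_sum s) UNIV"
    by (rule has_sum_cong_neutral) (use assms in auto)
  finally show ?thesis .
qed

lemma multi_power_inc: "multi_power z (inc i k) = z $ i * multi_power z k"
proof -
  have "multi_power z (inc i k) = (\<Prod>j\<in>UNIV. (if j = i then z $ i else 1) * (z $ j) ^ k j)"
    unfolding multi_power_def inc_def by (intro prod.cong) auto
  then show ?thesis by (simp add: prod.distrib multi_power_def)
qed

lemma
  assumes "f \<in> hardy_space"
  shows coord_mult_in_hardy_space: "coord_mult i f \<in> hardy_space"
    and hardy_coeff_coord_mult: "hardy_coeff (coord_mult i f) (inc i k) = hardy_coeff f k"
    and hardy_coeff_coord_mult_0: "k i = 0 \<Longrightarrow> hardy_coeff (coord_mult i f) k = 0"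
proof -
  \<comment> \<open>Truncated subtraction at \<open>k i = 0\<close> would return \<open>k\<close>
    itself, hence the separate case.\<close>
  let ?b = "\<lambda>k. if k i = 0 then 0 else hardy_coeff f (k(i := k i - 1))"
  have b: "?b (inc i k) = hardy_coeff f k" for k by (simp add: inc_def)
  have h: "polydisc_holomorphic (coord_mult i f)"
    unfolding coord_mult_def
    by (intro polydisc_holomorphic_mult polydisc_holomorphic_component hardy_space_holomorphic assms)
  have "power_series_of (coord_mult i f) ?b"
    unfolding power_series_of_def
  proof
    fix z :: "complex ^ 'a" assume z: "z \<in> polydisc"
    have "((\<lambda>k. ?b (inc i k) * multi_power z (inc i k)) has_sum coord_mult i f z) UNIV"
      unfolding b multi_power_inc coord_mult_def
      using has_sum_cmult_right[OF hardy_space_has_sum[OF assms z], of "z $ i"] by (simp add: mult_ac)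
    then show "((\<lambda>k. ?b k * multi_power z k) has_sum coord_mult i f z) UNIV"
      by (subst (asm) has_sum_inc) auto
  qed
  with h have *: "hardy_coeff (coord_mult i f) = ?b" by (rule hardy_coeff_eqI)
  show "hardy_coeff (coord_mult i f) (inc i k) = hardy_coeff f k"
    and "k i = 0 \<Longrightarrow> hardy_coeff (coord_mult i f) k = 0"
    unfolding * b by simp_all
  have "l2 ?b"
    unfolding l2_def
  proof -
    have "(\<lambda>k. (cmod (?b (inc i k)))\<^sup>2) summable_on UNIV"
      unfolding b using hardy_space_l2[OF assms] by (simp add: l2_def)
    hence "(\<lambda>k. (cmod (?b k))\<^sup>2) summable_on {k. k i \<noteq> 0}"
      by (subst (asm) summable_on_reindex_bij_betw[OF bij_betw_inc])
    then show "(\<lambda>k. (cmod (?b k))\<^sup>2) summable_on UNIV"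
      by (rule summable_on_cong_neutral[THEN iffD1, rotated -1]) auto
  qed
  then show "coord_mult i f \<in> hardy_space"
    using hardy_space_outside[OF assms] by (intro hardy_spaceI[OF _ h]) (simp_all add: * , simp add: coord_mult_def)
qed

text \<open>Backward shift in the \<open>i\<close>-th variable, the adjoint of
  \<open>coord_mult i\<close> on the whole Hardy space.\<close>

definition bshift :: "'n \<Rightarrow> (complex ^ 'n::finite \<Rightarrow> complex) \<Rightarrow> complex ^ 'n \<Rightarrow> complex" where
  "bshift i f = hfun (\<lambda>k. hardy_coeff f (inc i k))"

lemma
  assumes "f \<in> hardy_space"
  shows bshift_in_hardy_space: "bshift i f \<in> hardy_space"
    and hardy_coeff_bshift: "hardy_coeff (bshift i f) k = hardy_coeff f (inc i k)"
proof -
  have "(\<lambda>k. (cmod (hardy_coeff f k))\<^sup>2) summable_on {k. k i \<noteq> 0}"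
    by (rule summable_on_subset_banach[of _ UNIV]) (use hardy_space_l2[OF assms] in \<open>auto simp: l2_def\<close>)
  hence "l2 (\<lambda>k. hardy_coeff f (inc i k))"
    unfolding l2_def by (subst (asm) summable_on_reindex_bij_betw[OF bij_betw_inc, symmetric])
  then show "bshift i f \<in> hardy_space" "hardy_coeff (bshift i f) k = hardy_coeff f (inc i k)"
    by (simp_all add: bshift_def hfun_in_hardy_space hfun_coeff)
qed

lemma hardy_inner_coord_mult:
  assumes "f \<in> hardy_space" "g \<in> hardy_space"
  shows "hardy_inner (coord_mult i f) g = hardy_inner f (bshift i g)"
proof -
  have "((\<lambda>k. hardy_coeff (coord_mult i f) k * cnj (hardy_coeff g k)) has_sum hardy_inner (coord_mult i f) g) UNIV"
    unfolding hardy_inner_def by (intro has_sum_infsum hardy_inner_summable coord_mult_in_hardy_space assms)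
  hence "((\<lambda>k. hardy_coeff f k * cnj (hardy_coeff (bshift i g) k)) has_sum hardy_inner (coord_mult i f) g) UNIV"
    by (subst (asm) has_sum_inc[symmetric, of i])
       (simp_all add: hardy_coeff_coord_mult hardy_coeff_coord_mult_0 hardy_coeff_bshift assms)
  then show ?thesis by (simp add: hardy_inner_def infsumI)
qed

definition vupd :: "'n \<Rightarrow> complex \<Rightarrow> complex ^ 'n::finite \<Rightarrow> complex ^ 'n" where
  "vupd i w z = (\<chi> j. if j = i then w else z $ j)"

lemma vupd_nth: "vupd i w z $ j = (if j = i then w else z $ j)"
  by (simp add: vupd_def)

lemma vupd_in_polydisc: "z \<in> polydisc \<Longrightarrow> cmod w < 1 \<Longrightarrow> vupd i w z \<in> polydisc"
  by (simp add: polydisc_def vupd_nth)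

text \<open>Setting z_i = 0 keeps exactly the monomials free of z_i; the remaining ones are z_i
  times the shifted series.\<close>

lemma bshift_eq:
  assumes "f \<in> hardy_space" "z \<in> polydisc"
  shows "z $ i * bshift i f z = f z - f (vupd i 0 z)"
proof -
  have "multi_power (vupd i 0 z) k = (if k i = 0 then multi_power z k else 0)" for k
    by (auto simp: multi_power_def vupd_nth prod_zero_iff power_0_left intro!: prod.cong)
  hence "((\<lambda>k. hardy_coeff f k * (if k i = 0 then multi_power z k else 0)) has_sum f (vupd i 0 z)) UNIV"
    using hardy_space_has_sum[OF assms(1) vupd_in_polydisc[OF assms(2), of 0 i]] by simp
  from has_sum_add[OF hardy_space_has_sum[OF assms] has_sum_cmult_right[OF this, of "-1"]]
  have "((\<lambda>k. hardy_coeff f k * (if k i = 0 then 0 else multi_power z k)) has_sum (f z + - 1 * f (vupd i 0 z))) UNIV"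
    by (rule has_sum_cong[THEN iffD1, rotated]) auto
  hence "((\<lambda>k. hardy_coeff f k * (if k i = 0 then 0 else multi_power z k)) has_sum (f z - f (vupd i 0 z))) UNIV"
    by simp
  hence "((\<lambda>k. hardy_coeff f (inc i k) * multi_power z (inc i k)) has_sum (f z - f (vupd i 0 z))) UNIV"
    by (subst (asm) has_sum_inc[symmetric, of i]) (auto simp: inc_def)
  moreover have "((\<lambda>k. z $ i * (hardy_coeff f (inc i k) * multi_power z k)) has_sum z $ i * bshift i f z) UNIV"
    using hardy_space_has_sum[OF bshift_in_hardy_space[OF assms(1)] assms(2), of i]
    by (intro has_sum_cmult_right) (simp add: hardy_coeff_bshift assms)
  ultimately show ?thesis
    unfolding multi_power_inc by (auto simp: mult_ac dest: has_sum_unique)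
qed

text \<open>Multiplication by z_i only relocates coefficients and so is injective. This replaces
  division by z_i, which would fail where z_i = 0.\<close>

lemma coord_mult_cancel:
  assumes "f \<in> hardy_space" "g \<in> hardy_space" "\<And>z. z \<in> polydisc \<Longrightarrow> z $ i * f z = z $ i * g z"
  shows "f = g"
proof (rule hardy_space_eqI[OF assms(1,2)])
  have "coord_mult i f = coord_mult i g"
    using assms hardy_space_outside[OF assms(1)] hardy_space_outside[OF assms(2)]
    by (fastforce simp: coord_mult_def fun_eq_iff)
  then show "hardy_coeff f k = hardy_coeff g k" for k
    using hardy_coeff_coord_mult[OF assms(1), of i k] hardy_coeff_coord_mult[OF assms(2), of i k] by simp
qed

section \<open>Parseval's formula on tori inside the polydisc\<close>

lemma Parseval:
  fixes f g :: "complex ^ 'n::finite \<Rightarrow> complex"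
  assumes f: "polydisc_holomorphic f" and g: "polydisc_holomorphic g" and r: "0 < r" "r < 1"
  shows "((\<lambda>k. hardy_coeff f k * cnj (hardy_coeff g k) * of_real r ^ (2 * mdeg k)) has_sum
           (\<integral>x. f (r *\<^sub>R vcis x) * cnj (g (r *\<^sub>R vcis x)) \<partial>torus)) UNIV"
proof -
  note cf = polydisc_holomorphic_continuous[OF f] and cg = polydisc_holomorphic_continuous[OF g]
  obtain B where B: "B \<ge> 0" "\<And>z. (\<And>i. cmod (z $ i) \<le> r) \<Longrightarrow> cmod (f z) \<le> B"
    using bounded_on_closed_polydisc[OF cf r(2)] by blast
  have ps: "((\<lambda>k. hardy_coeff f k * multi_power z k) has_sum f z) UNIV"
    "((\<lambda>k. hardy_coeff g k * multi_power z k) has_sum g z) UNIV" if "\<And>i. cmod (z $ i) \<le> r" for z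
    using power_series_of_hardy_coeff[OF f] power_series_of_hardy_coeff[OF g] closed_polydisc_subset[OF r(2)] that
    unfolding power_series_of_def by blast+
  \<comment> \<open>Only \<open>g\<close> is expanded; the integral of \<open>f\<close> against each
    monomial is then a Fourier coefficient.\<close>
  let ?F = "\<lambda>k x. f (r *\<^sub>R vcis x) * (cnj (hardy_coeff g k) * of_real r ^ mdeg k * cnj (multi_power (vcis x) k))"
  have "((\<lambda>k. integral\<^sup>L torus (?F k)) has_sum (\<integral>x. f (r *\<^sub>R vcis x) * cnj (g (r *\<^sub>R vcis x)) \<partial>torus)) UNIV"
  proof (rule has_sum_integral[OF torus_prob_space])
    show "(\<lambda>k. B * (cmod (hardy_coeff g k) * r ^ mdeg k)) summable_on UNIV"
      by (intro summable_on_cmult_right power_series_abs_summable[OF ps(2)]) (use r in auto)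
    show "?F k \<in> borel_measurable torus" for k
      by (intro borel_measurable_times borel_measurable_const measurable_cnj_multi_power_vcis measurable_radial[OF cf]) (use r in auto)
    have "(\<lambda>x. cnj (g (r *\<^sub>R vcis x))) \<in> borel_measurable torus"
      by (rule borel_measurable_continuous_on[where f = cnj], intro continuous_intros,
          rule measurable_radial[OF cg]) (use r in auto)
    then show "(\<lambda>x. f (r *\<^sub>R vcis x) * cnj (g (r *\<^sub>R vcis x))) \<in> borel_measurable torus"
      by (intro borel_measurable_times measurable_radial[OF cf]) (use r in auto)
    show "cmod (?F k x) \<le> B * (cmod (hardy_coeff g k) * r ^ mdeg k)" for k x
    proof -
      have "cmod (?F k x) = cmod (f (r *\<^sub>R vcis x)) * (cmod (hardy_coeff g k) * r ^ mdeg k)"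
        using r by (simp add: norm_mult norm_power)
      also have "\<dots> \<le> B * (cmod (hardy_coeff g k) * r ^ mdeg k)"
        using r by (intro mult_right_mono B) auto
      finally show ?thesis .
    qed
    show "((\<lambda>k. ?F k x) has_sum f (r *\<^sub>R vcis x) * cnj (g (r *\<^sub>R vcis x))) UNIV" for x
    proof (rule has_sum_cmult_right)
      have "((\<lambda>k. cnj (hardy_coeff g k * multi_power (r *\<^sub>R vcis x) k)) has_sum cnj (g (r *\<^sub>R vcis x))) UNIV"
        unfolding has_sum_cnj_iff by (rule ps(2)) (use r in auto)
      then show "((\<lambda>k. cnj (hardy_coeff g k) * of_real r ^ mdeg k * cnj (multi_power (vcis x) k)) has_sum cnj (g (r *\<^sub>R vcis x))) UNIV"
        by (simp add: multi_power_scaleR mult.assoc)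
    qed
  qed
  also have "(\<lambda>k. integral\<^sup>L torus (?F k)) = (\<lambda>k. hardy_coeff f k * cnj (hardy_coeff g k) * of_real r ^ (2 * mdeg k))"
  proof
    fix k
    have "integral\<^sup>L torus (?F k) = (\<integral>x. (cnj (hardy_coeff g k) * of_real r ^ mdeg k) * (f (r *\<^sub>R vcis x) * cnj (multi_power (vcis x) k)) \<partial>torus)"
      by (intro Bochner_Integration.integral_cong refl) (simp add: mult_ac)
    also have "\<dots> = (cnj (hardy_coeff g k) * of_real r ^ mdeg k) * (hardy_coeff f k * of_real r ^ mdeg k)"
      by (simp only: integral_mult_right_zero power_series_Fourier[OF cf less_imp_le[OF r(1)] r(2) ps(1)])
    finally show "integral\<^sup>L torus (?F k) = hardy_coeff f k * cnj (hardy_coeff g k) * of_real r ^ (2 * mdeg k)"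
      unfolding mult_2 power_add by (simp only: mult_ac)
  qed
  finally show ?thesis .
qed

lemma Parseval_square:
  fixes f :: "complex ^ 'n::finite \<Rightarrow> complex"
  assumes f: "polydisc_holomorphic f" and r: "0 < r" "r < 1"
  shows "((\<lambda>k. (cmod (hardy_coeff f k))\<^sup>2 * r ^ (2 * mdeg k)) has_sum
           (\<integral>x. (cmod (f (r *\<^sub>R vcis x)))\<^sup>2 \<partial>torus)) UNIV"
proof -
  have "((\<lambda>k. complex_of_real ((cmod (hardy_coeff f k))\<^sup>2 * r ^ (2 * mdeg k))) has_sum
           complex_of_real (\<integral>x. (cmod (f (r *\<^sub>R vcis x)))\<^sup>2 \<partial>torus)) UNIV"
    using Parseval[OF f f r] by (simp only: complex_norm_square[symmetric] of_real_power[symmetric] of_real_mult[symmetric] integral_complex_of_real)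
  then show ?thesis by (simp only: has_sum_of_real_iff)
qed

definition hmono :: "('n::finite \<Rightarrow> nat) \<Rightarrow> complex ^ 'n \<Rightarrow> complex" where
  "hmono k = hfun (\<lambda>l. if l = k then 1 else 0)"

lemma l2_finite_support: "finite F \<Longrightarrow> l2 (\<lambda>k. if k \<in> F then a k else 0)"
  unfolding l2_def by (rule finite_nonzero_values_imp_summable_on) auto

lemma l2_hmono: "l2 (\<lambda>l. if l = k then 1 else 0)"
  using l2_finite_support[of "{k}" "\<lambda>_. 1"] by simp

lemma hmono_in_hardy_space: "hmono k \<in> hardy_space"
  unfolding hmono_def by (intro hfun_in_hardy_space l2_hmono)

lemma hardy_coeff_hmono: "hardy_coeff (hmono k) l = (if l = k then 1 else 0)"
  unfolding hmono_def by (simp add: hfun_coeff l2_hmono)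

lemma hfun_finite_support:
  assumes "finite F" "z \<in> polydisc"
  shows "hfun (\<lambda>k. if k \<in> F then a k else 0) z = (\<Sum>k\<in>F. a k * multi_power z k)"
proof -
  have "(\<Sum>\<^sub>\<infinity>k. (if k \<in> F then a k else 0) * multi_power z k) = (\<Sum>\<^sub>\<infinity>k\<in>F. a k * multi_power z k)"
    by (rule infsum_cong_neutral) auto
  with assms show ?thesis by (simp add: hfun_def)
qed

lemma hmono_eq: "z \<in> polydisc \<Longrightarrow> hmono k z = multi_power z k"
  using hfun_finite_support[of "{k}" z "\<lambda>_. 1"] by (simp add: hmono_def)

lemma hardy_inner_hmono: "hardy_inner f (hmono k) = hardy_coeff f k"
proof -
  have "hardy_inner f (hmono k) = (\<Sum>\<^sub>\<infinity>l\<in>{k}. hardy_coeff f l)"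
    unfolding hardy_inner_def hardy_coeff_hmono by (rule infsum_cong_neutral) auto
  then show ?thesis by simp
qed

section \<open>Bounded and inner multipliers\<close>

lemma integrable_radial_square:
  fixes f :: "complex ^ 'n::finite \<Rightarrow> complex"
  assumes f: "continuous_on polydisc f" and r: "0 < r" "r < 1"
  shows "integrable torus (\<lambda>x. (cmod (f (r *\<^sub>R vcis x)))\<^sup>2)"
proof -
  interpret P: prob_space "torus :: ('n \<Rightarrow> real) measure" by (rule torus_prob_space)
  obtain B where B: "B \<ge> 0" "\<And>z. (\<And>i. cmod (z $ i) \<le> r) \<Longrightarrow> cmod (f z) \<le> B"
    using bounded_on_closed_polydisc[OF f r(2)] by blast
  have m: "(\<lambda>x. f (r *\<^sub>R vcis x)) \<in> borel_measurable torus"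
    by (rule measurable_radial[OF f]) (use r in auto)
  show ?thesis
  proof (rule P.integrable_const_bound[where B = "B\<^sup>2"])
    show "(\<lambda>x. (cmod (f (r *\<^sub>R vcis x)))\<^sup>2) \<in> borel_measurable torus"
      by (intro borel_measurable_power borel_measurable_norm[THEN measurable_compose[OF m]])
    show "AE x in torus. norm ((cmod (f (r *\<^sub>R vcis x)))\<^sup>2) \<le> B\<^sup>2"
      using r by (intro AE_I2) (auto intro!: power_mono B)
  qed
qed

lemma hardy_inner_add_right:
  assumes "f \<in> hardy_space" "g \<in> hardy_space" "h \<in> hardy_space"
  shows "hardy_inner h (\<lambda>z. f z + g z) = hardy_inner h f + hardy_inner h g"
  by (subst (1 2 3) hardy_inner_commute) (simp add: hardy_inner_add_left assms)

lemma hardy_norm_power2: "(hardy_norm f)\<^sup>2 = (\<Sum>\<^sub>\<infinity>k. (cmod (hardy_coeff f k))\<^sup>2)"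
  by (simp add: hardy_norm_def infsum_nonneg)

lemma zero_in_polydisc: "0 \<in> polydisc"
  by (simp add: polydisc_def)

text \<open>\<open>B\<close> is arbitrary because \<open>inner_function\<close> only asserts
  boundedness; the bound 1 is derived in \<open>norm_inner_le_1\<close>.\<close>

locale bounded_multiplier =
  fixes \<theta> :: "complex ^ 'n::finite \<Rightarrow> complex" and B :: real
  assumes holo: "polydisc_holomorphic \<theta>" and bound: "\<And>z. z \<in> polydisc \<Longrightarrow> cmod (\<theta> z) \<le> B"
begin

abbreviation mul :: "(complex ^ 'n \<Rightarrow> complex) \<Rightarrow> complex ^ 'n \<Rightarrow> complex" where
  "mul f \<equiv> \<lambda>z. \<theta> z * f z"

lemma B_nonneg: "0 \<le> B"
  using bound[OF zero_in_polydisc] norm_ge_zero order_trans by blast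

text \<open>On a torus of radius \<open>r\<close> the pointwise bound on \<theta> can be integrated,
  and Parseval turns both sides into weighted coefficient sums. Letting \<open>r\<close> tend to 1
  inside finite partial sums removes the weights.\<close>

lemma
  assumes f: "f \<in> hardy_space"
  shows mul_in_hardy_space: "mul f \<in> hardy_space"
    and hardy_norm_mul: "hardy_norm (mul f) \<le> B * hardy_norm f"
proof -
  note hf = hardy_space_holomorphic[OF f]
  note h = polydisc_holomorphic_mult[OF holo hf]
  let ?c = "hardy_coeff (mul f)"
  have fin: "(\<Sum>k\<in>F. (cmod (?c k))\<^sup>2) \<le> (B * hardy_norm f)\<^sup>2" if F: "finite F" for F
  proof (rule tendsto_upperbound)
    show "((\<lambda>r. \<Sum>k\<in>F. (cmod (?c k))\<^sup>2 * r ^ (2 * mdeg k)) \<longlongrightarrow> (\<Sum>k\<in>F. (cmod (?c k))\<^sup>2)) (at_left (1::real))"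
      by (auto intro!: tendsto_eq_intros sum.cong)
    show "\<forall>\<^sub>F r in at_left (1::real). (\<Sum>k\<in>F. (cmod (?c k))\<^sup>2 * r ^ (2 * mdeg k)) \<le> (B * hardy_norm f)\<^sup>2"
    proof (rule eventually_at_leftI[of 0])
      fix r :: real assume "r \<in> {0<..<1}"
      hence r: "0 < r" "r < 1" by auto
      have "(\<Sum>k\<in>F. (cmod (?c k))\<^sup>2 * r ^ (2 * mdeg k)) \<le> (\<integral>x. (cmod (mul f (r *\<^sub>R vcis x)))\<^sup>2 \<partial>torus)"
        by (rule finite_sum_le_has_sum[OF Parseval_square[OF h r] F]) auto
      also have "\<dots> \<le> (\<integral>x. B\<^sup>2 * (cmod (f (r *\<^sub>R vcis x)))\<^sup>2 \<partial>torus)"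
      proof (rule integral_mono)
        show "integrable torus (\<lambda>x. (cmod (mul f (r *\<^sub>R vcis x)))\<^sup>2)"
          by (rule integrable_radial_square[OF polydisc_holomorphic_continuous[OF h] r])
        show "integrable torus (\<lambda>x. B\<^sup>2 * (cmod (f (r *\<^sub>R vcis x)))\<^sup>2)"
          by (intro integrable_mult_right integrable_radial_square[OF polydisc_holomorphic_continuous[OF hf] r])
        show "(cmod (mul f (r *\<^sub>R vcis x)))\<^sup>2 \<le> B\<^sup>2 * (cmod (f (r *\<^sub>R vcis x)))\<^sup>2" for x
          unfolding norm_mult power_mult_distrib using r
          by (intro mult_right_mono power_mono bound vcis_in_polydisc) auto
      qed
      also have "\<dots> = B\<^sup>2 * (\<integral>x. (cmod (f (r *\<^sub>R vcis x)))\<^sup>2 \<partial>torus)" by simp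
      also have "(\<integral>x. (cmod (f (r *\<^sub>R vcis x)))\<^sup>2 \<partial>torus) \<le> (hardy_norm f)\<^sup>2"
        unfolding hardy_norm_power2
      proof (rule has_sum_mono[OF Parseval_square[OF hf r] has_sum_infsum])
        show "(\<lambda>k. (cmod (hardy_coeff f k))\<^sup>2) summable_on UNIV"
          using hardy_space_l2[OF f] by (simp add: l2_def)
        show "(cmod (hardy_coeff f k))\<^sup>2 * r ^ (2 * mdeg k) \<le> (cmod (hardy_coeff f k))\<^sup>2" for k
          using r by (intro mult_left_le power_le_one) auto
      qed
      finally show "(\<Sum>k\<in>F. (cmod (?c k))\<^sup>2 * r ^ (2 * mdeg k)) \<le> (B * hardy_norm f)\<^sup>2"
        by (simp add: power_mult_distrib mult_left_mono)
    qed simp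
  qed simp
  have s: "(\<lambda>k. (cmod (?c k))\<^sup>2) summable_on UNIV"
    by (rule nonneg_bdd_above_summable_on) (auto intro!: bdd_aboveI2[where M = "(B * hardy_norm f)\<^sup>2"] fin)
  then show "mul f \<in> hardy_space"
    by (intro hardy_spaceI h) (auto simp: hardy_space_outside[OF f] l2_def)
  have "(hardy_norm (mul f))\<^sup>2 \<le> (B * hardy_norm f)\<^sup>2"
    unfolding hardy_norm_power2 by (rule infsum_le_finite_sums[OF s]) (rule fin)
  then show "hardy_norm (mul f) \<le> B * hardy_norm f"
    by (rule power2_le_imp_le) (use B_nonneg in simp)
qed

lemma mul_hardy_inner_bound:
  assumes "f \<in> hardy_space" "x \<in> hardy_space"
  shows "cmod (hardy_inner x (mul f)) \<le> hardy_norm x * B * hardy_norm f"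
proof -
  have "cmod (hardy_inner x (mul f)) \<le> hardy_norm x * hardy_norm (mul f)"
    by (intro hardy_Cauchy_Schwarz assms mul_in_hardy_space)
  also have "\<dots> \<le> hardy_norm x * (B * hardy_norm f)"
    by (intro mult_left_mono hardy_norm_mul assms) auto
  finally show ?thesis by (simp add: mult.assoc)
qed

text \<open>Forced by the adjoint relation: testing the adjoint of multiplication by \<theta> on a
  monomial reads off a coefficient.\<close>

definition adj_coeff :: "(complex ^ 'n \<Rightarrow> complex) \<Rightarrow> ('n \<Rightarrow> nat) \<Rightarrow> complex" where
  "adj_coeff x k = hardy_inner x (mul (hmono k))"

definition adj :: "(complex ^ 'n \<Rightarrow> complex) \<Rightarrow> complex ^ 'n \<Rightarrow> complex" where
  "adj x = hfun (adj_coeff x)"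

lemma hardy_inner_mul_finite:
  assumes "finite F" "x \<in> hardy_space"
  shows "hardy_inner x (mul (hfun (\<lambda>k. if k \<in> F then a k else 0))) = (\<Sum>k\<in>F. adj_coeff x k * cnj (a k))"
  using assms(1)
proof (induction F)
  case empty
  have "mul (hfun (\<lambda>k. 0)) = (\<lambda>z. 0 * mul (hmono undefined) z)"
    by (simp add: hfun_def fun_eq_iff)
  then show ?case
    using hardy_inner_cmult_right[OF mul_in_hardy_space[OF hmono_in_hardy_space], of x 0] by simp
next
  case (insert l F)
  let ?t = "\<lambda>F. hfun (\<lambda>k. if k \<in> F then a k else 0)"
  have t: "?t F \<in> hardy_space"
    by (intro hfun_in_hardy_space l2_finite_support insert.hyps)
  have "?t (insert l F) z = ?t F z + a l * hmono l z" for z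
  proof (cases "z \<in> polydisc")
    case True
    then show ?thesis
      using insert.hyps hfun_finite_support[of F z a] hfun_finite_support[of "insert l F" z a]
      by (simp add: hmono_eq)
  qed (simp add: hfun_def hmono_def)
  hence eq: "mul (?t (insert l F)) = (\<lambda>z. mul (?t F) z + a l * mul (hmono l) z)"
    by (simp add: fun_eq_iff algebra_simps)
  have "hardy_inner x (mul (?t (insert l F))) = hardy_inner x (\<lambda>z. mul (?t F) z + a l * mul (hmono l) z)"
    by (rule arg_cong[OF eq])
  also have "\<dots> = hardy_inner x (mul (?t F)) + cnj (a l) * hardy_inner x (mul (hmono l))"
    by (simp add: hardy_inner_add_right hardy_inner_cmult_right mul_in_hardy_space t hmono_in_hardy_space
        hardy_space_cmult assms)
  finally have "hardy_inner x (mul (?t (insert l F))) = hardy_inner x (mul (?t F)) + cnj (a l) * hardy_inner x (mul (hmono l))" .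
  with insert show ?case
    by (simp add: adj_coeff_def)
qed

lemma l2_adj_coeff:
  assumes x: "x \<in> hardy_space"
  shows "l2 (adj_coeff x)"
proof -
  let ?C = "hardy_norm x * B"
  have C: "?C \<ge> 0" using B_nonneg by simp
  have fin: "(\<Sum>k\<in>F. (cmod (adj_coeff x k))\<^sup>2) \<le> ?C\<^sup>2" if F: "finite F" for F
  proof -
    let ?S = "\<Sum>k\<in>F. (cmod (adj_coeff x k))\<^sup>2"
    \<comment> \<open>Testing against the truncated coefficient sequence itself yields \<open>S \<le> C * sqrt S\<close>.\<close>
    let ?t = "hfun (\<lambda>k. if k \<in> F then adj_coeff x k else 0)"
    have l: "l2 (\<lambda>k. if k \<in> F then adj_coeff x k else 0)" using F by (rule l2_finite_support)
    have "(hardy_norm ?t)\<^sup>2 = (\<Sum>\<^sub>\<infinity>k\<in>F. (cmod (adj_coeff x k))\<^sup>2)"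
      unfolding hardy_norm_power2 hfun_coeff[OF l] by (rule infsum_cong_neutral) auto
    hence t: "hardy_norm ?t = sqrt ?S"
      by (intro real_sqrt_unique[symmetric]) (simp_all add: F)
    have S: "?S \<ge> 0" by (intro sum_nonneg) auto
    have eq: "complex_of_real ?S = hardy_inner x (mul ?t)"
      unfolding hardy_inner_mul_finite[OF F x] of_real_sum
      by (intro sum.cong refl) (simp only: if_True complex_norm_square)
    have "?S = cmod (complex_of_real ?S)"
      using S by (simp only: norm_of_real abs_of_nonneg)
    also have "\<dots> = cmod (hardy_inner x (mul ?t))"
      by (simp only: eq)
    also have "\<dots> \<le> ?C * hardy_norm ?t"
      by (intro mul_hardy_inner_bound hfun_in_hardy_space l x)
    finally have le: "?S \<le> ?C * sqrt ?S" unfolding t .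
    have "sqrt ?S \<le> ?C"
    proof (cases "?S = 0")
      case False
      hence "sqrt ?S > 0" using S by simp
      moreover have "sqrt ?S * sqrt ?S \<le> ?C * sqrt ?S" using le S by simp
      ultimately show ?thesis by (rule mult_right_le_imp_le[rotated])
    qed (use C in simp)
    hence "(sqrt ?S)\<^sup>2 \<le> ?C\<^sup>2" using S by (intro power_mono) auto
    then show ?thesis using S by simp
  qed
  show ?thesis
    unfolding l2_def
    by (rule nonneg_bdd_above_summable_on) (auto intro!: bdd_aboveI2[where M = "?C\<^sup>2"] fin)
qed

lemma adj_in_hardy_space: "x \<in> hardy_space \<Longrightarrow> adj x \<in> hardy_space"
  unfolding adj_def by (intro hfun_in_hardy_space l2_adj_coeff)

text \<open>The relation holds for the truncations of \<open>h\<close> to finite sets of exponents.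
  They converge to \<open>h\<close> in norm, the squared error being the tail of the coefficient
  sum, and pairing with \<open>mul\<close> is bounded.\<close>

lemma hardy_inner_adj:
  assumes x: "x \<in> hardy_space" and h: "h \<in> hardy_space"
  shows "hardy_inner (adj x) h = hardy_inner x (mul h)"
proof -
  let ?h = "hardy_coeff h"
  let ?t = "\<lambda>F. hfun (\<lambda>k. if k \<in> F then ?h k else 0)"
  let ?C = "hardy_norm x * B"
  have lim: "((\<lambda>F. \<Sum>k\<in>F. (cmod (?h k))\<^sup>2) \<longlongrightarrow> (hardy_norm h)\<^sup>2) (finite_subsets_at_top UNIV)"
    using has_sum_infsum[of "\<lambda>k. (cmod (?h k))\<^sup>2" UNIV] hardy_space_l2[OF h]
    by (simp add: hardy_norm_power2 l2_def has_sum_def)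
  have est: "cmod ((\<Sum>k\<in>F. adj_coeff x k * cnj (?h k)) - hardy_inner x (mul h))
      \<le> ?C * sqrt ((hardy_norm h)\<^sup>2 - (\<Sum>k\<in>F. (cmod (?h k))\<^sup>2))" if F: "finite F" for F
  proof -
    have l: "l2 (\<lambda>k. if k \<in> F then ?h k else 0)" using F by (rule l2_finite_support)
    note t = hfun_in_hardy_space[OF l]
    have "((\<lambda>k. if k \<in> F then (cmod (?h k))\<^sup>2 else 0) has_sum (\<Sum>k\<in>F. (cmod (?h k))\<^sup>2)) UNIV"
      by (rule has_sum_finite_neutralI[of F]) (use F in auto)
    from has_sum_add[OF has_sum_infsum has_sum_cmult_right[OF this, of "-1"], of "\<lambda>k. (cmod (?h k))\<^sup>2"]
    have "((\<lambda>k. (cmod (?h k))\<^sup>2 + - 1 * (if k \<in> F then (cmod (?h k))\<^sup>2 else 0)) has_sum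
        ((hardy_norm h)\<^sup>2 + - 1 * (\<Sum>k\<in>F. (cmod (?h k))\<^sup>2))) UNIV"
      using hardy_space_l2[OF h] by (simp add: l2_def hardy_norm_power2)
    hence "((\<lambda>k. (cmod ((if k \<in> F then ?h k else 0) - ?h k))\<^sup>2) has_sum
        ((hardy_norm h)\<^sup>2 + - 1 * (\<Sum>k\<in>F. (cmod (?h k))\<^sup>2))) UNIV"
      by (rule has_sum_cong[THEN iffD1, rotated]) auto
    hence "hardy_norm (\<lambda>z. ?t F z - h z) = sqrt ((hardy_norm h)\<^sup>2 - (\<Sum>k\<in>F. (cmod (?h k))\<^sup>2))"
      unfolding hardy_norm_def[of "\<lambda>z. ?t F z - h z"] hardy_coeff_diff[OF t h] hfun_coeff[OF l]
      by (subst infsumI) auto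
    moreover have "(\<Sum>k\<in>F. adj_coeff x k * cnj (?h k)) - hardy_inner x (mul h) = hardy_inner x (mul (\<lambda>z. ?t F z - h z))"
      unfolding hardy_inner_mul_finite[OF F x, symmetric]
      by (simp add: right_diff_distrib hardy_inner_diff_right mul_in_hardy_space t h x)
    ultimately show ?thesis
      using mul_hardy_inner_bound[OF hardy_space_diff[OF t h] x] by simp
  qed
  have "((\<lambda>F. ?C * sqrt ((hardy_norm h)\<^sup>2 - (\<Sum>k\<in>F. (cmod (?h k))\<^sup>2))) \<longlongrightarrow> 0) (finite_subsets_at_top UNIV)"
    by (rule tendsto_eq_intros tendsto_real_sqrt lim refl)+ simp
  hence "((\<lambda>F. (\<Sum>k\<in>F. adj_coeff x k * cnj (?h k)) - hardy_inner x (mul h)) \<longlongrightarrow> 0) (finite_subsets_at_top UNIV)"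
    by (rule Lim_null_comparison[rotated])
       (use est in \<open>auto intro!: eventually_finite_subsets_at_top_weakI\<close>)
  hence "((\<lambda>k. adj_coeff x k * cnj (?h k)) has_sum hardy_inner x (mul h)) UNIV"
    unfolding has_sum_def by (simp add: LIM_zero_iff)
  then show ?thesis
    unfolding adj_def hardy_inner_def[of "hfun (adj_coeff x)"] hfun_coeff[OF l2_adj_coeff[OF x]] by (rule infsumI)
qed

lemma adj_eqI:
  assumes "x \<in> hardy_space" "y \<in> hardy_space" "\<And>h. h \<in> hardy_space \<Longrightarrow> hardy_inner y h = hardy_inner x (mul h)"
  shows "adj x = y"
  by (rule hardy_eqI_inner) (simp_all add: assms adj_in_hardy_space hardy_inner_adj)

text \<open>Kernels are eigenvectors of the adjoint: pairing with \<open>h\<close> evaluates the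
  product of \<theta> and \<open>h\<close> at \<open>w\<close>.\<close>

lemma adj_kern:
  assumes "w \<in> polydisc"
  shows "adj (kern w) = (\<lambda>z. cnj (\<theta> w) * kern w z)"
proof (rule adj_eqI)
  fix h :: "complex ^ 'n \<Rightarrow> complex" assume h: "h \<in> hardy_space"
  have "hardy_inner (\<lambda>z. cnj (\<theta> w) * kern w z) h = cnj (\<theta> w * h w)"
    by (simp add: hardy_inner_cmult_left kern_in_hardy_space assms hardy_inner_commute[of "kern w"]
        kern_reproducing h)
  also have "\<dots> = hardy_inner (kern w) (mul h)"
    by (simp add: hardy_inner_commute[of "kern w"] kern_reproducing assms mul_in_hardy_space h)
  finally show "hardy_inner (\<lambda>z. cnj (\<theta> w) * kern w z) h = hardy_inner (kern w) (mul h)" .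
qed (auto intro: kern_in_hardy_space hardy_space_cmult assms)

end

text \<open>An Abel-type limit: absolute summability gives uniform convergence on [0, 1] including
  the endpoint, hence continuity at 1.\<close>

lemma infsum_radial_limit:
  fixes a :: "('n::finite \<Rightarrow> nat) \<Rightarrow> complex"
  assumes s: "(\<lambda>k. cmod (a k)) summable_on UNIV"
  shows "((\<lambda>r. \<Sum>\<^sub>\<infinity>k. a k * of_real r ^ (2 * mdeg k)) \<longlongrightarrow> (\<Sum>\<^sub>\<infinity>k. a k)) (at_left (1::real))"
proof -
  let ?f = "\<lambda>k r. a k * of_real r ^ (2 * mdeg k)"
  have "uniform_limit {0..1::real} (\<lambda>X r. \<Sum>k\<in>X. ?f k r) (\<lambda>r. \<Sum>\<^sub>\<infinity>k. ?f k r) (finite_subsets_at_top UNIV)"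
  proof (rule Weierstrass_m_test_general[OF _ s])
    show "cmod (?f k r) \<le> cmod (a k)" if "r \<in> {0..1}" for k r
      using that by (auto simp: norm_mult norm_power intro!: mult_left_le power_le_one)
  qed
  hence "continuous_on {0..1} (\<lambda>r::real. \<Sum>\<^sub>\<infinity>k. ?f k r)"
    by (rule uniform_limit_theorem[rotated]) (auto intro!: always_eventually continuous_intros)
  hence "((\<lambda>r. \<Sum>\<^sub>\<infinity>k. ?f k r) \<longlongrightarrow> (\<Sum>\<^sub>\<infinity>k. ?f k 1)) (at 1 within {0..1})"
    unfolding continuous_on_def by (rule bspec) simp
  then show ?thesis by (simp add: at_within_Icc_at_left)
qed

locale inner_multiplier = bounded_multiplier \<theta> B for \<theta> :: "complex ^ 'n::finite \<Rightarrow> complex" and B +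
  assumes radial: "AE x in torus. \<exists>w. cmod w = 1 \<and> ((\<lambda>r. \<theta> (r *\<^sub>R vcis x)) \<longlongrightarrow> w) (at_left (1::real))"
begin

text \<open>Evaluate the Parseval integrals at radii \<open>s m\<close> tending to 1 in two ways.
  The coefficient sums tend to the inner product; by dominated convergence the integrals tend to
  that of the two monomials, since |\<theta>| tends to 1 almost everywhere.\<close>

lemma hardy_inner_mul_hmono:
  "hardy_inner (mul (hmono k)) (mul (hmono l)) = (if k = l then 1 else 0)"
proof -
  interpret P: prob_space "torus :: ('n \<Rightarrow> real) measure" by (rule torus_prob_space)
  let ?p = "mul (hmono k)" and ?q = "mul (hmono l)"
  note p = mul_in_hardy_space[OF hmono_in_hardy_space[of k]] and q = mul_in_hardy_space[OF hmono_in_hardy_space[of l]]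
  note hp = hardy_space_holomorphic[OF p] and hq = hardy_space_holomorphic[OF q]
  \<comment> \<open>Dominated convergence needs a sequence of radii; the 2 keeps \<open>s 0\<close>
    positive.\<close>
  define s where "s = (\<lambda>m::nat. 1 - 1 / (real m + 2))"
  have s01: "0 < s m" "s m < 1" for m by (auto simp: s_def field_simps)
  have s1: "s \<longlonglongrightarrow> 1" unfolding s_def by real_asymp
  have s: "filterlim s (at_left 1) sequentially"
    unfolding filterlim_at using s1 s01 by (auto intro!: always_eventually simp: less_imp_neq)
  let ?G = "\<lambda>m x. ?p (s m *\<^sub>R vcis x) * cnj (?q (s m *\<^sub>R vcis x))"
  let ?g = "\<lambda>x. multi_power (vcis x) k * cnj (multi_power (vcis x) l)"
  have cm: "(\<lambda>x. cnj (f x)) \<in> borel_measurable torus" if "f \<in> borel_measurable torus" for f :: "_ \<Rightarrow> complex"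
    by (rule borel_measurable_continuous_on[OF _ that]) (intro continuous_intros)
  have lim: "(\<lambda>m. integral\<^sup>L torus (?G m)) \<longlonglongrightarrow> integral\<^sup>L torus ?g"
  proof (rule integral_dominated_convergence[where w = "\<lambda>_. B * B"])
    show "?g \<in> borel_measurable torus"
      by (intro borel_measurable_times measurable_multi_power_vcis measurable_cnj_multi_power_vcis)
    show "?G m \<in> borel_measurable torus" for m
      using s01[of m] by (intro borel_measurable_times cm measurable_radial polydisc_holomorphic_continuous hp hq) auto
    show "AE x in torus. (\<lambda>m. ?G m x) \<longlonglongrightarrow> ?g x"
      using radial
    proof eventually_elim
      case (elim x)
      then obtain w where w: "cmod w = 1" "((\<lambda>r. \<theta> (r *\<^sub>R vcis x)) \<longlongrightarrow> w) (at_left (1::real))" by blast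
      from filterlim_compose[OF w(2) s] have th: "(\<lambda>m. \<theta> (s m *\<^sub>R vcis x)) \<longlonglongrightarrow> w" .
      have ww: "w * cnj w = 1" using w(1) by (simp add: complex_norm_square[symmetric])
      have "(\<lambda>m. (\<theta> (s m *\<^sub>R vcis x) * (of_real (s m) ^ mdeg k * multi_power (vcis x) k)) *
              cnj (\<theta> (s m *\<^sub>R vcis x) * (of_real (s m) ^ mdeg l * multi_power (vcis x) l)))
          \<longlonglongrightarrow> (w * (of_real 1 ^ mdeg k * multi_power (vcis x) k)) * cnj (w * (of_real 1 ^ mdeg l * multi_power (vcis x) l))"
        by (intro tendsto_intros th s1)
      also have "(w * (of_real 1 ^ mdeg k * multi_power (vcis x) k)) * cnj (w * (of_real 1 ^ mdeg l * multi_power (vcis x) l))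
          = (w * cnj w) * ?g x" by (simp add: mult_ac)
      finally show ?case
        using s01 by (simp add: ww hmono_eq vcis_in_polydisc less_imp_le multi_power_scaleR)
    qed
    show "AE x in torus. norm (?G m x) \<le> B * B" for m
    proof (rule AE_I2)
      fix x :: "'n \<Rightarrow> real"
      have v: "s m *\<^sub>R vcis x \<in> polydisc" using s01[of m] by (intro vcis_in_polydisc) auto
      have "cmod (mul (hmono j) (s m *\<^sub>R vcis x)) \<le> B * 1" for j
        unfolding norm_mult hmono_eq[OF v] multi_power_scaleR using s01[of m]
        by (intro mult_mono bound v) (auto simp: norm_mult norm_power B_nonneg intro!: power_le_one)
      then show "norm (?G m x) \<le> B * B"
        unfolding norm_mult[of "?p _"] complex_mod_cnj by (intro mult_mono) (auto simp: B_nonneg)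
    qed
  qed simp
  have eq: "integral\<^sup>L torus (?G m) = (\<Sum>\<^sub>\<infinity>j. hardy_coeff ?p j * cnj (hardy_coeff ?q j) * of_real (s m) ^ (2 * mdeg j))" for m
    using Parseval[OF hp hq s01] by (rule infsumI[symmetric])
  have "(\<lambda>m. \<Sum>\<^sub>\<infinity>j. hardy_coeff ?p j * cnj (hardy_coeff ?q j) * of_real (s m) ^ (2 * mdeg j))
      \<longlonglongrightarrow> hardy_inner ?p ?q"
    unfolding hardy_inner_def
    by (rule filterlim_compose[OF infsum_radial_limit s])
       (use hardy_inner_summable[OF p q] in \<open>simp add: summable_on_iff_abs_summable_on_complex\<close>)
  hence "(\<lambda>m. integral\<^sup>L torus (?G m)) \<longlonglongrightarrow> hardy_inner ?p ?q"
    unfolding eq .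
  from LIMSEQ_unique[OF this lim] show ?thesis by (simp add: torus_orthogonality)
qed

text \<open>This is the isometry property. For monomials it is a comparison of coefficients; for
  general \<open>f\<close>, moving \<theta> across the inner product puts the adjoint on a monomial
  again.\<close>

lemma adj_mul:
  assumes f: "f \<in> hardy_space"
  shows "adj (mul f) = f"
proof -
  have mono: "adj (mul (hmono l)) = hmono l" for l
    by (rule hardy_space_eqI[OF adj_in_hardy_space[OF mul_in_hardy_space[OF hmono_in_hardy_space]] hmono_in_hardy_space])
       (simp add: hardy_inner_hmono[symmetric] hardy_inner_adj mul_in_hardy_space hmono_in_hardy_space hardy_inner_mul_hmono,
        simp add: hardy_inner_hmono hardy_coeff_hmono)
  show ?thesis
  proof (rule hardy_space_eqI[OF adj_in_hardy_space[OF mul_in_hardy_space[OF f]] f])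
    fix k
    have "hardy_coeff (adj (mul f)) k = hardy_inner (mul f) (mul (hmono k))"
      by (simp add: hardy_inner_hmono[symmetric] hardy_inner_adj mul_in_hardy_space hmono_in_hardy_space f)
    also have "\<dots> = cnj (hardy_inner (adj (mul (hmono k))) f)"
      by (simp add: hardy_inner_adj mul_in_hardy_space hmono_in_hardy_space f hardy_inner_commute[of "mul f"])
    also have "\<dots> = hardy_coeff f k"
      by (simp add: mono hardy_inner_hmono[symmetric] hardy_inner_commute[of f])
    finally show "hardy_coeff (adj (mul f)) k = hardy_coeff f k" .
  qed
qed

end

lemma inner_multiplierI:
  assumes "inner_function \<theta>"
  obtains B where "inner_multiplier \<theta> B"
proof -
  obtain B where "\<forall>x\<in>\<theta> ` polydisc. cmod x \<le> B"
    using assms by (auto simp: inner_function_def bounded_iff)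
  moreover have "AE x in torus. \<exists>w. cmod w = 1 \<and> ((\<lambda>r. \<theta> (r *\<^sub>R vcis x)) \<longlongrightarrow> w) (at_left (1::real))"
    using assms by (intro AE_torus_measureD) (auto simp: inner_function_def)
  ultimately have "inner_multiplier \<theta> B"
    using assms by unfold_locales (auto simp: inner_function_def)
  then show ?thesis by (rule that)
qed

section \<open>Commutators on the quotient module\<close>

text \<open>The norm limit \<open>g\<close> supplied by compactness is also a pointwise limit, so it
  vanishes wherever z_j is nonzero, and cancelling z_j gives \<open>g = 0\<close>. The exception z_j
  = 0 is allowed because the commutator formula controls only z_j times the value.\<close>

lemma compact_operator_pointwise_null:
  fixes Q :: "(complex ^ 'n::finite \<Rightarrow> complex) set"
  assumes T: "compact_operator_on Q T" and Q: "Q \<subseteq> hardy_space" and TQ: "\<And>f. f \<in> Q \<Longrightarrow> T f \<in> hardy_space"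
    and f: "\<And>m::nat. f m \<in> Q" "\<And>m. hardy_norm (f m) \<le> C"
    and lim: "\<And>z. z \<in> polydisc \<Longrightarrow> z $ j \<noteq> 0 \<Longrightarrow> (\<lambda>m. T (f m) z) \<longlonglongrightarrow> 0"
  obtains s :: "nat \<Rightarrow> nat" where "strict_mono s" "(\<lambda>m. hardy_norm (T (f (s m)))) \<longlonglongrightarrow> 0"
proof -
  obtain g and s :: "nat \<Rightarrow> nat" where g: "g \<in> Q" and s: "strict_mono s"
    and gl: "(\<lambda>m. hardy_norm (\<lambda>z. T (f (s m)) z - g z)) \<longlonglongrightarrow> 0"
    using T f unfolding compact_operator_on_def by blast
  have gH: "g \<in> hardy_space" using g Q by auto
  have "g z = 0" if z: "z \<in> polydisc" "z $ j \<noteq> 0" for z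
  proof -
    have "(\<lambda>m. T (f (s m)) z - g z) \<longlonglongrightarrow> 0"
    proof (rule Lim_null_comparison)
      show "\<forall>\<^sub>F m in sequentially. norm (T (f (s m)) z - g z)
          \<le> hardy_norm (\<lambda>z. T (f (s m)) z - g z) * hardy_norm (kern z)"
        by (intro always_eventually allI hardy_point_evaluation[of "\<lambda>z. T (f (s _)) z - g z"] hardy_space_diff TQ f gH z)
      show "(\<lambda>m. hardy_norm (\<lambda>z. T (f (s m)) z - g z) * hardy_norm (kern z)) \<longlonglongrightarrow> 0"
        using gl by (rule tendsto_mult_left_zero)
    qed
    moreover have "(\<lambda>m. T (f (s m)) z - g z) \<longlonglongrightarrow> 0 - g z"
      using LIMSEQ_subseq_LIMSEQ[OF lim[OF z] s] by (intro tendsto_diff) (auto simp: o_def)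
    ultimately show "g z = 0" using LIMSEQ_unique by fastforce
  qed
  hence "g = (\<lambda>_. 0)"
    by (intro coord_mult_cancel[OF gH zero_in_hardy_space, of j]) auto
  with gl have "(\<lambda>m. hardy_norm (T (f (s m)))) \<longlonglongrightarrow> 0" by simp
  with s show ?thesis by (rule that)
qed

lemma hardy_inner_bshift:
  assumes "f \<in> hardy_space" "g \<in> hardy_space"
  shows "hardy_inner (bshift i g) f = hardy_inner g (coord_mult i f)"
  by (subst (1 2) hardy_inner_commute) (simp add: hardy_inner_coord_mult assms)

section \<open>The quotient module, its projection and its shifts\<close>

context inner_multiplier
begin

abbreviation Q :: "(complex ^ 'n \<Rightarrow> complex) set" where
  "Q \<equiv> beurling_quotient \<theta>"

lemma Q_iff: "f \<in> Q \<longleftrightarrow> f \<in> hardy_space \<and> (\<forall>h\<in>hardy_space. hardy_inner f (mul h) = 0)"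
  by (auto simp: beurling_quotient_def hardy_orthocomplement_def)

lemma Q_hardy_space: "f \<in> Q \<Longrightarrow> f \<in> hardy_space"
  by (simp add: Q_iff)

lemma Q_orthogonal: "f \<in> Q \<Longrightarrow> h \<in> hardy_space \<Longrightarrow> hardy_inner f (mul h) = 0"
  by (simp add: Q_iff)

lemma Q_orthogonal': "f \<in> Q \<Longrightarrow> h \<in> hardy_space \<Longrightarrow> hardy_inner (mul h) f = 0"
  by (subst hardy_inner_commute) (simp add: Q_orthogonal)

lemma Q_diff: "f \<in> Q \<Longrightarrow> g \<in> Q \<Longrightarrow> (\<lambda>z. f z - g z) \<in> Q"
  by (simp add: Q_iff hardy_space_diff hardy_inner_diff_left mul_in_hardy_space)

lemma Q_eqI:
  assumes "f \<in> Q" "g \<in> Q" "\<And>h. h \<in> Q \<Longrightarrow> hardy_inner h f = hardy_inner h g"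
  shows "f = g"
proof -
  let ?d = "\<lambda>z. f z - g z"
  have d: "?d \<in> Q" using assms(1,2) by (rule Q_diff)
  have "hardy_inner ?d ?d = hardy_inner ?d f - hardy_inner ?d g"
    by (intro hardy_inner_diff_right Q_hardy_space d assms)
  hence "hardy_inner ?d ?d = 0" using assms(3)[OF d] by simp
  from hardy_inner_self_eq_0[OF Q_hardy_space[OF d] this] show ?thesis by (auto simp: fun_eq_iff)
qed

text \<open>Since multiplication by \<theta> is an isometry, \<theta> times \<open>adj x\<close> is
  the projection of \<open>x\<close> onto the range; this is the complementary projection.\<close>

definition proj :: "(complex ^ 'n \<Rightarrow> complex) \<Rightarrow> complex ^ 'n \<Rightarrow> complex" where
  "proj x = (\<lambda>z. x z - \<theta> z * adj x z)"

lemma proj_in_Q: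
  assumes "x \<in> hardy_space"
  shows "proj x \<in> Q"
  unfolding Q_iff
proof (intro conjI ballI)
  show "proj x \<in> hardy_space"
    unfolding proj_def by (intro hardy_space_diff mul_in_hardy_space adj_in_hardy_space assms)
  fix h :: "complex ^ 'n \<Rightarrow> complex" assume h: "h \<in> hardy_space"
  have "hardy_inner (mul (adj x)) (mul h) = hardy_inner (adj x) h"
    by (subst hardy_inner_adj[symmetric])
       (simp_all add: adj_mul adj_in_hardy_space mul_in_hardy_space assms h)
  also have "\<dots> = hardy_inner x (mul h)" by (rule hardy_inner_adj[OF assms h])
  finally show "hardy_inner (proj x) (mul h) = 0"
    unfolding proj_def by (simp add: hardy_inner_diff_left mul_in_hardy_space adj_in_hardy_space assms h)
qed

lemma hardy_inner_proj:
  assumes "x \<in> hardy_space" "g \<in> Q"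
  shows "hardy_inner (proj x) g = hardy_inner x g"
  unfolding proj_def using assms
  by (simp add: hardy_inner_diff_left mul_in_hardy_space adj_in_hardy_space Q_hardy_space Q_orthogonal')

lemma hardy_proj_eq:
  assumes x: "x \<in> hardy_space"
  shows "hardy_proj Q x = proj x"
  unfolding hardy_proj_def
proof (rule the_equality)
  show "proj x \<in> Q \<and> (\<forall>h\<in>Q. hardy_inner (\<lambda>z. x z - proj x z) h = 0)"
    using proj_in_Q[OF x]
    by (simp add: hardy_inner_diff_left Q_hardy_space x hardy_inner_proj)
  fix g assume g: "g \<in> Q \<and> (\<forall>h\<in>Q. hardy_inner (\<lambda>z. x z - g z) h = 0)"
  show "g = proj x"
  proof (rule Q_eqI)
    fix h assume h: "h \<in> Q"
    have "hardy_inner x h - hardy_inner g h = 0"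
      using g h by (metis hardy_inner_diff_left Q_hardy_space x)
    hence "hardy_inner g h = hardy_inner (proj x) h" using h by (simp add: hardy_inner_proj x)
    then show "hardy_inner h g = hardy_inner h (proj x)"
      by (metis hardy_inner_commute)
  qed (use g proj_in_Q[OF x] in auto)
qed

lemma coord_mult_mul: "coord_mult j (mul h) = mul (coord_mult j h)"
  by (simp add: coord_mult_def fun_eq_iff)

text \<open>The multiples of \<theta> are invariant under multiplication by z_j, so their
  orthocomplement is invariant under its adjoint.\<close>

lemma bshift_in_Q:
  assumes "g \<in> Q"
  shows "bshift j g \<in> Q"
  unfolding Q_iff
proof (intro conjI ballI)
  show "bshift j g \<in> hardy_space" by (intro bshift_in_hardy_space Q_hardy_space assms)
  fix h :: "complex ^ 'n \<Rightarrow> complex" assume h: "h \<in> hardy_space"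
  then show "hardy_inner (bshift j g) (mul h) = 0"
    using assms
    by (simp add: hardy_inner_bshift mul_in_hardy_space Q_hardy_space coord_mult_mul Q_orthogonal coord_mult_in_hardy_space)
qed

lemma compressed_mult_eq: "f \<in> Q \<Longrightarrow> compressed_mult Q i f = proj (coord_mult i f)"
  unfolding compressed_mult_def by (intro hardy_proj_eq coord_mult_in_hardy_space Q_hardy_space)

text \<open>As \<open>Q\<close> is invariant under the backward shift, the adjoint of the
  compression is its plain restriction, with no projection left.\<close>

lemma hardy_adjoint_eq:
  assumes g: "g \<in> Q"
  shows "hardy_adjoint Q (compressed_mult Q j) g = bshift j g"
proof -
  have eq: "hardy_inner (compressed_mult Q j f) g = hardy_inner f (bshift j g)" if "f \<in> Q" for f
    using that g
    by (simp add: compressed_mult_eq hardy_inner_proj coord_mult_in_hardy_space Q_hardy_space hardy_inner_coord_mult)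
  show ?thesis
    unfolding hardy_adjoint_def
  proof (rule the_equality)
    show "bshift j g \<in> Q \<and> (\<forall>f\<in>Q. hardy_inner (compressed_mult Q j f) g = hardy_inner f (bshift j g))"
      using bshift_in_Q[OF g] eq by blast
    fix h assume h: "h \<in> Q \<and> (\<forall>f\<in>Q. hardy_inner (compressed_mult Q j f) g = hardy_inner f h)"
    show "h = bshift j g"
    proof (rule Q_eqI)
      fix f assume "f \<in> Q"
      with eq h show "hardy_inner f h = hardy_inner f (bshift j g)" by metis
    qed (use h bshift_in_Q[OF g] in auto)
  qed
qed

lemma cross_commutator_eq:
  assumes "f \<in> Q"
  shows "cross_commutator Q i j f = (\<lambda>z. proj (coord_mult i (bshift j f)) z - bshift j (proj (coord_mult i f)) z)"
  unfolding cross_commutator_def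
  using assms
  by (simp add: hardy_adjoint_eq compressed_mult_eq bshift_in_Q proj_in_Q coord_mult_in_hardy_space Q_hardy_space)

lemma cross_commutator_in_hardy_space:
  assumes "f \<in> Q"
  shows "cross_commutator Q i j f \<in> hardy_space"
  unfolding cross_commutator_eq[OF assms]
  by (intro hardy_space_diff bshift_in_hardy_space Q_hardy_space proj_in_Q coord_mult_in_hardy_space assms)

text \<open>Adjoint form of the fact that multiplications by \<theta> and by z_j commute.\<close>

lemma adj_bshift:
  assumes "g \<in> hardy_space"
  shows "adj (bshift j g) = bshift j (adj g)"
  by (rule adj_eqI)
     (simp_all add: assms bshift_in_hardy_space adj_in_hardy_space hardy_inner_bshift hardy_inner_adj
        mul_in_hardy_space coord_mult_in_hardy_space coord_mult_mul)

definition dif :: "'n \<Rightarrow> complex ^ 'n \<Rightarrow> complex" where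
  "dif i z = \<theta> z - \<theta> (vupd i 0 z)"

text \<open>The factor \<open>z\<^sub>j\<close> keeps the difference quotient \<open>dif j z / z\<^sub>j\<close> out of the formula.\<close>

lemma cross_commutator_off_diagonal:
  assumes f: "f \<in> Q" and ij: "i \<noteq> j" and z: "z \<in> polydisc"
  shows "z $ j * cross_commutator Q i j f z = dif j z * adj (coord_mult i f) (vupd j 0 z)"
proof -
  let ?y = "coord_mult i f"
  note fH = Q_hardy_space[OF f]
  note y = coord_mult_in_hardy_space[OF fH, of i]
  \<comment> \<open>For \<open>i \<noteq> j\<close> the two operators act on different variables and
    commute.\<close>
  have "coord_mult i (bshift j f) = bshift j ?y"
  proof (rule coord_mult_cancel[of _ _ j])
    fix z :: "complex ^ 'n" assume z: "z \<in> polydisc"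
    have "z $ j * coord_mult i (bshift j f) z = z $ i * (z $ j * bshift j f z)"
      by (simp add: coord_mult_def)
    also have "\<dots> = z $ j * bshift j ?y z"
      unfolding bshift_eq[OF fH z] bshift_eq[OF y z] using ij
      by (simp add: coord_mult_def vupd_nth algebra_simps)
    finally show "z $ j * coord_mult i (bshift j f) z = z $ j * bshift j ?y z" .
  qed (intro coord_mult_in_hardy_space bshift_in_hardy_space fH)+
  hence cc: "cross_commutator Q i j f z = bshift j ?y z - \<theta> z * bshift j (adj ?y) z - bshift j (proj ?y) z"
    unfolding cross_commutator_eq[OF f] proj_def[of "coord_mult i (bshift j f)"]
    by (simp add: adj_bshift y)
  have "z $ j * cross_commutator Q i j f z =
      z $ j * bshift j ?y z - \<theta> z * (z $ j * bshift j (adj ?y) z) - z $ j * bshift j (proj ?y) z"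
    unfolding cc by (simp add: algebra_simps)
  \<comment> \<open>With g = \<open>adj ?y\<close>, this is the product rule D_j(\<theta> g) =
    \<theta> D_j g + (D_j \<theta>) g(z with z_j = 0); the contributions of \<open>?y\<close> itself
    cancel.\<close>
  also have "\<dots> = dif j z * adj ?y (vupd j 0 z)"
    unfolding bshift_eq[OF y z] bshift_eq[OF adj_in_hardy_space[OF y] z] bshift_eq[OF Q_hardy_space[OF proj_in_Q[OF y]] z]
    by (simp add: proj_def dif_def algebra_simps)
  finally show ?thesis .
qed

section \<open>Projected Szego kernels\<close>

lemma adj_cmult: "x \<in> hardy_space \<Longrightarrow> adj (\<lambda>z. c * x z) = (\<lambda>z. c * adj x z)"
  by (rule adj_eqI) (simp_all add: hardy_space_cmult adj_in_hardy_space hardy_inner_cmult_left hardy_inner_adj)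

lemma adj_diff:
  "x \<in> hardy_space \<Longrightarrow> y \<in> hardy_space \<Longrightarrow> adj (\<lambda>z. x z - y z) = (\<lambda>z. adj x z - adj y z)"
  by (rule adj_eqI)
     (simp_all add: hardy_space_diff adj_in_hardy_space hardy_inner_diff_left hardy_inner_adj mul_in_hardy_space)

text \<open>The overview's f_w scaled by \<open>c\<close>, which will be the reciprocal of the
  kernel norm.\<close>

definition qkern :: "complex \<Rightarrow> complex ^ 'n \<Rightarrow> complex ^ 'n \<Rightarrow> complex" where
  "qkern c w = proj (\<lambda>z. c * kern w z)"

lemma qkern_in_Q: "w \<in> polydisc \<Longrightarrow> qkern c w \<in> Q"
  unfolding qkern_def by (intro proj_in_Q hardy_space_cmult kern_in_hardy_space)

lemma qkern_eq:
  assumes "w \<in> polydisc"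
  shows "qkern c w z = c * (1 - \<theta> z * cnj (\<theta> w)) * kern w z"
  unfolding qkern_def proj_def
  by (simp add: adj_cmult adj_kern kern_in_hardy_space assms algebra_simps)

text \<open>Only the \<open>i\<close>-th factor of the product formula changes: u / (1 - u) = 1 / (1
  - u) - 1 with u = \<open>cnj (w $ i) * z $ i\<close>.\<close>

lemma coord_mult_kern:
  assumes "w \<in> polydisc"
  shows "cnj (w $ i) * coord_mult i (kern w) z = kern w z - kern (vupd i 0 w) z"
proof (cases "z \<in> polydisc")
  case True
  have w0: "vupd i 0 w \<in> polydisc" using assms by (simp add: vupd_in_polydisc)
  have ne: "1 - cnj (w $ i) * z $ i \<noteq> 0"
  proof
    assume "1 - cnj (w $ i) * z $ i = 0"
    hence "cmod (cnj (w $ i) * z $ i) = 1" by simp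
    moreover have "cmod (cnj (w $ i) * z $ i) < 1"
      using assms True mult_strict_mono'[of "cmod (w $ i)" 1 "cmod (z $ i)" 1] by (simp add: polydisc_def norm_mult)
    ultimately show False by simp
  qed
  let ?P = "\<Prod>l\<in>UNIV - {i}. 1 / (1 - cnj (w $ l) * z $ l)"
  have "kern w z = 1 / (1 - cnj (w $ i) * z $ i) * ?P"
    unfolding kern_eq[OF assms True] by (rule prod.remove) auto
  moreover have "kern (vupd i 0 w) z = ?P"
    unfolding kern_eq[OF w0 True] by (subst prod.remove[of _ i]) (auto simp: vupd_nth intro!: prod.cong)
  ultimately show ?thesis
    using ne by (simp add: coord_mult_def divide_simps) (simp add: algebra_simps)
next
  case False
  then show ?thesis
    using assms by (simp add: coord_mult_def hardy_space_outside[OF kern_in_hardy_space] vupd_in_polydisc)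
qed

text \<open>After the factor \<open>cnj (w $ i)\<close> everything is a combination of two kernels
  and of \<theta> times them, on which \<open>adj\<close> is known. The terms with
  \<open>kern w\<close> cancel.\<close>

lemma adj_coord_mult_qkern:
  assumes w: "w \<in> polydisc"
  shows "cnj (w $ i) * adj (coord_mult i (qkern c w)) z = c * cnj (dif i w) * kern (vupd i 0 w) z"
proof -
  have w0: "vupd i 0 w \<in> polydisc" using w by (simp add: vupd_in_polydisc)
  note k = kern_in_hardy_space[OF w] and k0 = kern_in_hardy_space[OF w0]
  let ?K = "\<lambda>z. kern w z - kern (vupd i 0 w) z"
  have K: "?K \<in> hardy_space" by (intro hardy_space_diff k k0)
  have "(\<lambda>z. cnj (w $ i) * adj (coord_mult i (qkern c w)) z) = adj (\<lambda>z. cnj (w $ i) * coord_mult i (qkern c w) z)"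
    by (intro adj_cmult[symmetric] coord_mult_in_hardy_space Q_hardy_space qkern_in_Q w)
  also have "(\<lambda>z. cnj (w $ i) * coord_mult i (qkern c w) z) = (\<lambda>z. c * ?K z - mul (\<lambda>z. c * cnj (\<theta> w) * ?K z) z)"
    unfolding coord_mult_kern[OF w, symmetric] by (simp add: fun_eq_iff qkern_eq[OF w] coord_mult_def algebra_simps)
  also have "adj \<dots> = (\<lambda>z. adj (\<lambda>z. c * ?K z) z - adj (mul (\<lambda>z. c * cnj (\<theta> w) * ?K z)) z)"
    by (intro adj_diff hardy_space_cmult mul_in_hardy_space K)
  also have "\<dots> = (\<lambda>z. c * (cnj (\<theta> w) * kern w z - cnj (\<theta> (vupd i 0 w)) * kern (vupd i 0 w) z) - c * cnj (\<theta> w) * ?K z)"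
    by (simp only: adj_mul[OF hardy_space_cmult[OF K]] adj_cmult[OF K] adj_diff[OF k k0] adj_kern w w0)
  finally show ?thesis
    by (auto simp: fun_eq_iff dif_def algebra_simps)
qed

text \<open>A projection may be dropped from one side of an inner product with itself; what remains
  is a kernel pairing, that is, the value of \<open>qkern c w\<close> at \<open>w\<close>.\<close>

lemma qkern_norm:
  assumes w: "w \<in> polydisc"
  shows "(hardy_norm (qkern c w))\<^sup>2 = (cmod c)\<^sup>2 * (1 - (cmod (\<theta> w))\<^sup>2) * (hardy_norm (kern w))\<^sup>2"
proof -
  note k = kern_in_hardy_space[OF w] and q = qkern_in_Q[OF w, of c]
  have "complex_of_real ((hardy_norm (qkern c w))\<^sup>2) = hardy_inner (qkern c w) (qkern c w)"
    by (simp add: hardy_inner_self Q_hardy_space q)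
  also have "\<dots> = hardy_inner (\<lambda>z. c * kern w z) (qkern c w)"
    using hardy_inner_proj[OF hardy_space_cmult[OF k] q, of c] by (simp add: qkern_def)
  also have "\<dots> = c * cnj (qkern c w w)"
    using kern_reproducing[OF Q_hardy_space[OF q] w]
    by (simp add: hardy_inner_cmult_left k hardy_inner_commute[of "kern w"])
  also have "\<dots> = (c * cnj c) * (1 - \<theta> w * cnj (\<theta> w)) * cnj (kern w w)"
    by (simp add: qkern_eq w mult_ac)
  also have "kern w w = of_real ((hardy_norm (kern w))\<^sup>2)"
    using kern_reproducing[OF k w] by (simp add: hardy_inner_self k)
  finally have "complex_of_real ((hardy_norm (qkern c w))\<^sup>2) =
      complex_of_real ((cmod c)\<^sup>2 * (1 - (cmod (\<theta> w))\<^sup>2) * (hardy_norm (kern w))\<^sup>2)"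
    by (simp only: complex_norm_square[symmetric] complex_cnj_complex_of_real complex_cnj_power of_real_mult of_real_diff of_real_power of_real_1)
  then show ?thesis unfolding of_real_eq_iff .
qed

end

section \<open>Growth of the Szego kernel near the boundary\<close>

lemma kern_norm_ge:
  assumes "w \<in> polydisc"
  shows "1 / (1 - (cmod (w $ k))\<^sup>2) \<le> (hardy_norm (kern w))\<^sup>2"
proof -
  have lt: "(cmod (w $ i))\<^sup>2 < 1" for i
    using assms by (simp add: polydisc_def abs_square_less_1)
  hence ge: "1 \<le> 1 / (1 - (cmod (w $ i))\<^sup>2)" for i by simp
  have "1 / (1 - (cmod (w $ k))\<^sup>2) * 1 \<le> 1 / (1 - (cmod (w $ k))\<^sup>2) * (\<Prod>i\<in>UNIV - {k}. 1 / (1 - (cmod (w $ i))\<^sup>2))"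
    using ge lt[of k] by (intro mult_left_mono prod_ge_1) auto
  also have "\<dots> = (hardy_norm (kern w))\<^sup>2"
    unfolding kern_norm[OF assms] by (rule prod.remove[symmetric]) auto
  finally show ?thesis by simp
qed

lemma kern_norm_pos: "w \<in> polydisc \<Longrightarrow> hardy_norm (kern w) > 0"
proof -
  assume w: "w \<in> polydisc"
  have "0 < (\<Prod>i\<in>UNIV. 1 / (1 - (cmod (w $ i))\<^sup>2))"
    using w by (intro prod_pos) (simp add: polydisc_def abs_square_less_1)
  hence "(hardy_norm (kern w))\<^sup>2 > 0" using kern_norm[OF w] by simp
  then show ?thesis by (simp add: less_le)
qed

text \<open>One coordinate approaching the circle is enough, since all other factors of the squared
  norm are at least 1.\<close>

lemma kern_norm_inverse_tendsto_0:
  assumes w: "\<And>m::nat. w m \<in> polydisc" and lim: "(\<lambda>m. cmod (w m $ k)) \<longlonglongrightarrow> 1"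
  shows "(\<lambda>m. inverse (hardy_norm (kern (w m)))) \<longlonglongrightarrow> 0"
proof (rule Lim_null_comparison)
  show "\<forall>\<^sub>F m in sequentially. norm (inverse (hardy_norm (kern (w m)))) \<le> sqrt (1 - (cmod (w m $ k))\<^sup>2)"
  proof (intro always_eventually allI)
    fix m
    have "1 - (cmod (w m $ k))\<^sup>2 > 0"
      using w[of m] by (simp add: polydisc_def abs_square_less_1)
    hence "inverse ((hardy_norm (kern (w m)))\<^sup>2) \<le> 1 - (cmod (w m $ k))\<^sup>2"
      using kern_norm_ge[OF w, of m k] kern_norm_pos[OF w, of m] by (simp add: field_simps)
    then show "norm (inverse (hardy_norm (kern (w m)))) \<le> sqrt (1 - (cmod (w m $ k))\<^sup>2)"
      by (intro real_le_rsqrt) (simp add: power_inverse)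
  qed
  show "(\<lambda>m. sqrt (1 - (cmod (w m $ k))\<^sup>2)) \<longlonglongrightarrow> 0"
    by (rule tendsto_eq_intros lim refl)+ simp
qed

text \<open>The bound is uniform in \<open>w\<close>, so at a fixed \<open>z\<close> the normalised
  kernels vanish in the limit.\<close>

lemma kern_bound:
  assumes "w \<in> polydisc" "z \<in> polydisc"
  shows "cmod (kern w z) \<le> (\<Prod>i\<in>UNIV. 1 / (1 - cmod (z $ i)))"
  unfolding kern_eq[OF assms] prod_norm[symmetric]
proof (intro prod_mono conjI norm_ge_zero)
  fix i
  have "cmod (cnj (w $ i) * z $ i) \<le> cmod (z $ i)"
    using assms unfolding norm_mult complex_mod_cnj
    by (intro mult_left_le_one_le) (auto simp: polydisc_def less_imp_le)
  hence "1 - cmod (z $ i) \<le> cmod (1 - cnj (w $ i) * z $ i)"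
    using norm_triangle_ineq2[of 1 "cnj (w $ i) * z $ i"] by simp
  moreover have "1 - cmod (z $ i) > 0" using assms by (simp add: polydisc_def)
  ultimately show "cmod (1 / (1 - cnj (w $ i) * z $ i)) \<le> 1 / (1 - cmod (z $ i))"
    by (simp add: norm_divide frac_le)
qed

section \<open>Failure of compactness\<close>

text \<open>The factor 1/2 spares an attained maximum: if all values on the circle were smaller, the
  maximum principle would bound \<open>cmod (q a)\<close> by its own half.\<close>

lemma maximum_modulus_circle:
  assumes q: "q holomorphic_on ball 0 1" and a: "cmod a < r" "r < 1" "q a \<noteq> 0"
  obtains t where "cmod t = r" "cmod (q a) / 2 \<le> cmod (q t)"
proof -
  have "\<exists>t. cmod t = r \<and> cmod (q a) / 2 \<le> cmod (q t)"
  proof (rule ccontr)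
    assume "\<nexists>t. cmod t = r \<and> cmod (q a) / 2 \<le> cmod (q t)"
    hence le: "cmod (q t) \<le> cmod (q a) / 2" if "t \<in> frontier (cball 0 r)" for t
      using that by force
    have r: "r > 0" using a(1) norm_ge_zero[of a] by linarith
    have "cball 0 r \<subseteq> ball (0::complex) 1" "ball 0 r \<subseteq> ball (0::complex) 1" using a(2) by auto
    with q have "cmod (q a) \<le> cmod (q a) / 2"
      by (intro maximum_modulus_frontier[of q "cball 0 r", OF _ _ _ le])
         (use a r in \<open>auto intro: holomorphic_on_subset holomorphic_on_imp_continuous_on continuous_on_subset\<close>)
    with a(3) show False by simp
  qed
  with that show ?thesis by blast
qed

text \<open>Otherwise \<open>f\<close> vanishes on the nonempty open set where \<open>g\<close> does
  not, and the identity theorem makes it zero.\<close>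

lemma holomorphic_common_nonzero:
  assumes f: "f holomorphic_on ball 0 1" and g: "g holomorphic_on ball 0 1"
    and "a \<in> ball 0 1" "f a \<noteq> 0" "b \<in> ball 0 1" "g b \<noteq> 0"
  obtains t where "t \<in> ball 0 1" "f t \<noteq> 0" "g t \<noteq> (0::complex)"
proof (rule ccontr)
  assume "\<not> thesis"
  with that have fg: "t \<in> ball 0 1 \<Longrightarrow> g t \<noteq> 0 \<Longrightarrow> f t = 0" for t by blast
  let ?S = "{t \<in> ball 0 1. g t \<in> - {0}}"
  have "open ?S"
    by (rule continuous_open_preimage[OF holomorphic_on_imp_continuous_on[OF g], unfolded vimage_def Int_def mem_Collect_eq]) auto
  hence "f a = (\<lambda>_. 0) a"
    by (rule analytic_continuation_open[of ?S "ball 0 1"]) (use assms fg in auto)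
  with assms show False by simp
qed

lemma vupd_commute: "i \<noteq> l \<Longrightarrow> vupd i w (vupd l t a) = vupd l t (vupd i w a)"
  by (simp add: vec_eq_iff vupd_nth)

lemma vupd_self [simp]: "vupd i (z $ i) z = z"
  by (simp add: vec_eq_iff vupd_nth)

lemma vupd_vupd [simp]: "vupd i s (vupd i t z) = vupd i s z"
  by (simp add: vec_eq_iff vupd_nth)

text \<open>The factors for \<open>i\<close> and \<open>j\<close> are 1 because one argument
  vanishes there; the others are diagonal since \<open>a\<close> and \<open>b\<close> agree. What
  remains is each squared kernel norm stripped of its factors \<open>i\<close> and
  \<open>j\<close>.\<close>

lemma kern_off_diagonal:
  assumes a: "a \<in> polydisc" and b: "b \<in> polydisc" and ij: "i \<noteq> j"
    and ab: "\<And>l. l \<noteq> i \<Longrightarrow> l \<noteq> j \<Longrightarrow> a $ l = b $ l"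
  shows "kern (vupd i 0 a) (vupd j 0 b) = of_real (sqrt ((1 - (cmod (a $ i))\<^sup>2) * (1 - (cmod (a $ j))\<^sup>2) *
      ((1 - (cmod (b $ i))\<^sup>2) * (1 - (cmod (b $ j))\<^sup>2))) * (hardy_norm (kern a) * hardy_norm (kern b)))"
proof -
  let ?P = "\<lambda>w. \<Prod>l\<in>UNIV - {i, j}. 1 / (1 - (cmod (w $ l))\<^sup>2)"
  let ?\<rho> = "\<lambda>w. (1 - (cmod (w $ i))\<^sup>2) * (1 - (cmod (w $ j))\<^sup>2)"
  have lt: "(cmod (w $ l))\<^sup>2 < 1" if "w \<in> polydisc" for w :: "complex ^ 'a" and l
    using that by (simp add: polydisc_def abs_square_less_1)
  have P: "?P w = ?\<rho> w * (hardy_norm (kern w))\<^sup>2" if w: "w \<in> polydisc" for w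
  proof -
    have "(hardy_norm (kern w))\<^sup>2 = 1 / (1 - (cmod (w $ i))\<^sup>2) * (\<Prod>l\<in>UNIV - {i}. 1 / (1 - (cmod (w $ l))\<^sup>2))"
      unfolding kern_norm[OF w] by (rule prod.remove) auto
    also have "(\<Prod>l\<in>UNIV - {i}. 1 / (1 - (cmod (w $ l))\<^sup>2)) = 1 / (1 - (cmod (w $ j))\<^sup>2) * (\<Prod>l\<in>UNIV - {i} - {j}. 1 / (1 - (cmod (w $ l))\<^sup>2))"
      using ij by (intro prod.remove) auto
    also have "UNIV - {i} - {j} = UNIV - {i, j}" by auto
    finally show ?thesis using lt[OF w, of i] lt[OF w, of j] by simp
  qed
  have Pab: "?P a = ?P b" using ab by (intro prod.cong) auto
  have P0: "?P a \<ge> 0" using lt[OF a] by (intro prod_nonneg) (simp add: less_imp_le)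
  \<comment> \<open>Reading the common product once at \<open>a\<close> and once at \<open>b\<close>
    brings in both kernel norms.\<close>
  have "(?P a)\<^sup>2 = ?P a * ?P b" unfolding Pab[symmetric] by (rule power2_eq_square)
  also have "\<dots> = (?\<rho> a * (hardy_norm (kern a))\<^sup>2) * (?\<rho> b * (hardy_norm (kern b))\<^sup>2)"
    by (simp only: P[OF a] P[OF b])
  also have "\<dots> = (?\<rho> a * ?\<rho> b) * (hardy_norm (kern a) * hardy_norm (kern b))\<^sup>2"
    by (simp only: power_mult_distrib mult_ac)
  finally have "?P a = sqrt ((?\<rho> a * ?\<rho> b) * (hardy_norm (kern a) * hardy_norm (kern b))\<^sup>2)"
    using P0 by (metis real_sqrt_unique)
  hence "?P a = sqrt (?\<rho> a * ?\<rho> b) * (hardy_norm (kern a) * hardy_norm (kern b))"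
    by (simp add: real_sqrt_mult)
  moreover have "kern (vupd i 0 a) (vupd j 0 b) = of_real (?P a)"
  proof -
    have "kern (vupd i 0 a) (vupd j 0 b) = (\<Prod>l\<in>UNIV. 1 / (1 - cnj (vupd i 0 a $ l) * vupd j 0 b $ l))"
      using a b by (intro kern_eq vupd_in_polydisc) auto
    also have "\<dots> = (\<Prod>l\<in>UNIV - {i, j}. 1 / (1 - cnj (vupd i 0 a $ l) * vupd j 0 b $ l))"
      by (rule prod.mono_neutral_right) (auto simp: vupd_nth)
    also have "\<dots> = (\<Prod>l\<in>UNIV - {i, j}. of_real (1 / (1 - (cmod (a $ l))\<^sup>2)))"
    proof (rule prod.cong[OF refl])
      fix l assume l: "l \<in> UNIV - {i, j}"
      have "cnj (a $ l) * a $ l = of_real ((cmod (a $ l))\<^sup>2)"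
        by (metis complex_norm_square mult.commute)
      then show "1 / (1 - cnj (vupd i 0 a $ l) * vupd j 0 b $ l) = of_real (1 / (1 - (cmod (a $ l))\<^sup>2))"
        using l ab[of l] by (simp add: vupd_nth)
    qed
    finally show ?thesis by simp
  qed
  ultimately show ?thesis by simp
qed

context inner_multiplier
begin

text \<open>The squared norm of \<open>qkern 1 w\<close> cannot be negative.\<close>

lemma norm_inner_le_1:
  assumes "w \<in> polydisc"
  shows "cmod (\<theta> w) \<le> 1"
proof -
  have "0 \<le> (1 - (cmod (\<theta> w))\<^sup>2) * (hardy_norm (kern w))\<^sup>2"
    using qkern_norm[OF assms, of 1] by (metis mult_1 norm_one one_power2 zero_le_power2)
  hence "(cmod (\<theta> w))\<^sup>2 \<le> 1"
    using kern_norm_pos[OF assms] by (simp add: zero_le_mult_iff)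
  then show ?thesis by (simp add: abs_square_le_1)
qed

lemma dif_bound: "z \<in> polydisc \<Longrightarrow> cmod (dif i z) \<le> 2"
  using norm_triangle_ineq4[of "\<theta> z" "\<theta> (vupd i 0 z)"] norm_inner_le_1[of z]
    norm_inner_le_1[of "vupd i 0 z"] by (simp add: dif_def vupd_in_polydisc)

lemma slice_holomorphic: "a \<in> polydisc \<Longrightarrow> (\<lambda>t. \<theta> (vupd l t a)) holomorphic_on ball 0 1"
  using holo by (simp add: polydisc_holomorphic_def vupd_def)

lemma dif_slice_holomorphic:
  assumes "a \<in> polydisc" "i \<noteq> l"
  shows "(\<lambda>t. dif i (vupd l t a)) holomorphic_on ball 0 1"
  unfolding dif_def vupd_commute[OF assms(2)]
  by (intro holomorphic_intros slice_holomorphic vupd_in_polydisc assms) auto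

text \<open>Normalised by the norm of the full kernel, so that the norm is at most 1 and equals an
  explicit function of |\<theta>(w)|.\<close>

abbreviation nqkern :: "complex ^ 'n \<Rightarrow> complex ^ 'n \<Rightarrow> complex" where
  "nqkern w \<equiv> qkern (of_real (inverse (hardy_norm (kern w)))) w"

lemma nqkern_norm:
  assumes "w \<in> polydisc"
  shows "(hardy_norm (nqkern w))\<^sup>2 = 1 - (cmod (\<theta> w))\<^sup>2"
proof -
  let ?N = "hardy_norm (kern w)"
  have "(cmod (of_real (inverse ?N)))\<^sup>2 * ?N\<^sup>2 = 1"
    using kern_norm_pos[OF assms] unfolding norm_of_real power2_abs by (simp add: power_inverse)
  moreover have "x * y * z = y" if "x * z = 1" for x y z :: real
    using that by (metis mult.commute mult.left_commute mult_1_right)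
  ultimately show ?thesis
    unfolding qkern_norm[OF assms] by blast
qed

lemma nqkern_norm_le_1:
  assumes "w \<in> polydisc"
  shows "hardy_norm (nqkern w) \<le> 1"
proof (rule power2_le_imp_le)
  show "(hardy_norm (nqkern w))\<^sup>2 \<le> 1\<^sup>2"
    unfolding nqkern_norm[OF assms] by simp
qed simp

lemma nqkern_null_subsequence:
  assumes T: "compact_operator_on Q (cross_commutator Q i j)" and w: "\<And>m::nat. w m \<in> polydisc"
    and lim: "\<And>z. z \<in> polydisc \<Longrightarrow> z $ j \<noteq> 0 \<Longrightarrow> (\<lambda>m. cross_commutator Q i j (nqkern (w m)) z) \<longlonglongrightarrow> 0"
  shows "\<exists>s :: nat \<Rightarrow> nat. strict_mono s \<and>
    (\<lambda>m. hardy_norm (cross_commutator Q i j (nqkern (w (s m))))) \<longlonglongrightarrow> 0"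
proof -
  have QH: "Q \<subseteq> hardy_space" using Q_hardy_space by blast
  show ?thesis
  proof (rule compact_operator_pointwise_null[OF T QH, where f = "\<lambda>m. nqkern (w m)" and C = 1 and j = j])
    show "nqkern (w m) \<in> Q" for m by (rule qkern_in_Q[OF w])
    show "hardy_norm (nqkern (w m)) \<le> 1" for m by (rule nqkern_norm_le_1[OF w])
  qed (use lim cross_commutator_in_hardy_space in blast)+
qed

text \<open>Both points move along the same coordinate \<open>k\<close>. At the moving
  \<open>v m\<close> the kernel grows like the product of the two kernel norms: one is absorbed by
  the normalisation, the other by point evaluation, so the commutator norms stay away from
  0.\<close>

lemma dif_product_eq_0:
  assumes T: "compact_operator_on Q (cross_commutator Q i j)" and ij: "i \<noteq> j" and k: "k \<noteq> i" "k \<noteq> j"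
    and a: "a \<in> polydisc" and b: "b \<in> polydisc"
    and ab: "\<And>l. l \<noteq> i \<Longrightarrow> l \<noteq> j \<Longrightarrow> a $ l = b $ l"
  shows "dif i a * dif j b = 0"
proof (rule ccontr)
  assume ne: "dif i a * dif j b \<noteq> 0"
  let ?T = "cross_commutator Q i j"
  \<comment> \<open>Needed to remove the factor \<open>cnj (a $ i)\<close> from
    \<open>formula\<close> below.\<close>
  have ai: "a $ i \<noteq> 0"
  proof
    assume "a $ i = 0"
    hence "vupd i 0 a = a" by (metis vupd_self)
    with ne show False by (simp add: dif_def)
  qed
  let ?q = "\<lambda>t. dif i (vupd k t a) * dif j (vupd k t b)"
  have q: "?q holomorphic_on ball 0 1"
    using k by (intro holomorphic_intros dif_slice_holomorphic a b) auto
  have qa: "?q (a $ k) = dif i a * dif j b"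
    using vupd_self[of k a] vupd_self[of k b] ab[OF k] by simp
  define \<delta> where "\<delta> = cmod (dif i a * dif j b) / 2"
  have \<delta>: "\<delta> > 0" using ne by (simp add: \<delta>_def)
  \<comment> \<open>Radii tending to 1; the 2 puts \<open>r 0\<close> strictly above |a_k|.\<close>
  define r where "r = (\<lambda>m::nat. 1 - (1 - cmod (a $ k)) / (real m + 2))"
  have ak: "cmod (a $ k) < 1" using a by (simp add: polydisc_def)
  have r: "cmod (a $ k) < r m" "r m < 1" for m
  proof -
    have "(1 - cmod (a $ k)) / (real m + 2) < (1 - cmod (a $ k)) / 1"
      using ak by (intro divide_strict_left_mono) auto
    then show "cmod (a $ k) < r m" by (simp add: r_def)
    show "r m < 1" using ak by (simp add: r_def)
  qed
  have "\<exists>t. cmod t = r m \<and> \<delta> \<le> cmod (?q t)" for m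
  proof -
    obtain t where "cmod t = r m" "cmod (?q (a $ k)) / 2 \<le> cmod (?q t)"
      using maximum_modulus_circle[OF q r(1)[of m] r(2)[of m]] ne unfolding qa by blast
    then show ?thesis unfolding qa \<delta>_def by blast
  qed
  hence "\<exists>t. \<forall>m. cmod (t m) = r m \<and> \<delta> \<le> cmod (?q (t m))"
    by (intro choice allI)
  then obtain t where "\<forall>m. cmod (t m) = r m \<and> \<delta> \<le> cmod (?q (t m))" ..
  hence t: "\<And>m. cmod (t m) = r m" "\<And>m. \<delta> \<le> cmod (?q (t m))" by auto
  define w where "w = (\<lambda>m. vupd k (t m) a)"
  define v where "v = (\<lambda>m. vupd k (t m) b)"
  have w: "w m \<in> polydisc" and v: "v m \<in> polydisc" for m
    using t(1)[of m] r(2)[of m] a b by (auto simp: w_def v_def intro: vupd_in_polydisc)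
  have w0: "vupd i 0 (w m) \<in> polydisc" for m using w by (simp add: vupd_in_polydisc)
  have wi: "w m $ i = a $ i" "w m $ j = a $ j" "v m $ i = b $ i" "v m $ j = b $ j" for m
    using k by (auto simp: w_def v_def vupd_nth)
  let ?N = "\<lambda>w. hardy_norm (kern w)"
  let ?F = "\<lambda>m. nqkern (w m)"
  have formula: "cnj (a $ i) * (z $ j * ?T (?F m) z) =
      of_real (inverse (?N (w m))) * (cnj (dif i (w m)) * dif j z * kern (vupd i 0 (w m)) (vupd j 0 z))"
    if z: "z \<in> polydisc" for m z
    unfolding cross_commutator_off_diagonal[OF qkern_in_Q[OF w] ij z]
    using adj_coord_mult_qkern[OF w[of m], of i "of_real (inverse (?N (w m)))" "vupd j 0 z"]
    unfolding wi by (simp add: mult_ac)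
  have rl: "r \<longlonglongrightarrow> 1" unfolding r_def by real_asymp
  have Nl: "(\<lambda>m. inverse (?N (w m))) \<longlonglongrightarrow> 0"
    by (rule kern_norm_inverse_tendsto_0[OF w, where k = k]) (simp add: w_def vupd_nth t rl)
  have lim: "(\<lambda>m. ?T (?F m) z) \<longlonglongrightarrow> 0" if z: "z \<in> polydisc" "z $ j \<noteq> 0" for z
  proof -
    \<comment> \<open>Each 2 bounds one of the two differences of \<theta>; the product bounds the
      kernel for all \<open>m\<close> at once.\<close>
    let ?C = "2 * 2 * (\<Prod>l\<in>UNIV. 1 / (1 - cmod (vupd j 0 z $ l)))"
    have zj: "vupd j 0 z \<in> polydisc" using z by (simp add: vupd_in_polydisc)
    have "(\<lambda>m. cnj (a $ i) * (z $ j * ?T (?F m) z)) \<longlonglongrightarrow> 0"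
    proof (rule Lim_null_comparison)
      show "\<forall>\<^sub>F m in sequentially. norm (cnj (a $ i) * (z $ j * ?T (?F m) z)) \<le> inverse (?N (w m)) * ?C"
      proof (intro always_eventually allI)
        fix m
        have "norm (cnj (a $ i) * (z $ j * ?T (?F m) z)) =
          inverse (?N (w m)) * (cmod (dif i (w m)) * cmod (dif j z) * cmod (kern (vupd i 0 (w m)) (vupd j 0 z)))"
          unfolding formula[OF z(1)] using kern_norm_pos[OF w, of m] by (simp add: norm_mult norm_inverse)
        also have "\<dots> \<le> inverse (?N (w m)) * ?C"
          using kern_norm_pos[OF w, of m]
          by (intro mult_left_mono mult_mono dif_bound kern_bound w z(1) w0 zj) auto
        finally show "norm (cnj (a $ i) * (z $ j * ?T (?F m) z)) \<le> inverse (?N (w m)) * ?C" .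
      qed
      show "(\<lambda>m. inverse (?N (w m)) * ?C) \<longlonglongrightarrow> 0"
        using Nl by (rule tendsto_mult_left_zero)
    qed
    hence "(\<lambda>m. (cnj (a $ i) * z $ j) * ?T (?F m) z) \<longlonglongrightarrow> (cnj (a $ i) * z $ j) * 0"
      by (simp add: mult.assoc)
    then show ?thesis
      using ai z by (subst (asm) tendsto_mult_left_iff) auto
  qed
  obtain s :: "nat \<Rightarrow> nat" where s: "strict_mono s" "(\<lambda>m. hardy_norm (?T (?F (s m)))) \<longlonglongrightarrow> 0"
    using nqkern_null_subsequence[of i j w, OF T w lim] by blast
  \<comment> \<open>\<open>\<kappa>\<close> is the ratio of the kernel value at \<open>(w\<^bsub>i:=0\<^esub>, v\<^bsub>j:=0\<^esub>)\<close> to \<open>\<parallel>K\<^sub>w\<parallel> \<parallel>K\<^sub>v\<parallel>\<close>; it does not depend on \<open>m\<close>.\<close>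
  define \<kappa> where "\<kappa> = sqrt ((1 - (cmod (a $ i))\<^sup>2) * (1 - (cmod (a $ j))\<^sup>2) *
      ((1 - (cmod (b $ i))\<^sup>2) * (1 - (cmod (b $ j))\<^sup>2)))"
  have \<kappa>: "\<kappa> > 0"
    using a b by (auto simp: \<kappa>_def polydisc_def abs_square_less_1 intro!: mult_pos_pos)
  \<comment> \<open>Testing at \<open>v m\<close> leaves a surplus factor \<open>?N (v m)\<close> on
    the left, exactly the cost of point evaluation there.\<close>
  have low: "\<kappa> * \<delta> \<le> hardy_norm (?T (?F m))" for m
  proof -
    note Nw = kern_norm_pos[OF w, of m] and Nv = kern_norm_pos[OF v, of m]
    have K: "kern (vupd i 0 (w m)) (vupd j 0 (v m)) = of_real (\<kappa> * (?N (w m) * ?N (v m)))"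
      using kern_off_diagonal[OF w v ij, of m m] ab unfolding wi \<kappa>_def by (auto simp: w_def v_def vupd_nth)
    have "\<kappa> * \<delta> * ?N (v m) \<le> \<kappa> * cmod (?q (t m)) * ?N (v m)"
      using \<kappa> Nv t(2)[of m] by (intro mult_right_mono mult_left_mono) auto
    also have "\<dots> = inverse (?N (w m)) * (cmod (dif i (w m)) * cmod (dif j (v m)) * (\<kappa> * (?N (w m) * ?N (v m))))"
      using Nw by (simp add: norm_mult w_def v_def field_simps)
    also have "\<dots> = norm (cnj (a $ i) * (v m $ j * ?T (?F m) (v m)))"
      unfolding formula[OF v] K using Nw Nv \<kappa> by (simp add: norm_mult norm_inverse)
    also have "\<dots> = (cmod (a $ i) * cmod (v m $ j)) * cmod (?T (?F m) (v m))"
      by (simp add: norm_mult)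
    also have "\<dots> \<le> 1 * cmod (?T (?F m) (v m))"
      using a v[of m] by (intro mult_right_mono mult_le_one) (auto simp: polydisc_def less_imp_le)
    also have "\<dots> \<le> hardy_norm (?T (?F m)) * ?N (v m)"
      using hardy_point_evaluation[OF cross_commutator_in_hardy_space[OF qkern_in_Q[OF w]] v] by simp
    finally show ?thesis using Nv by simp
  qed
  have "\<kappa> * \<delta> \<le> 0"
    by (rule LIMSEQ_le_const[OF s(2)]) (use low in auto)
  with \<kappa> \<delta> show False by (simp add: mult_le_0_iff)
qed

text \<open>Points where the two differences are nonzero need not agree off \<open>i\<close> and
  \<open>j\<close>. They are made to agree one coordinate at a time by a common value at which both
  slices stay nonzero.\<close>

lemma dif_eq_0_cases:
  assumes T: "compact_operator_on Q (cross_commutator Q i j)" and ij: "i \<noteq> j" and k: "k \<noteq> i" "k \<noteq> j"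
  shows "(\<forall>z\<in>polydisc. dif i z = 0) \<or> (\<forall>z\<in>polydisc. dif j z = 0)"
proof (rule ccontr)
  assume "\<not> ?thesis"
  hence ex: "\<exists>a\<in>polydisc. \<exists>b\<in>polydisc. dif i a \<noteq> 0 \<and> dif j b \<noteq> 0" by blast
  have "\<exists>a\<in>polydisc. \<exists>b\<in>polydisc. dif i a \<noteq> 0 \<and> dif j b \<noteq> 0 \<and> (\<forall>l\<in>S. a $ l = b $ l)"
    if "finite S" "i \<notin> S" "j \<notin> S" for S
    using that
  proof (induction S)
    case empty
    then show ?case using ex by simp
  next
    case (insert l S)
    then obtain a b where ab: "a \<in> polydisc" "b \<in> polydisc" "dif i a \<noteq> 0" "dif j b \<noteq> 0" "\<forall>l\<in>S. a $ l = b $ l"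
      by auto
    obtain t where t: "t \<in> ball 0 1" "dif i (vupd l t a) \<noteq> 0" "dif j (vupd l t b) \<noteq> 0"
    proof (rule holomorphic_common_nonzero)
      show "(\<lambda>t. dif i (vupd l t a)) holomorphic_on ball 0 1" "(\<lambda>t. dif j (vupd l t b)) holomorphic_on ball 0 1"
        using insert.prems by (auto intro!: dif_slice_holomorphic ab)
      show "dif i (vupd l (a $ l) a) \<noteq> 0" "dif j (vupd l (b $ l) b) \<noteq> 0" using ab by simp_all
      show "a $ l \<in> ball 0 1" "b $ l \<in> ball 0 1" using ab by (auto simp: polydisc_def)
    qed
    have "vupd l t a \<in> polydisc" "vupd l t b \<in> polydisc" using t ab by (auto intro: vupd_in_polydisc)
    moreover have "\<forall>l'\<in>insert l S. vupd l t a $ l' = vupd l t b $ l'"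
      using ab by (simp add: vupd_nth)
    ultimately show ?case using t by blast
  qed
  from this[of "UNIV - {i, j}"] obtain a b where "a \<in> polydisc" "b \<in> polydisc" "dif i a \<noteq> 0" "dif j b \<noteq> 0"
    "\<forall>l\<in>UNIV - {i, j}. a $ l = b $ l" by auto
  with dif_product_eq_0[OF T ij k, of a b] show False by auto
qed

text \<open>Here the projected kernel does not depend on z_j. The backward shift kills it, while z_j
  times it already lies in \<open>Q\<close> and is shifted back to it, so only the second term of
  the commutator survives.\<close>

lemma cross_commutator_diagonal_qkern:
  assumes dj: "\<forall>z\<in>polydisc. dif j z = 0" and w: "w \<in> polydisc" "w $ j = 0"
  shows "cross_commutator Q j j (qkern c w) = (\<lambda>z. - qkern c w z)"
proof -
  let ?F = "qkern c w"
  note F = qkern_in_Q[OF w(1), of c]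
  note FH = Q_hardy_space[OF F]
  have th: "\<theta> (vupd j 0 z) = \<theta> z" if "z \<in> polydisc" for z
    using dj that by (simp add: dif_def)
  have F0: "?F (vupd j 0 z) = ?F z" if z: "z \<in> polydisc" for z
  proof -
    have zj: "vupd j 0 z \<in> polydisc" using z by (simp add: vupd_in_polydisc)
    have "kern w (vupd j 0 z) = kern w z"
      unfolding kern_eq[OF w(1) zj] kern_eq[OF w(1) z] using w(2) by (intro prod.cong) (auto simp: vupd_nth)
    then show ?thesis by (simp add: qkern_eq w th z)
  qed
  have b0: "bshift j ?F = (\<lambda>_. 0)"
    by (rule coord_mult_cancel[of _ _ j])
       (simp_all add: bshift_in_hardy_space FH zero_in_hardy_space bshift_eq F0)
  \<comment> \<open>\<theta> is free of z_j, so it behaves as a scalar for the shift in that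
    variable.\<close>
  have bm: "bshift j (mul h) = mul (bshift j h)" if h: "h \<in> hardy_space" for h
  proof (rule coord_mult_cancel[of _ _ j])
    fix z :: "complex ^ 'n" assume z: "z \<in> polydisc"
    have "z $ j * bshift j (mul h) z = \<theta> z * (z $ j * bshift j h z)"
      unfolding bshift_eq[OF mul_in_hardy_space[OF h] z] bshift_eq[OF h z] th[OF z] by (simp add: algebra_simps)
    then show "z $ j * bshift j (mul h) z = z $ j * mul (bshift j h) z" by (simp add: mult_ac)
  qed (intro bshift_in_hardy_space mul_in_hardy_space h)+
  have z0: "hardy_inner (\<lambda>_. 0) h = 0" for h :: "complex ^ 'n \<Rightarrow> complex"
    using hardy_inner_cmult_left[OF zero_in_hardy_space, of 0 h] by simp
  have "adj (coord_mult j ?F) = (\<lambda>_. 0)"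
  proof (rule adj_eqI)
    fix h :: "complex ^ 'n \<Rightarrow> complex" assume h: "h \<in> hardy_space"
    have "hardy_inner (coord_mult j ?F) (mul h) = hardy_inner ?F (mul (bshift j h))"
      by (simp add: hardy_inner_coord_mult FH mul_in_hardy_space h bm)
    then show "hardy_inner (\<lambda>_. 0) h = hardy_inner (coord_mult j ?F) (mul h)"
      by (simp add: z0 Q_orthogonal F bshift_in_hardy_space h)
  qed (auto intro: coord_mult_in_hardy_space zero_in_hardy_space FH)
  hence p: "proj (coord_mult j ?F) = coord_mult j ?F"
    by (simp add: proj_def)
  have "adj (\<lambda>_. 0) = (\<lambda>_. 0)"
    by (rule adj_eqI) (simp_all add: zero_in_hardy_space z0)
  hence p0: "proj (coord_mult j (\<lambda>_. 0)) = (\<lambda>_. 0)"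
    by (simp add: coord_mult_def proj_def)
  have "bshift j (coord_mult j ?F) = ?F"
    by (rule coord_mult_cancel[of _ _ j])
       (simp_all add: bshift_in_hardy_space coord_mult_in_hardy_space FH bshift_eq, simp add: coord_mult_def vupd_nth)
  then show ?thesis
    unfolding cross_commutator_eq[OF F] b0 p p0 by simp
qed

text \<open>Two free variables with separate tasks: \<open>j\<close> is set to 0 for the commutator
  formula, \<open>k\<close> runs to the circle. Neither changes \<theta>, so the value stays
  \<theta>(w0) and the norms stay constant.\<close>

lemma not_compact_diagonal:
  assumes dj: "\<forall>z\<in>polydisc. dif j z = 0" and dk: "\<forall>z\<in>polydisc. dif k z = 0" and jk: "j \<noteq> k"
    and w0: "w0 \<in> polydisc" "cmod (\<theta> w0) < 1"
  shows "\<not> compact_operator_on Q (cross_commutator Q j j)"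
proof
  assume T: "compact_operator_on Q (cross_commutator Q j j)"
  let ?T = "cross_commutator Q j j"
  define t where "t = (\<lambda>m::nat. 1 - 1 / (real m + 2))"
  have t: "0 \<le> t m" "t m < 1" for m by (auto simp: t_def field_simps)
  have tl: "t \<longlonglongrightarrow> 1" unfolding t_def by real_asymp
  define w where "w = (\<lambda>m. vupd k (of_real (t m)) (vupd j 0 w0))"
  have w: "w m \<in> polydisc" for m
    using t[of m] w0 by (auto simp: w_def intro!: vupd_in_polydisc)
  have wj: "w m $ j = 0" for m using jk by (simp add: w_def vupd_nth)
  have thw: "\<theta> (w m) = \<theta> w0" for m
  proof -
    have "\<theta> (w m) = \<theta> (vupd k 0 (w m))" using dk w[of m] by (simp add: dif_def)
    also have "\<dots> = \<theta> (vupd k 0 (vupd j 0 w0))" by (simp add: w_def)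
    also have "\<dots> = \<theta> (vupd j 0 w0)" using dk vupd_in_polydisc[OF w0(1), of 0 j] by (simp add: dif_def)
    also have "\<dots> = \<theta> w0" using dj w0 by (simp add: dif_def)
    finally show ?thesis .
  qed
  let ?F = "\<lambda>m. nqkern (w m)"
  have TF: "?T (?F m) = (\<lambda>z. - 1 * ?F m z)" for m
    using cross_commutator_diagonal_qkern[OF dj w wj] by simp
  have lim: "(\<lambda>m. ?T (?F m) z) \<longlonglongrightarrow> 0" if z: "z \<in> polydisc" for z
  proof (rule Lim_null_comparison)
    let ?C = "2 * (\<Prod>l\<in>UNIV. 1 / (1 - cmod (z $ l)))"
    have b: "cmod (1 - \<theta> z * cnj (\<theta> w0)) \<le> 2"
      using norm_triangle_ineq4[of 1 "\<theta> z * cnj (\<theta> w0)"] mult_le_one[of "cmod (\<theta> z)" "cmod (\<theta> w0)"]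
        norm_inner_le_1[OF z] w0(2) by (simp add: norm_mult)
    show "\<forall>\<^sub>F m in sequentially. norm (?T (?F m) z) \<le> inverse (hardy_norm (kern (w m))) * ?C"
    proof (intro always_eventually allI)
      fix m
      have "norm (?T (?F m) z) = inverse (hardy_norm (kern (w m))) * (cmod (1 - \<theta> z * cnj (\<theta> w0)) * cmod (kern (w m) z))"
        unfolding TF qkern_eq[OF w] thw using kern_norm_pos[OF w, of m] by (simp add: norm_mult norm_inverse)
      also have "\<dots> \<le> inverse (hardy_norm (kern (w m))) * ?C"
        using kern_norm_pos[OF w, of m] by (intro mult_left_mono mult_mono b kern_bound w z) auto
      finally show "norm (?T (?F m) z) \<le> inverse (hardy_norm (kern (w m))) * ?C" .
    qed
    have "(\<lambda>m. inverse (hardy_norm (kern (w m)))) \<longlonglongrightarrow> 0"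
      by (rule kern_norm_inverse_tendsto_0[OF w, where k = k]) (use t tl in \<open>simp add: w_def vupd_nth\<close>)
    then show "(\<lambda>m. inverse (hardy_norm (kern (w m))) * ?C) \<longlonglongrightarrow> 0"
      by (rule tendsto_mult_left_zero)
  qed
  obtain s :: "nat \<Rightarrow> nat" where s: "strict_mono s" "(\<lambda>m. hardy_norm (?T (?F (s m)))) \<longlonglongrightarrow> 0"
    using nqkern_null_subsequence[of j j w, OF T w lim] by blast
  have "(hardy_norm (?T (?F m)))\<^sup>2 = 1 - (cmod (\<theta> w0))\<^sup>2" for m
    unfolding TF hardy_norm_cmult[OF Q_hardy_space[OF qkern_in_Q[OF w]]]
    using nqkern_norm[OF w, of m] by (simp add: thw)
  hence "(\<lambda>m. 1 - (cmod (\<theta> w0))\<^sup>2) \<longlonglongrightarrow> 0\<^sup>2"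
    using tendsto_power[OF s(2), of 2] by simp
  hence "1 - (cmod (\<theta> w0))\<^sup>2 = 0" by (simp add: LIMSEQ_const_iff)
  moreover have "(cmod (\<theta> w0))\<^sup>2 < 1" using w0(2) by (simp add: abs_square_less_1)
  ultimately show False by simp
qed

text \<open>Coordinates are replaced by 0 one after the other without changing \<theta>.\<close>

lemma constant_if_dif_eq_0:
  assumes "\<And>i z. z \<in> polydisc \<Longrightarrow> dif i z = 0"
  shows "\<theta> constant_on polydisc"
  unfolding constant_on_def
proof (intro exI ballI)
  fix z :: "complex ^ 'n" assume z: "z \<in> polydisc"
  have p: "(\<chi> l. if l \<in> S then 0 else z $ l) \<in> polydisc" for S
    using z by (simp add: polydisc_def)
  have "\<theta> z = \<theta> (\<chi> l. if l \<in> S then 0 else z $ l)" if "finite S" for S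
    using that
  proof (induction S)
    case (insert i S)
    have "(\<chi> l. if l \<in> insert i S then 0 else z $ l) = vupd i 0 (\<chi> l. if l \<in> S then 0 else z $ l)"
      by (simp add: vec_eq_iff vupd_nth)
    with insert assms[OF p, of i S] show ?case by (simp add: dif_def)
  qed simp
  from this[of UNIV] show "\<theta> z = \<theta> 0" by (simp add: zero_vec_def)
qed

text \<open>Otherwise |\<theta>| = 1 throughout, and the maximum principle makes the slice through
  \<open>a\<close> in direction \<open>i\<close> constant.\<close>

lemma exists_norm_less_1:
  assumes a: "a \<in> polydisc" "dif i a \<noteq> 0"
  obtains w where "w \<in> polydisc" "cmod (\<theta> w) < 1"
proof (rule ccontr)
  assume "\<not> thesis"
  with that have ge: "w \<in> polydisc \<Longrightarrow> cmod (\<theta> w) \<ge> 1" for w by force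
  let ?g = "\<lambda>t. \<theta> (vupd i t a)"
  have p: "vupd i t a \<in> polydisc" if "t \<in> ball 0 1" for t
    using that a by (auto intro: vupd_in_polydisc)
  have "?g constant_on ball 0 1"
  proof (rule maximum_modulus_principle[OF slice_holomorphic[OF a(1)], of "ball 0 1" 0])
    fix t :: complex assume "t \<in> ball 0 1"
    then show "cmod (?g t) \<le> cmod (?g 0)"
      using norm_inner_le_1[OF p, of t] ge[OF p, of 0] by auto
  qed auto
  moreover have "a $ i \<in> ball 0 1" using a by (simp add: polydisc_def)
  ultimately have "?g (a $ i) = ?g 0"
    unfolding constant_on_def by (metis centre_in_ball zero_less_one)
  with a(2) show False by (simp add: dif_def)
qed

end

theorem theorem3p1:
  fixes \<theta> :: "complex ^ 'n::finite \<Rightarrow> complex"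
  assumes "CARD('n) \<ge> 3"
    and "inner_function \<theta>"
    and "\<not> \<theta> constant_on polydisc"
  shows "\<not> essentially_normal (beurling_quotient \<theta>)"
proof
  assume "essentially_normal (beurling_quotient \<theta>)"
  hence T: "compact_operator_on (beurling_quotient \<theta>) (cross_commutator (beurling_quotient \<theta>) i j)" for i j
    by (simp add: essentially_normal_def)
  obtain B where "inner_multiplier \<theta> B" using inner_multiplierI[OF assms(2)] .
  then interpret inner_multiplier \<theta> B .
  \<comment> \<open>The dimension hypothesis enters here: two indices never exhaust the
    coordinates.\<close>
  have third: "\<exists>k. k \<noteq> i \<and> k \<noteq> j" for i j :: 'n
  proof (rule ccontr)
    assume "\<nexists>k. k \<noteq> i \<and> k \<noteq> j"
    hence "(UNIV :: 'n set) \<subseteq> {i, j}" by auto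
    hence "CARD('n) \<le> card {i, j}" by (intro card_mono) auto
    also have "\<dots> \<le> 2" by (simp add: card_insert_if)
    finally show False using assms(1) by simp
  qed
  obtain i a where a: "a \<in> polydisc" "dif i a \<noteq> 0"
    using constant_if_dif_eq_0 assms(3) by blast
  \<comment> \<open>The point \<open>a\<close> rules out the first alternative of
    \<open>dif_eq_0_cases\<close>.\<close>
  have d: "\<forall>z\<in>polydisc. dif j z = 0" if "j \<noteq> i" for j
    using third[of i j] dif_eq_0_cases[OF T, of i j] a that by metis
  obtain j where j: "j \<noteq> i" using third[of i i] by auto
  obtain k where k: "k \<noteq> i" "k \<noteq> j" using third[of i j] by auto
  obtain w where "w \<in> polydisc" "cmod (\<theta> w) < 1"
    using exists_norm_less_1[OF a] .
  \<comment> \<open>The diagonal argument needs two distinct free directions besides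
    \<open>i\<close>.\<close>
  with not_compact_diagonal[OF d[OF j] d[OF k(1)]] k(2) T show False by auto
qed

end
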